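(* For every positive integer $T$ and every $\varepsilon,m>0$, $\delta\in(0,1)$, the denominator $\sum_{S}A(S,m,\varepsilon,\delta)$ in the definition of the finite-lattice propagator $A(a\to f;m,\varepsilon,\delta,T)$ is nonzero. Moreover, for each $(x,t)\in\varepsilon\mathbb{Z}^2$ and $k\in\{1,2\}$ the limit $$\widetilde{A}^{\mathrm{loop}}_k(x,t,m,\varepsilon):=-2(-i)^k\lim_{\delta\searrow0}\lim_{T\to\infty}A(a_0\to f_k(x,t);m,\varepsilon,\delta,T)$$ exists and equals $\widetilde{A}_k(x,t,m,\varepsilon)$.
   Context: Combinatorial model. Fix an integer $T>0$ and $\varepsilon,m>0$, $\delta\in(0,1)$. The lattice is the set $\{(x,t)\in[0,T\varepsilon]^2: 2x/\varepsilon,2t/\varepsilon,(x+t)/\varepsilon\in\mathbb{Z}\}$ modulo the identifications $(x,0)\sim(x,T\varepsilon)$ and $(0,t)\sim(T\varepsilon,t)$ (a finite subset of a torus). A lattice point is even (resp. odd) if $2x/\varepsilon$ is even (resp. odd). An edge is a vector from a lattice point $(x,t)$ to the lattice point $(x+\varepsilon/2,t+\varepsilon/2)$ or $(x-\varepsilon/2,t+\varepsilon/2)$. A path is a finite sequence of distinct edges such that the endpoint of each edge is the starting point of the next. A cycle is a sequence of edges, each ending where the next starts, whose first and last edges coincide, with no other repetitions and at least one edge in between; a loop is a cycle up to changing the starting edge (removing the first edge, cyclically permuting, and appending the new first edge at the end). A node of a path or loop $s$ is an ordered pair of consecutive edges of $s$ (in the order of $s$); a turn is a node whose two edges are orthogonal;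 a node (turn) is even/odd according to whether the endpoint of its first edge is even/odd. The arrow of $s$ is $A(s)=\pm\frac{(-im\varepsilon)^{\mathrm{oddturns}(s)}(-\delta)^{\mathrm{eventurns}(s)}}{(1+m^2\varepsilon^2)^{\mathrm{oddnodes}(s)/2}(1-\delta^2)^{\mathrm{evennodes}(s)/2}}$, with the minus sign iff $s$ is a loop. A loop configuration is a set of pairwise edge-disjoint loops; a loop configuration with source $a$ and sink $f$ is an edge-disjoint set of loops and exactly one path starting with edge $a$ and ending with edge $f$. The arrow $A(S)=A(S,m,\varepsilon,\delta)$ of a configuration is the product of arrows of its loops and paths (empty product $=1$). The finite-lattice propagator is $A(a\to f;m,\varepsilon,\delta,T):=\frac{\sum_{S\text{ with source }a,\text{ sink }f}A(S)}{\sum_{S}A(S)}$, where the denominator is over all loop configurations. For $(x,t)\in\varepsilon\mathbb{Z}^2$ let $x':=x\bmod T\varepsilon$, $t':=t\bmod T\varepsilon$; $a_0$ is the edge from $(0,0)$ to $(\varepsilon/2,\varepsilon/2)$, $f_1(x,t)$ the edge from $(x',t')$ to $(x'-\varepsilon/2,t'+\varepsilon/2)$, $f_2(x,t)$ the edge from $(x',t')$ to $(x'+\varepsilon/2,t'+\varepsilon/2)$. Axiomatic propagator: for $\delta\in(0,1)$ let $A_k(x,t)=A_k(x,t,m,\varepsilon,\delta)$, $k\in\{1,2\}$, be the unique pair of complex functions on $\{(x,t)\in\mathbb{R}^2:2x/\varepsilon,2t/\varepsilon,(x+t)/\varepsilon\in\mathbb{Z}\}$ satisfying: (1) for $2x/\varepsilon,2t/\varepsilon$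 even, $A_1(x,t)=\frac{1}{\sqrt{1+m^2\varepsilon^2}}(A_1(x+\frac{\varepsilon}{2},t-\frac{\varepsilon}{2})+m\varepsilon A_2(x+\frac{\varepsilon}{2},t-\frac{\varepsilon}{2}))$, $A_2(x,t)=\frac{1}{\sqrt{1+m^2\varepsilon^2}}(A_2(x-\frac{\varepsilon}{2},t-\frac{\varepsilon}{2})-m\varepsilon A_1(x-\frac{\varepsilon}{2},t-\frac{\varepsilon}{2}))+2\delta_{x0}\delta_{t0}$; (2) for $2x/\varepsilon,2t/\varepsilon$ odd, $A_1(x,t)=\frac{1}{\sqrt{1-\delta^2}}(A_1(x+\frac{\varepsilon}{2},t-\frac{\varepsilon}{2})-i\delta A_2(x+\frac{\varepsilon}{2},t-\frac{\varepsilon}{2}))$, $A_2(x,t)=\frac{1}{\sqrt{1-\delta^2}}(A_2(x-\frac{\varepsilon}{2},t-\frac{\varepsilon}{2})+i\delta A_1(x-\frac{\varepsilon}{2},t-\frac{\varepsilon}{2}))$; (3) $\sum_{(x,t)\in\varepsilon\mathbb{Z}^2}(|A_1|^2+|A_2|^2)<\infty$ (existence, uniqueness known; $\delta_{xy}$ Kronecker delta). $\widetilde{A}_k(x,t,m,\varepsilon):=\lim_{\delta\searrow0}A_k(x,t,m,\varepsilon,\delta)$ (known to exist). *)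

theory Defs
  imports "HOL-Analysis.Analysis"
begin

text \<open>Lattice coordinates: a lattice point (x,t) is encoded by the integers
  (2x/eps, 2t/eps), normalised to 0..2T-1 (torus of side T*eps).
  An edge is (start point, direction), direction True = towards x+eps/2,
  False = towards x-eps/2; both go towards t+eps/2.\<close>

type_synonym pt = "int \<times> int"
type_synonym edge = "pt \<times> bool"

definition lat_pt :: "nat \<Rightarrow> pt \<Rightarrow> bool" where
  "lat_pt T p \<longleftrightarrow> 0 \<le> fst p \<and> fst p < 2 * int T \<and> 0 \<le> snd p \<and> snd p < 2 * int T
     \<and> even (fst p + snd p)"

definition is_edge :: "nat \<Rightarrow> edge \<Rightarrow> bool" where
  "is_edge T e \<longleftrightarrow> lat_pt T (fst e)"

definition e_end :: "nat \<Rightarrow> edge \<Rightarrow> pt" where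
  "e_end T e = ((fst (fst e) + (if snd e then 1 else -1)) mod (2 * int T),
                (snd (fst e) + 1) mod (2 * int T))"

definition chained :: "nat \<Rightarrow> edge list \<Rightarrow> bool" where
  "chained T es \<longleftrightarrow> (\<forall>k. Suc k < length es \<longrightarrow> e_end T (es ! k) = fst (es ! Suc k))"

definition is_path :: "nat \<Rightarrow> edge list \<Rightarrow> bool" where
  "is_path T p \<longleftrightarrow> p \<noteq> [] \<and> distinct p \<and> (\<forall>e\<in>set p. is_edge T e) \<and> chained T p"

definition is_cycle :: "nat \<Rightarrow> edge list \<Rightarrow> bool" where
  "is_cycle T c \<longleftrightarrow> length c \<ge> 3 \<and> hd c = last c \<and> distinct (butlast c)
     \<and> (\<forall>e\<in>set c. is_edge T e) \<and> chained T c"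

definition rot :: "edge list \<Rightarrow> edge list" where
  "rot c = tl c @ [hd (tl c)]"

definition loop_of :: "edge list \<Rightarrow> edge list set" where
  "loop_of c = range (\<lambda>k. (rot ^^ k) c)"

definition is_loop :: "nat \<Rightarrow> edge list set \<Rightarrow> bool" where
  "is_loop T l \<longleftrightarrow> (\<exists>c. is_cycle T c \<and> l = loop_of c)"

definition loop_edges :: "edge list set \<Rightarrow> edge set" where
  "loop_edges l = (\<Union>c\<in>l. set c)"

definition loop_config :: "nat \<Rightarrow> edge list set set \<Rightarrow> bool" where
  "loop_config T L \<longleftrightarrow> finite L \<and> (\<forall>l\<in>L. is_loop T l)
     \<and> (\<forall>l1\<in>L. \<forall>l2\<in>L. l1 \<noteq> l2 \<longrightarrow> loop_edges l1 \<inter> loop_edges l2 = {})"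

definition nodes :: "edge list \<Rightarrow> (edge \<times> edge) list" where
  "nodes s = zip s (tl s)"

definition arrow_nodes :: "nat \<Rightarrow> real \<Rightarrow> real \<Rightarrow> real \<Rightarrow> (edge \<times> edge) list \<Rightarrow> complex" where
  "arrow_nodes T m \<epsilon> \<delta> ns =
     (let oddn = filter (\<lambda>(e1, e2). odd (fst (e_end T e1))) ns;
          evenn = filter (\<lambda>(e1, e2). even (fst (e_end T e1))) ns;
          turn = (\<lambda>(e1 :: edge, e2 :: edge). snd e1 \<noteq> snd e2)
      in (- \<i> * complex_of_real (m * \<epsilon>)) ^ length (filter turn oddn)
         * (- complex_of_real \<delta>) ^ length (filter turn evenn)
         / (complex_of_real ((1 + m\<^sup>2 * \<epsilon>\<^sup>2) powr (real (length oddn) / 2))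
            * complex_of_real ((1 - \<delta>\<^sup>2) powr (real (length evenn) / 2))))"

definition arrow_path :: "nat \<Rightarrow> real \<Rightarrow> real \<Rightarrow> real \<Rightarrow> edge list \<Rightarrow> complex" where
  "arrow_path T m \<epsilon> \<delta> p = arrow_nodes T m \<epsilon> \<delta> (nodes p)"

definition arrow_loop :: "nat \<Rightarrow> real \<Rightarrow> real \<Rightarrow> real \<Rightarrow> edge list set \<Rightarrow> complex" where
  "arrow_loop T m \<epsilon> \<delta> l = - arrow_nodes T m \<epsilon> \<delta> (nodes (SOME c. c \<in> l))"

definition loop_configs :: "nat \<Rightarrow> edge list set set set" where
  "loop_configs T = {L. loop_config T L}"

definition configs_src_sink :: "nat \<Rightarrow> edge \<Rightarrow> edge \<Rightarrow> (edge list set set \<times> edge list) set" where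
  "configs_src_sink T a f = {(L, p). loop_config T L \<and> is_path T p \<and> hd p = a \<and> last p = f
      \<and> (\<forall>l\<in>L. set p \<inter> loop_edges l = {})}"

definition denom :: "nat \<Rightarrow> real \<Rightarrow> real \<Rightarrow> real \<Rightarrow> complex" where
  "denom T m \<epsilon> \<delta> = (\<Sum>L\<in>loop_configs T. \<Prod>l\<in>L. arrow_loop T m \<epsilon> \<delta> l)"

definition numer :: "nat \<Rightarrow> real \<Rightarrow> real \<Rightarrow> real \<Rightarrow> edge \<Rightarrow> edge \<Rightarrow> complex" where
  "numer T m \<epsilon> \<delta> a f = (\<Sum>(L, p)\<in>configs_src_sink T a f.
       arrow_path T m \<epsilon> \<delta> p * (\<Prod>l\<in>L. arrow_loop T m \<epsilon> \<delta> l))"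

definition propagator :: "edge \<Rightarrow> edge \<Rightarrow> real \<Rightarrow> real \<Rightarrow> real \<Rightarrow> nat \<Rightarrow> complex" where
  "propagator a f m \<epsilon> \<delta> T = numer T m \<epsilon> \<delta> a f / denom T m \<epsilon> \<delta>"

definition a0 :: edge where "a0 = ((0, 0), True)"

text \<open>f_k(x,t) for (x,t) = (p*eps, q*eps); k = 1 goes left, k = 2 goes right.\<close>
definition f_edge :: "nat \<Rightarrow> nat \<Rightarrow> int \<Rightarrow> int \<Rightarrow> edge" where
  "f_edge k T p q = (((2 * p) mod (2 * int T), (2 * q) mod (2 * int T)), k = 2)"

text \<open>Axiomatic propagator on the lattice {(x,t) : 2x/eps, 2t/eps, (x+t)/eps integers},
  encoded by (i,j) = (2x/eps, 2t/eps) with i+j even; values off the lattice are fixed to 0.\<close>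
definition ax_conds :: "real \<Rightarrow> real \<Rightarrow> real \<Rightarrow> (pt \<Rightarrow> complex) \<Rightarrow> (pt \<Rightarrow> complex) \<Rightarrow> bool" where
  "ax_conds m \<epsilon> \<delta> A1 A2 \<longleftrightarrow>
    (\<forall>i j. even i \<and> even j \<longrightarrow>
       A1 (i, j) = (A1 (i + 1, j - 1) + complex_of_real (m * \<epsilon>) * A2 (i + 1, j - 1))
                   / complex_of_real (sqrt (1 + m\<^sup>2 * \<epsilon>\<^sup>2))
     \<and> A2 (i, j) = (A2 (i - 1, j - 1) - complex_of_real (m * \<epsilon>) * A1 (i - 1, j - 1))
                   / complex_of_real (sqrt (1 + m\<^sup>2 * \<epsilon>\<^sup>2))
                   + (if i = 0 \<and> j = 0 then 2 else 0))
  \<and> (\<forall>i j. odd i \<and> odd j \<longrightarrow>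
       A1 (i, j) = (A1 (i + 1, j - 1) - \<i> * complex_of_real \<delta> * A2 (i + 1, j - 1))
                   / complex_of_real (sqrt (1 - \<delta>\<^sup>2))
     \<and> A2 (i, j) = (A2 (i - 1, j - 1) + \<i> * complex_of_real \<delta> * A1 (i - 1, j - 1))
                   / complex_of_real (sqrt (1 - \<delta>\<^sup>2)))
  \<and> (\<lambda>z. (cmod (A1 z))\<^sup>2 + (cmod (A2 z))\<^sup>2) summable_on {z. even (fst z) \<and> even (snd z)}
  \<and> (\<forall>z. odd (fst z + snd z) \<longrightarrow> A1 z = 0 \<and> A2 z = 0)"

definition ax_prop :: "real \<Rightarrow> real \<Rightarrow> real \<Rightarrow> (pt \<Rightarrow> complex) \<times> (pt \<Rightarrow> complex)" where
  "ax_prop m \<epsilon> \<delta> = (THE A. ax_conds m \<epsilon> \<delta> (fst A) (snd A))"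

definition A_ax :: "nat \<Rightarrow> pt \<Rightarrow> real \<Rightarrow> real \<Rightarrow> real \<Rightarrow> complex" where
  "A_ax k z m \<epsilon> \<delta> = (if k = 1 then fst (ax_prop m \<epsilon> \<delta>) z else snd (ax_prop m \<epsilon> \<delta>) z)"

text \<open>Tilde A_k(x,t,m,eps) for (x,t) = (p*eps, q*eps).\<close>
definition A_tilde :: "nat \<Rightarrow> int \<Rightarrow> int \<Rightarrow> real \<Rightarrow> real \<Rightarrow> complex" where
  "A_tilde k p q m \<epsilon> = Lim (at_right 0) (\<lambda>\<delta>. A_ax k (2 * p, 2 * q) m \<epsilon> \<delta>)"

end

theory Submission
  imports Defs "Jordan_Normal_Form.Determinant"
begin

text \<open>
  Let U be the one-step evolution on the edges of the torus. Expanding the determinant of I - U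
  over permutations and splitting these into cycles shows that the denominator is
  det(I - U) and that the numerator is a minor of it, so by Cramer's rule the propagator
  is the Green function of I - U.

  Two time steps on the edges leaving the even points form a 2x2 matrix of unit determinant, so
  everything reduces to a scalar equation: the sum over the two time neighbours, minus \<open>\<kappa>\<close> times the sum
  over the two space neighbours, minus \<open>\<i> \<mu>\<close>, with \<open>\<mu> > 0\<close>. The first two terms form a real symmetric
  operator, so pairing a homogeneous square summable solution with itself forces it to vanish.
  On the torus this makes the determinant nonzero; on the infinite lattice it is the
  uniqueness of the axiomatic propagator.

  The scalar Green function is explicit after a Fourier transform in space: the time dependence of
  a mode is \<open>l^|n| / (l - 1/l)\<close>, where \<open>l\<close> is the root of \<open>l + 1/l = 2w\<close> in the unit disc, and
  its periodization on the torus. The limit in \<open>T\<close> is the limit of Riemann sums. The integral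
  is continuous up to \<open>\<delta> = 0\<close>, where \<open>w\<close> becomes real but stays inside (-1,1). The loop and axiomatic
  propagators differ before the last limit: the even turns occur in a different place.
\<close>

section \<open>Determinants as sums over paths\<close>

text \<open>The minus sign of a loop is the sign of the expansion: a cycle of n edges has sign
  (-1)^(n-1) and brings n factors -U, so it counts as minus the product of its node weights. Along a
  path from \<open>a\<close> to \<open>f\<close> all signs cancel.

  The factor -2 (-i)^k is 2i for k = 1 and 2 for k = 2. Multiplying the amplitudes of left-moving
  edges by i turns the turn weights -i m \<epsilon> and -\<delta> into the coefficients of the
  axioms, and 2 is the strength of their source. The remaining difference is that source and sink
  sit after the even turn in the loop model and before it in the axioms; the even turn tends to the
  identity with \<delta>.

  The two limits cannot be treated alike. For \<delta> > 0 the roots \<open>l\<close> stay uniformly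
  inside the unit disc, so wrapping around the torus changes a mode by an amount exponentially small
  in T. At \<delta> = 0 the roots lie on the unit circle and this decay is lost. Only the integral
  over the momentum survives, and it does so because \<kappa> < 1 there, as m \<epsilon> >
  0.\<close>

definition perm_det :: "'a set \<Rightarrow> ('a \<Rightarrow> 'a \<Rightarrow> complex) \<Rightarrow> complex" where
  "perm_det E A = (\<Sum>p | p permutes E. of_int (sign p) * (\<Prod>i\<in>E. A i (p i)))"

text \<open>The signed cofactor with row \<open>f\<close> and column \<open>a\<close> deleted.
  Keeping full permutations with \<open>p f = a\<close> instead of bijections between two different
  sets leaves the sign to \<open>sign p\<close>.\<close>

definition perm_minor :: "'a set \<Rightarrow> ('a \<Rightarrow> 'a \<Rightarrow> complex) \<Rightarrow> 'a \<Rightarrow> 'a \<Rightarrow> complex" where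
  "perm_minor E A a f =
     (\<Sum>p | p permutes E \<and> p f = a. of_int (sign p) * (\<Prod>i\<in>E - {f}. A i (p i)))"

lemma perm_minor_same:
  assumes "f \<in> E"
  shows "perm_minor E A f f = perm_det (E - {f}) A"
proof -
  have "{p. p permutes E \<and> p f = f} = {p. p permutes (E - {f})}"
  proof (intro equalityI subsetI CollectI)
    fix p assume "p \<in> {p. p permutes E \<and> p f = f}"
    then have pE: "p permutes E" and pf: "p f = f" by auto
    from pE show "p permutes (E - {f})"
    proof (rule permutes_superset)
      fix x assume "x \<in> E - (E - {f})"
      then have "x = f" by blast
      with pf show "p x = x" by simp
    qed
  next
    fix p assume "p \<in> {p. p permutes (E - {f})}"
    then have *: "p permutes (E - {f})" by simp
    have "p permutes E" using * by (rule permutes_subset) auto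
    moreover have "p f = f" using * by (rule permutes_not_in) auto
    ultimately show "p permutes E \<and> p f = f" ..
  qed
  then show ?thesis unfolding perm_minor_def perm_det_def by (rule arg_cong)
qed

lemma perm_det_expand_row:
  assumes "finite E" "f \<in> E"
  shows "perm_det E A = (\<Sum>b\<in>E. A f b * perm_minor E A b f)"
proof -
  have "perm_det E A = (\<Sum>b\<in>E. \<Sum>p | p \<in> {p. p permutes E} \<and> p f = b.
          of_int (sign p) * (\<Prod>i\<in>E. A i (p i)))"
    unfolding perm_det_def
    using assms by (intro sum.group[symmetric]) (auto simp: finite_permutations permutes_in_image)
  also have "\<dots> = (\<Sum>b\<in>E. A f b * perm_minor E A b f)"
  proof (intro sum.cong refl)
    fix b assume "b \<in> E"
    show "(\<Sum>p | p \<in> {p. p permutes E} \<and> p f = b. of_int (sign p) * (\<Prod>i\<in>E. A i (p i)))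
        = A f b * perm_minor E A b f"
      unfolding perm_minor_def sum_distrib_left
      by (intro sum.cong) (auto simp: prod.remove[OF assms])
  qed
  finally show ?thesis .
qed

text \<open>This follows the cycle that contains \<open>f\<close> and \<open>a\<close> one step
  beyond \<open>a\<close>. If \<open>p f = a\<close> and \<open>p a = b\<close>, then composing with
  the transposition of \<open>a\<close> and \<open>b\<close> fixes \<open>a\<close>, sends
  \<open>f\<close> to \<open>b\<close> and reverses the sign. So \<open>a\<close> drops out of the
  index set and the factor \<open>- A a b\<close> is left.\<close>

lemma perm_minor_step:
  assumes fin: "finite E" and "a \<in> E" "f \<in> E" "a \<noteq> f"
  shows "perm_minor E A a f = (\<Sum>b\<in>E - {a}. - A a b * perm_minor (E - {a}) A b f)"
proof -
  have "perm_minor E A a f = (\<Sum>b\<in>E - {a}. \<Sum>p | p \<in> {p. p permutes E \<and> p f = a} \<and> p a = b.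
          of_int (sign p) * (\<Prod>i\<in>E - {f}. A i (p i)))"
    unfolding perm_minor_def
  proof (intro sum.group[symmetric])
    show "finite {p. p permutes E \<and> p f = a}"
      using finite_permutations[OF fin] by (rule rev_finite_subset) auto
    show "(\<lambda>p. p a) ` {p. p permutes E \<and> p f = a} \<subseteq> E - {a}"
      using assms by (auto simp: permutes_in_image) (metis permutes_inverses(2))
  qed (use fin in auto)
  also have "\<dots> = (\<Sum>b\<in>E - {a}. - A a b * perm_minor (E - {a}) A b f)"
  proof (intro sum.cong refl)
    fix b assume b: "b \<in> E - {a}"
    let ?t = "Transposition.transpose a b"
    have "(\<Sum>q | q permutes (E - {a}) \<and> q f = b.
             - A a b * (of_int (sign q) * (\<Prod>i\<in>E - {a} - {f}. A i (q i))))
        = (\<Sum>p | p \<in> {p. p permutes E \<and> p f = a} \<and> p a = b.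
             of_int (sign p) * (\<Prod>i\<in>E - {f}. A i (p i)))"
    proof (rule sum.reindex_bij_witness[of _ "\<lambda>p. ?t \<circ> p" "\<lambda>q. ?t \<circ> q"])
      fix q assume q: "q \<in> {q. q permutes (E - {a}) \<and> q f = b}"
      then have qE: "q permutes E" and qa: "q a = a"
        by (auto intro: permutes_subset simp: permutes_not_in)
      have t: "?t permutes E" using b \<open>a \<in> E\<close> by (intro permutes_swap_id) auto
      show "?t \<circ> q \<in> {p. p \<in> {p. p permutes E \<and> p f = a} \<and> p a = b}"
        using q qE qa t by (auto intro: permutes_compose)
      show "?t \<circ> (?t \<circ> q) = q" by (simp add: fun_eq_iff)
      have s: "sign (?t \<circ> q) = - sign q"
        using b fin qE t
        by (subst sign_compose[OF permutes_imp_permutation[OF fin t] permutes_imp_permutation[OF fin qE]])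
           (auto simp: sign_swap_id)
      have "(\<Prod>i\<in>E - {f}. A i ((?t \<circ> q) i)) = A a b * (\<Prod>i\<in>E - {f} - {a}. A i ((?t \<circ> q) i))"
        using fin assms qa by (subst prod.remove[of _ a]) auto
      also have "(\<Prod>i\<in>E - {f} - {a}. A i ((?t \<circ> q) i)) = (\<Prod>i\<in>E - {a} - {f}. A i (q i))"
      proof (intro prod.cong)
        fix i assume i: "i \<in> E - {a} - {f}"
        have "q i \<noteq> a" using i qa permutes_inj[OF qE] by (metis DiffD1 DiffD2 injD insertI1)
        moreover have "q i \<noteq> b" using i q permutes_inj[OF qE] by (metis (mono_tags, lifting) DiffD2 injD mem_Collect_eq singletonI)
        ultimately show "A i ((?t \<circ> q) i) = A i (q i)" by simp
      qed auto
      finally show "of_int (sign (?t \<circ> q)) * (\<Prod>i\<in>E - {f}. A i ((?t \<circ> q) i))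
         = - A a b * (of_int (sign q) * (\<Prod>i\<in>E - {a} - {f}. A i (q i)))"
        by (simp add: s)
    next
      fix p assume p: "p \<in> {p. p \<in> {p. p permutes E \<and> p f = a} \<and> p a = b}"
      have t: "?t permutes E" using b \<open>a \<in> E\<close> by (intro permutes_swap_id) auto
      have tp: "(?t \<circ> p) a = a" using p by auto
      have "?t \<circ> p permutes E" using p t by (auto intro: permutes_compose)
      then have "?t \<circ> p permutes (E - {a})"
      proof (rule permutes_superset)
        fix x assume "x \<in> E - (E - {a})"
        then have "x = a" by blast
        with tp show "(?t \<circ> p) x = x" by simp
      qed
      then show "?t \<circ> p \<in> {q. q permutes (E - {a}) \<and> q f = b}" using p by auto
      show "?t \<circ> (?t \<circ> p) = p" by (simp add: fun_eq_iff)
    qed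
    then show "(\<Sum>p | p \<in> {p. p permutes E \<and> p f = a} \<and> p a = b.
             of_int (sign p) * (\<Prod>i\<in>E - {f}. A i (p i))) = - A a b * perm_minor (E - {a}) A b f"
      by (simp add: perm_minor_def sum_distrib_left)
  qed
  finally show ?thesis .
qed

definition simple_lists :: "'a set \<Rightarrow> 'a \<Rightarrow> 'a \<Rightarrow> 'a list set" where
  "simple_lists E a f = {q. q \<noteq> [] \<and> distinct q \<and> set q \<subseteq> E \<and> hd q = a \<and> last q = f}"

fun list_weight :: "('a \<Rightarrow> 'a \<Rightarrow> 'b::comm_monoid_mult) \<Rightarrow> 'a list \<Rightarrow> 'b" where
  "list_weight U (x # y # q) = U x y * list_weight U (y # q)"
| "list_weight U _ = 1"

lemma finite_simple_lists: "finite E \<Longrightarrow> finite (simple_lists E a f)"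
  by (rule finite_subset[OF _ finite_subset_distinct[of E]]) (auto simp: simple_lists_def)

lemma simple_lists_same: "a \<in> E \<Longrightarrow> simple_lists E a a = {[a]}"
proof -
  have "q = [a]" if "distinct q" "q \<noteq> []" "hd q = a" "last q = a" for q
    using that by (cases q) (auto split: if_splits)
  then show "a \<in> E \<Longrightarrow> simple_lists E a a = {[a]}" by (auto simp: simple_lists_def)
qed

lemma simple_lists_step:
  assumes "a \<in> E" "a \<noteq> f"
  shows "simple_lists E a f = (\<Union>b\<in>E - {a}. Cons a ` simple_lists (E - {a}) b f)"
proof (intro equalityI subsetI)
  fix q assume q: "q \<in> simple_lists E a f"
  then obtain r where r: "q = a # r" by (cases q) (auto simp: simple_lists_def)
  with q assms have "r \<noteq> []" by (auto simp: simple_lists_def)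
  with q r have "r \<in> simple_lists (E - {a}) (hd r) f" "hd r \<in> E - {a}"
    by (auto simp: simple_lists_def)
  with r show "q \<in> (\<Union>b\<in>E - {a}. Cons a ` simple_lists (E - {a}) b f)" by auto
qed (use assms in \<open>auto simp: simple_lists_def\<close>)

text \<open>Iterating the single step walks along the cycle from \<open>a\<close> until it closes at
  \<open>f\<close>, and visits no index twice. Each step brings a minus sign that cancels the one in
  \<open>- U\<close>, so the walk has the plain product of weights; the indices off the walk are
  permuted freely.\<close>

lemma perm_minor_eq_sum_lists:
  assumes "finite E" "a \<in> E" "f \<in> E"
    and AU: "\<And>i j. i \<in> E \<Longrightarrow> j \<in> E \<Longrightarrow> i \<noteq> j \<Longrightarrow> i \<noteq> f \<Longrightarrow> A i j = - U i j"
  shows "perm_minor E A a f = (\<Sum>q\<in>simple_lists E a f. list_weight U q * perm_det (E - set q) A)"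
  using assms
proof (induction "card E" arbitrary: E a)
  case (Suc n)
  show ?case
  proof (cases "a = f")
    case True
    with Suc show ?thesis by (simp add: perm_minor_same simple_lists_same)
  next
    case False
    have "perm_minor E A a f = (\<Sum>b\<in>E - {a}. - A a b * perm_minor (E - {a}) A b f)"
      using Suc False by (intro perm_minor_step) auto
    also have "\<dots> = (\<Sum>b\<in>E - {a}. \<Sum>q\<in>simple_lists (E - {a}) b f.
        list_weight U (a # q) * perm_det (E - set (a # q)) A)"
    proof (intro sum.cong refl)
      fix b assume b: "b \<in> E - {a}"
      have "perm_minor (E - {a}) A b f = (\<Sum>q\<in>simple_lists (E - {a}) b f.
         list_weight U q * perm_det (E - {a} - set q) A)"
        using Suc b False by (intro Suc.hyps) auto
      then have "- A a b * perm_minor (E - {a}) A b f = (\<Sum>q\<in>simple_lists (E - {a}) b f.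
         - A a b * (list_weight U q * perm_det (E - {a} - set q) A))"
        by (simp add: sum_distrib_left)
      also have "\<dots> = (\<Sum>q\<in>simple_lists (E - {a}) b f.
        list_weight U (a # q) * perm_det (E - set (a # q)) A)"
      proof (intro sum.cong refl)
        fix q assume q: "q \<in> simple_lists (E - {a}) b f"
        then obtain r where "q = b # r" by (cases q) (auto simp: simple_lists_def)
        moreover have "A a b = - U a b" using Suc.prems b False by auto
        ultimately show "- A a b * (list_weight U q * perm_det (E - {a} - set q) A)
          = list_weight U (a # q) * perm_det (E - set (a # q)) A"
          by (simp add: set_diff_eq algebra_simps)
      qed
      finally show "- A a b * perm_minor (E - {a}) A b f = \<dots>" .
    qed
    also have "\<dots> = (\<Sum>b\<in>E - {a}. \<Sum>q\<in>Cons a ` simple_lists (E - {a}) b f.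
        list_weight U q * perm_det (E - set q) A)"
      by (simp add: sum.reindex)
    also have "\<dots> = (\<Sum>q\<in>simple_lists E a f. list_weight U q * perm_det (E - set q) A)"
      unfolding simple_lists_step[OF Suc.prems(2) False]
      using Suc.prems(1)
      by (intro sum.UNION_disjoint[symmetric])
         (auto simp: finite_simple_lists, auto simp: simple_lists_def)
    finally show ?thesis .
  qed
qed auto

section \<open>Transfer to matrices: kernel criterion and Cramer's rule\<close>

lemma perm_det_eq_det:
  assumes e: "bij_betw e {0..<n} E"
  shows "perm_det E A = Determinant.det (mat n n (\<lambda>(i, j). A (e i) (e j)))"
proof -
  let ?N = "{0..<n}"
  have inj: "inj_on e ?N" and im: "e ` ?N = E" using e by (auto simp: bij_betw_def)
  have "Determinant.det (mat n n (\<lambda>(i, j). A (e i) (e j)))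
      = (\<Sum>p | p permutes ?N. of_int (sign p) * (\<Prod>i\<in>?N. A (e i) (e (p i))))"
    unfolding Determinant.det_def
  proof (subst if_P, simp, unfold dim_row_mat, intro sum.cong refl arg_cong2[of _ _ _ _ "(*)"] prod.cong)
    fix p i assume "p \<in> {p. p permutes ?N}" "i \<in> ?N"
    then have "p i < n" "i < n" using permutes_in_image[of p ?N i] by auto
    then show "mat n n (\<lambda>(i, j). A (e i) (e j)) $$ (i, p i) = A (e i) (e (p i))" by simp
  qed
  also have "\<dots> = (\<Sum>p | p permutes E. of_int (sign p) * (\<Prod>i\<in>E. A i (p i)))"
  proof (rule sum.reindex_bij_witness[of _ "map_permutation E (inv_into ?N e)" "map_permutation ?N e"])
    fix p assume "p \<in> {p. p permutes ?N}"
    then have p: "p permutes ?N" by simp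
    show "map_permutation ?N e p \<in> {p. p permutes E}"
      using map_permutation_permutes[OF e p] by simp
    show "map_permutation E (inv_into ?N e) (map_permutation ?N e p) = p"
      using e p inj by (intro map_permutation_compose_inv) auto
    have "(\<Prod>i\<in>E. A i (map_permutation ?N e p i)) = (\<Prod>i\<in>?N. A (e i) (e (p i)))"

      unfolding im[symmetric] prod.reindex[OF inj] using inj by (simp add: map_permutation_apply)
    moreover have "sign (map_permutation ?N e p) = sign p"
      using sign_map_permutation[OF inj p] by simp
    ultimately show "of_int (sign (map_permutation ?N e p)) * (\<Prod>i\<in>E. A i (map_permutation ?N e p i))
      = of_int (sign p) * (\<Prod>i\<in>?N. A (e i) (e (p i)))" by simp
  next
    fix p assume "p \<in> {p. p permutes E}"
    then have p: "p permutes E" by simp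
    have e': "bij_betw (inv_into ?N e) E ?N" using e by (rule bij_betw_inv_into)
    show "map_permutation E (inv_into ?N e) p \<in> {p. p permutes ?N}"
      using map_permutation_permutes[OF e' p] by simp
    show "map_permutation ?N e (map_permutation E (inv_into ?N e) p) = p"
      using e' p im by (intro map_permutation_compose_inv) (auto simp: f_inv_into_f)
  qed
  finally show ?thesis unfolding perm_det_def by simp
qed

text \<open>The kernel is taken on the left, summing over the first index: amplitude flows from an
  edge to its successors, so a left kernel vector is a stationary amplitude in which every edge
  receives from its predecessors.\<close>

lemma perm_det_nonzero:
  assumes "finite E"
    and ker: "\<And>y f. (\<And>j. j \<in> E \<Longrightarrow> (\<Sum>i\<in>E. y i * A i j) = 0) \<Longrightarrow> f \<in> E \<Longrightarrow> y f = 0"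
  shows "perm_det E A \<noteq> 0"
proof
  define n where "n = card E"
  obtain e where e: "bij_betw e {0..<n} E"
    using ex_bij_betw_nat_finite[OF assms(1)] unfolding n_def by blast
  let ?M = "mat n n (\<lambda>(i, j). A (e i) (e j))"
  assume "perm_det E A = 0"
  then have "Determinant.det (transpose_mat ?M) = 0"
    by (simp add: perm_det_eq_det[OF e] Determinant.det_transpose[of _ n])
  then obtain v where v: "v \<in> carrier_vec n" "v \<noteq> 0\<^sub>v n"
      and 0: "transpose_mat ?M *\<^sub>v v = 0\<^sub>v n"
    using det_0_iff_vec_prod_zero[of "transpose_mat ?M" n] by auto
  define y where "y = (\<lambda>x. vec_index v (inv_into {0..<n} e x))"
  have ye: "y (e i) = vec_index v i" if "i < n" for i
    using that e by (simp add: y_def bij_betw_def)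
  have im: "e ` {0..<n} = E" and inj: "inj_on e {0..<n}" using e by (auto simp: bij_betw_def)
  have "(\<Sum>i\<in>E. y i * A i j) = 0" if "j \<in> E" for j
  proof -
    have "j \<in> e ` {0..<n}" using that im by simp
    then obtain k where k: "k < n" "j = e k" by auto
    have "0 = vec_index (transpose_mat ?M *\<^sub>v v) k" using k by (simp add: 0)
    also have "\<dots> = (\<Sum>i<n. A (e i) j * vec_index v i)"
      using k v(1) by (simp add: scalar_prod_def lessThan_atLeast0)
    also have "\<dots> = (\<Sum>i\<in>{0..<n}. y (e i) * A (e i) j)"
      by (intro sum.cong) (auto simp: ye)
    also have "\<dots> = (\<Sum>i\<in>E. y i * A i j)"
      using inj by (simp add: im[symmetric] sum.reindex)
    finally show ?thesis by simp
  qed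
  then have "y f = 0" if "f \<in> E" for f using ker that by blast
  then have "vec_index v i = 0" if "i < n" for i
    using that ye[OF that] im by fastforce
  with v show False by auto
qed

text \<open>Replace row \<open>f\<close> of \<open>A\<close> by the unit vector at \<open>a\<close>.
  Expanding the new determinant along that row gives the cofactor; Cramer's rule for the system
  solved by \<open>y\<close> gives \<open>y f\<close> times the old determinant.\<close>

lemma perm_minor_cramer:
  assumes fin: "finite E" and af: "a \<in> E" "f \<in> E"
    and y: "\<And>j. j \<in> E \<Longrightarrow> (\<Sum>i\<in>E. y i * A i j) = (if j = a then 1 else 0)"
  shows "perm_minor E A a f = y f * perm_det E A"
proof -
  define n where "n = card E"
  obtain e where e: "bij_betw e {0..<n} E"
    using ex_bij_betw_nat_finite[OF fin] unfolding n_def by blast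
  have im: "e ` {0..<n} = E" and inj: "inj_on e {0..<n}" using e by (auto simp: bij_betw_def)
  let ?M = "mat n n (\<lambda>(i, j). A (e i) (e j))"
  define A' where "A' = (\<lambda>i j. if i = f then (if j = a then 1 else 0) else A i j)"
  let ?M' = "mat n n (\<lambda>(i, j). A' (e i) (e j))"
  let ?x = "Matrix.vec n (\<lambda>i. y (e i))"
  have "f \<in> e ` {0..<n}" using af im by simp
  then obtain k where k: "k < n" "f = e k" by auto
  have "transpose_mat ?M *\<^sub>v ?x = Matrix.vec n (\<lambda>i. if e i = a then 1 else 0)"
  proof (rule eq_vecI)
    fix i assume "i < dim_vec (Matrix.vec n (\<lambda>i. if e i = a then 1 else 0 :: complex))"
    then have i: "i < n" by simp
    have "vec_index (transpose_mat ?M *\<^sub>v ?x) i = (\<Sum>j\<in>{0..<n}. y (e j) * A (e j) (e i))"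
      using i by (simp add: scalar_prod_def mult.commute)
    also have "\<dots> = (\<Sum>j\<in>E. y j * A j (e i))"
      using inj by (simp add: im[symmetric] sum.reindex)
    also have "\<dots> = (if e i = a then 1 else 0)" using i im by (intro y) auto
    finally show "vec_index (transpose_mat ?M *\<^sub>v ?x) i = vec_index (Matrix.vec n (\<lambda>i. if e i = a then 1 else 0)) i"
      using i by simp
  qed simp
  \<comment> \<open>Cramer's rule is stated for columns, whence the transposes: column
    \<open>k\<close> of the transpose is row \<open>f\<close>.\<close>
  moreover have "replace_col (transpose_mat ?M) (Matrix.vec n (\<lambda>i. if e i = a then 1 else 0)) k
      = transpose_mat ?M'"
    using k inj by (intro eq_matI) (auto simp: replace_col_def A'_def inj_on_def)
  ultimately have "Determinant.det (transpose_mat ?M') = y f * Determinant.det (transpose_mat ?M)"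
    using cramer_lemma_mat[of "transpose_mat ?M" n ?x k] k by simp
  then have *: "perm_det E A' = y f * perm_det E A"
    by (simp add: perm_det_eq_det[OF e] Determinant.det_transpose[of _ n])
  have "perm_det E A' = (\<Sum>b\<in>E. (if b = a then perm_minor E A' b f else 0))"
    unfolding perm_det_expand_row[OF fin af(2)] by (intro sum.cong) (auto simp: A'_def)
  also have "\<dots> = perm_minor E A' a f" using fin af by simp
  also have "\<dots> = perm_minor E A a f"
    unfolding perm_minor_def A'_def by (intro sum.cong arg_cong2[of _ _ _ _ "(*)"] prod.cong) auto
  finally show ?thesis using * by simp
qed

section \<open>Loop configurations\<close>

lemma finite_edges: "finite {e. is_edge T e}"
proof -
  have "{e. is_edge T e} \<subseteq> ({0..<2 * int T} \<times> {0..<2 * int T}) \<times> UNIV"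
    by (auto simp: is_edge_def lat_pt_def)
  then show ?thesis by (rule finite_subset) auto
qed

text \<open>A cycle repeats its last edge at the front, so it is determined by its tail.\<close>
definition closed_list :: "'a list \<Rightarrow> 'a list" where
  "closed_list q = last q # q"

definition closed_chained :: "nat \<Rightarrow> edge list \<Rightarrow> bool" where
  "closed_chained T q \<longleftrightarrow> chained T (closed_list q)"

lemma chained_Cons2: "chained T (e # e' # es) \<longleftrightarrow> e_end T e = fst e' \<and> chained T (e' # es)"
proof -
  have "(\<forall>k. Suc k < length (e # e' # es) \<longrightarrow> e_end T ((e # e' # es) ! k) = fst ((e # e' # es) ! Suc k))
    \<longleftrightarrow> e_end T e = fst e' \<and> (\<forall>k. Suc k < length (e' # es) \<longrightarrow> e_end T ((e' # es) ! k) = fst ((e' # es) ! Suc k))"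
    (is "?l \<longleftrightarrow> ?r")
  proof
    assume l: ?l
    have "e_end T e = fst e'" using l[rule_format, of 0] by simp
    moreover have "e_end T ((e' # es) ! k) = fst ((e' # es) ! Suc k)" if "Suc k < length (e' # es)" for k
      using l[rule_format, of "Suc k"] that by simp
    ultimately show ?r by blast
  next
    assume r: ?r
    show ?l
    proof (intro allI impI)
      fix k assume "Suc k < length (e # e' # es)"
      then show "e_end T ((e # e' # es) ! k) = fst ((e # e' # es) ! Suc k)"
        using r by (cases k) auto
    qed
  qed
  then show ?thesis by (simp add: chained_def)
qed

lemma chained_simps [simp]: "chained T []" "chained T [e]"
  by (auto simp: chained_def)

lemma chained_append:
  "chained T (es @ [e]) \<longleftrightarrow> chained T es \<and> (es \<noteq> [] \<longrightarrow> e_end T (last es) = fst e)"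
proof (induction es)
  case (Cons x es)
  then show ?case by (cases es) (auto simp: chained_Cons2)
qed simp

lemma closed_chained_rotate1: "closed_chained T (rotate1 q) \<longleftrightarrow> closed_chained T q"
proof (cases q)
  case (Cons x r)
  have "closed_chained T (rotate1 q) \<longleftrightarrow> chained T (q @ [x])"
    using Cons by (simp add: closed_chained_def closed_list_def)
  also have "\<dots> \<longleftrightarrow> chained T (closed_list q)"
    using Cons chained_append[of T "x # r" x] by (auto simp: closed_list_def chained_Cons2)
  finally show ?thesis by (simp add: closed_chained_def)
qed simp

lemma closed_chained_rotate: "closed_chained T (rotate k q) \<longleftrightarrow> closed_chained T q"
  by (induction k) (auto simp: closed_chained_rotate1)

lemma rot_closed_list: "q \<noteq> [] \<Longrightarrow> rot (closed_list q) = closed_list (rotate1 q)"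
  by (cases q) (auto simp: rot_def closed_list_def)

lemma rot_pow_closed_list: "q \<noteq> [] \<Longrightarrow> (rot ^^ k) (closed_list q) = closed_list (rotate k q)"
  by (induction k) (auto simp: rot_closed_list)

text \<open>Two edges suffice here because \<open>closed_list\<close> adds the repeated one; this
  matches the length of at least 3 in \<open>is_cycle\<close>.\<close>

definition simple_cycle :: "nat \<Rightarrow> edge list \<Rightarrow> bool" where
  "simple_cycle T q \<longleftrightarrow> 2 \<le> length q \<and> distinct q \<and> (\<forall>e\<in>set q. is_edge T e) \<and> closed_chained T q"

lemma is_cycle_iff: "is_cycle T c \<longleftrightarrow> (\<exists>q. c = closed_list q \<and> simple_cycle T q)"
proof -
  have d: "distinct (last q # butlast q) \<longleftrightarrow> distinct q" if "q \<noteq> []" for q :: "edge list"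
    by (subst (3) append_butlast_last_id[OF that, symmetric], simp only: distinct_append) auto
  have "is_cycle T (closed_list q) \<longleftrightarrow> simple_cycle T q" for q
  proof (cases "q = []")
    case False
    then show ?thesis using d[OF False]
      by (auto simp: is_cycle_def closed_list_def closed_chained_def simple_cycle_def)
  qed (auto simp: is_cycle_def closed_list_def simple_cycle_def)
  moreover have "\<exists>q. c = closed_list q" if "is_cycle T c"
    using that by (cases c) (auto simp: is_cycle_def closed_list_def intro!: exI[of _ "tl c"] split: if_splits)
  ultimately show ?thesis by blast
qed

definition loop_from :: "edge list \<Rightarrow> edge list set" where
  "loop_from q = range (\<lambda>k. closed_list (rotate k q))"

lemma is_loop_iff: "is_loop T l \<longleftrightarrow> (\<exists>q. simple_cycle T q \<and> l = loop_from q)"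
proof -
  have "loop_of (closed_list q) = loop_from q" if "simple_cycle T q" for q
  proof -
    have "q \<noteq> []" using that by (auto simp: simple_cycle_def)
    then show ?thesis by (simp add: loop_of_def loop_from_def rot_pow_closed_list)
  qed
  then show ?thesis unfolding is_loop_def is_cycle_iff by blast
qed

lemma simple_cycle_rotate [simp]: "simple_cycle T (rotate k q) \<longleftrightarrow> simple_cycle T q"
  by (simp add: simple_cycle_def closed_chained_rotate)

lemma closed_list_inj: "closed_list q = closed_list q' \<Longrightarrow> q = q'"
  by (simp add: closed_list_def)

lemma loop_from_rotate: "loop_from (rotate k q) = loop_from q"
proof (intro equalityI subsetI)
  fix c assume "c \<in> loop_from (rotate k q)"
  then show "c \<in> loop_from q" by (auto simp: loop_from_def rotate_rotate)
next
  fix c assume "c \<in> loop_from q"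
  then obtain j where j: "c = closed_list (rotate j q)" by (auto simp: loop_from_def)
  \<comment> \<open>The rotation by \<open>k\<close> is undone by \<open>k * (length q - 1)\<close>
    further ones, as together they make \<open>k\<close> full turns. This avoids subtraction in the
    exponent.\<close>
  have "rotate j q = rotate (j + k * (length q - 1)) (rotate k q)"
  proof (cases "q = []")
    case False
    then have "j + k * (length q - 1) + k = j + k * length q"
      by (cases "length q") (auto simp: algebra_simps)
    then have "(j + k * (length q - 1) + k) mod length q = j mod length q"
      by (simp only: mod_mult_self1)
    then show ?thesis by (metis rotate_conv_mod rotate_rotate)
  qed simp
  with j show "c \<in> loop_from (rotate k q)" by (auto simp: loop_from_def)
qed

lemma loop_edges_loop_from [simp]: "q \<noteq> [] \<Longrightarrow> loop_edges (loop_from q) = set q"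
  by (auto simp: loop_edges_def loop_from_def closed_list_def dest: last_in_set)
     (metis last_in_set set_rotate rotate_is_Nil_conv)

lemma last_rotate_eq:
  assumes "distinct q" "q \<noteq> []" "last (rotate k q) = last q"
  shows "rotate k q = q"
proof -
  obtain n where n: "length q = Suc n" using assms by (cases "length q") auto
  have "last (rotate k q) = q ! ((k + n) mod Suc n)"
    using assms n by (simp add: last_conv_nth nth_rotate add.commute)
  then have "q ! ((k + n) mod Suc n) = q ! n"
    using assms n by (simp add: last_conv_nth)
  then have "(k + n) mod Suc n = n"
    using nth_eq_iff_index_eq[OF assms(1), of "(k + n) mod Suc n" n] n by fastforce
  then have "((k + n) mod Suc n + 1) mod Suc n = 0" by simp
  then have "(k + n + 1) mod Suc n = 0" by (metis mod_add_left_eq)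
  moreover have "k + n + 1 = k + Suc n" by simp
  ultimately have "k mod Suc n = 0" by (metis mod_add_self2)
  then have "k mod length q = 0" by (simp only: n)
  then show ?thesis by (metis rotate0 rotate_conv_mod id_apply)
qed

text \<open>The edges of a cycle are distinct, so the last edge determines the rotation. Prescribing
  the last edge therefore picks exactly one list from each loop through it, and sums over loops
  become sums over lists.\<close>

lemma loop_from_inj:
  assumes "simple_cycle T q" "simple_cycle T q'" "last q = last q'" "loop_from q = loop_from q'"
  shows "q = q'"
proof -
  have "closed_list q' \<in> loop_from q" using assms(4) by (metis loop_from_def rotate0 rangeI id_apply)
  then obtain k where k: "q' = rotate k q" by (auto simp: loop_from_def dest: closed_list_inj)
  have "distinct q" "q \<noteq> []" using assms(1) by (auto simp: simple_cycle_def)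
  then show ?thesis using assms(3) last_rotate_eq[of q k] by (simp add: k)
qed

lemma rotate_to_last:
  assumes "f \<in> set q"
  obtains k where "last (rotate k q) = f"
proof -
  obtain xs ys where q: "q = xs @ f # ys" using assms by (metis split_list)
  have "rotate (length (xs @ [f])) ((xs @ [f]) @ ys) = ys @ (xs @ [f])"
    by (rule rotate_append)
  then have "last (rotate (length (xs @ [f])) q) = f" using q by simp
  then show ?thesis by (rule that)
qed

section \<open>Recursion for the sum over loop configurations\<close>

definition configs_in :: "nat \<Rightarrow> edge set \<Rightarrow> edge list set set set" where
  "configs_in T E = {L. loop_config T L \<and> (\<forall>l\<in>L. loop_edges l \<subseteq> E)}"

definition loop_sum :: "nat \<Rightarrow> (edge list set \<Rightarrow> complex) \<Rightarrow> edge set \<Rightarrow> complex" where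
  "loop_sum T w E = (\<Sum>L\<in>configs_in T E. \<Prod>l\<in>L. w l)"

definition cycles_at :: "nat \<Rightarrow> edge set \<Rightarrow> edge \<Rightarrow> edge list set" where
  "cycles_at T E f = {q. simple_cycle T q \<and> set q \<subseteq> E \<and> last q = f}"

lemma simple_cycle_nonempty: "simple_cycle T q \<Longrightarrow> q \<noteq> []"
  by (auto simp: simple_cycle_def)

lemma finite_configs_in: "finite E \<Longrightarrow> finite (configs_in T E)"
proof -
  assume E: "finite E"
  have "configs_in T E \<subseteq> Pow (loop_from ` {q. set q \<subseteq> E \<and> distinct q})"
  proof (intro subsetI PowI)
    fix L l assume "L \<in> configs_in T E" "l \<in> L"
    then have "is_loop T l" "loop_edges l \<subseteq> E" by (auto simp: configs_in_def loop_config_def)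
    then obtain q where q: "simple_cycle T q" "l = loop_from q" by (auto simp: is_loop_iff)
    with \<open>loop_edges l \<subseteq> E\<close> have "set q \<subseteq> E" using simple_cycle_nonempty by simp
    with q show "l \<in> loop_from ` {q. set q \<subseteq> E \<and> distinct q}" by (auto simp: simple_cycle_def)
  qed
  moreover have "finite {q. set q \<subseteq> E \<and> distinct q}"
    using finite_subset_distinct[OF E] by (rule rev_finite_subset) auto
  ultimately show ?thesis by (meson finite_Pow_iff finite_imageI finite_subset)
qed

lemma finite_cycles_at:
  assumes "finite E"
  shows "finite (cycles_at T E f)"
proof -
  have "cycles_at T E f \<subseteq> {q. set q \<subseteq> E \<and> distinct q}"
    unfolding cycles_at_def simple_cycle_def by blast
  then show ?thesis using finite_subset_distinct[OF assms] by (rule finite_subset)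
qed

text \<open>Loops of a configuration share no edge, so at most one of them runs through
  \<open>f\<close>. Removing that loop leaves a configuration on the edges it does not use.\<close>

lemma configs_in_disjoint_union:
  "configs_in T E = configs_in T (E - {f}) \<union>
     (\<lambda>(q, L). insert (loop_from q) L) ` (SIGMA q:cycles_at T E f. configs_in T (E - set q))"
proof (intro equalityI subsetI)
  fix L assume L: "L \<in> configs_in T E"
  show "L \<in> configs_in T (E - {f}) \<union>
     (\<lambda>(q, L). insert (loop_from q) L) ` (SIGMA q:cycles_at T E f. configs_in T (E - set q))"
  proof (cases "\<exists>l\<in>L. f \<in> loop_edges l")
    case True
    then obtain l where l: "l \<in> L" "f \<in> loop_edges l" by blast
    with L obtain q0 where q0: "simple_cycle T q0" "l = loop_from q0"
      by (auto simp: configs_in_def loop_config_def is_loop_iff)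
    then have "f \<in> set q0" using l simple_cycle_nonempty by auto
    then obtain k where k: "last (rotate k q0) = f" by (rule rotate_to_last)
    define q where "q = rotate k q0"
    have q: "simple_cycle T q" "l = loop_from q" "last q = f"
      using q0 k by (auto simp: q_def loop_from_rotate)
    have sq: "loop_edges l = set q" using q simple_cycle_nonempty by simp
    have LE: "loop_edges l' \<subseteq> E" "is_loop T l'" if "l' \<in> L" for l'
      using L that by (simp_all add: configs_in_def loop_config_def)
    have disj: "loop_edges l1 \<inter> loop_edges l2 = {}" if "l1 \<in> L" "l2 \<in> L" "l1 \<noteq> l2" for l1 l2
      using L that by (simp add: configs_in_def loop_config_def)
    have "loop_edges l' \<subseteq> E - set q" if "l' \<in> L - {l}" for l'
      using disj[of l' l] LE[of l'] that l(1) sq by blast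
    moreover have "loop_config T (L - {l})"
      using L disj LE by (simp add: configs_in_def loop_config_def)
    ultimately have "L - {l} \<in> configs_in T (E - set q)" by (simp add: configs_in_def)
    moreover have "q \<in> cycles_at T E f" using q LE[OF l(1)] sq by (simp add: cycles_at_def)
    ultimately have "(q, L - {l}) \<in> (SIGMA q:cycles_at T E f. configs_in T (E - set q))" by blast
    moreover have "L = (\<lambda>(q, L). insert (loop_from q) L) (q, L - {l})" using l q by auto
    ultimately show ?thesis by blast
  next
    case False
    then have "L \<in> configs_in T (E - {f})" using L by (auto simp: configs_in_def)
    then show ?thesis by blast
  qed
next
  fix L assume "L \<in> configs_in T (E - {f}) \<union>
     (\<lambda>(q, L). insert (loop_from q) L) ` (SIGMA q:cycles_at T E f. configs_in T (E - set q))"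
  then consider "L \<in> configs_in T (E - {f})" |
    q L' where "L = insert (loop_from q) L'" "q \<in> cycles_at T E f" "L' \<in> configs_in T (E - set q)"
    by auto
  then show "L \<in> configs_in T E"
  proof cases
    case 2
    have q: "simple_cycle T q" "loop_edges (loop_from q) = set q" "set q \<subseteq> E"
      using 2 simple_cycle_nonempty[of T q] by (simp_all add: cycles_at_def)
    have "is_loop T (loop_from q)" using q by (auto simp: is_loop_iff)
    moreover have L': "loop_edges l \<subseteq> E - set q" "is_loop T l" "finite L'" if "l \<in> L'" for l
      using 2(3) that by (simp_all add: configs_in_def loop_config_def)
    moreover have "finite L'" using 2(3) by (simp add: configs_in_def loop_config_def)
    moreover have "loop_edges l1 \<inter> loop_edges l2 = {}" if "l1 \<in> L" "l2 \<in> L" "l1 \<noteq> l2" for l1 l2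
    proof -
      have "loop_edges l \<inter> set q = {}" if "l \<in> L'" for l using L'(1)[OF that] by blast
      moreover have "loop_edges l1 \<inter> loop_edges l2 = {}" if "l1 \<in> L'" "l2 \<in> L'"
        using 2(3) that \<open>l1 \<noteq> l2\<close> by (simp add: configs_in_def loop_config_def)
      ultimately show ?thesis using that q(2) unfolding 2(1) by blast
    qed
    moreover have "loop_edges l \<subseteq> E" if "l \<in> L" for l
      using that L'(1) q(2,3) unfolding 2(1) by blast
    ultimately show ?thesis unfolding configs_in_def loop_config_def 2(1) by blast
  qed (auto simp: configs_in_def)
qed

text \<open>This has the shape of a determinant expanded along row \<open>f\<close>: the first term
  is the diagonal entry, the others are the cycles through \<open>f\<close>.\<close>

lemma loop_sum_step:
  assumes E: "finite E" and f: "f \<in> E"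
  shows "loop_sum T w E = loop_sum T w (E - {f})
    + (\<Sum>q\<in>cycles_at T E f. w (loop_from q) * loop_sum T w (E - set q))"
proof -
  let ?S = "SIGMA q:cycles_at T E f. configs_in T (E - set q)"
  let ?h = "\<lambda>(q, L). insert (loop_from q) L"
  have new: "loop_edges (loop_from q) = set q \<and> f \<in> set q \<and> loop_from q \<notin> L \<and> finite L
      \<and> (\<forall>l\<in>L. f \<notin> loop_edges l)"
    if "q \<in> cycles_at T E f" "L \<in> configs_in T (E - set q)" for q L
  proof -
    have q: "simple_cycle T q" "q \<noteq> []" "last q = f"
      using that(1) simple_cycle_nonempty by (auto simp: cycles_at_def)
    then have f: "f \<in> set q" using last_in_set by blast
    have L: "finite L" "\<And>l. l \<in> L \<Longrightarrow> loop_edges l \<subseteq> E - set q"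
      using that(2) by (simp_all add: configs_in_def loop_config_def)
    then have "\<forall>l\<in>L. f \<notin> loop_edges l" using f by blast
    with L(1) f q show ?thesis by auto
  qed
  have inj: "inj_on ?h ?S"
  proof (rule inj_onI, clarify)
    fix q L q' L'
    assume *: "q \<in> cycles_at T E f" "L \<in> configs_in T (E - set q)"
      "q' \<in> cycles_at T E f" "L' \<in> configs_in T (E - set q')"
      "insert (loop_from q) L = insert (loop_from q') L'"
    have "loop_from q \<in> insert (loop_from q') L'" using *(5) by blast
    moreover have "loop_from q \<notin> L'" using new[OF *(1,2)] new[OF *(3,4)] by auto
    ultimately have eq: "loop_from q = loop_from q'" by blast
    then have "q = q'" using * by (intro loop_from_inj) (auto simp: cycles_at_def)
    moreover have "L = L'"
      using new[OF *(1,2)] new[OF *(3,4)] *(5) unfolding eq by (meson insert_ident)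
    ultimately show "q = q' \<and> L = L'" ..
  qed
  have fin: "finite ?S"
    using E by (intro finite_SigmaI finite_cycles_at finite_configs_in) auto
  have "loop_sum T w E = (\<Sum>L\<in>configs_in T (E - {f}). \<Prod>l\<in>L. w l) + (\<Sum>L\<in>?h ` ?S. \<Prod>l\<in>L. w l)"
    unfolding loop_sum_def
  proof (subst configs_in_disjoint_union[of T E f], rule sum.union_disjoint)
    show "configs_in T (E - {f}) \<inter> ?h ` ?S = {}"
    proof (rule ccontr)
      assume "\<not> ?thesis"
      then obtain q L where *: "q \<in> cycles_at T E f" "L \<in> configs_in T (E - set q)"
        "insert (loop_from q) L \<in> configs_in T (E - {f})" by auto
      then have "loop_edges (loop_from q) \<subseteq> E - {f}" by (simp add: configs_in_def)
      with new[OF *(1,2)] show False by blast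
    qed
    show "finite (configs_in T (E - {f}))" using E by (simp add: finite_configs_in)
    show "finite (?h ` ?S)" using fin by (rule finite_imageI)
  qed
  also have "(\<Sum>L\<in>?h ` ?S. \<Prod>l\<in>L. w l) = (\<Sum>(q, L)\<in>?S. w (loop_from q) * (\<Prod>l\<in>L. w l))"
  proof (subst sum.reindex[OF inj], intro sum.cong refl)
    fix x assume "x \<in> ?S"
    then obtain q L where x: "x = (q, L)" "q \<in> cycles_at T E f" "L \<in> configs_in T (E - set q)" by blast
    show "((\<lambda>L. \<Prod>l\<in>L. w l) \<circ> ?h) x = (case x of (q, L) \<Rightarrow> w (loop_from q) * (\<Prod>l\<in>L. w l))"
      using new[OF x(2,3)] by (simp add: x(1))
  qed
  also have "\<dots> = (\<Sum>q\<in>cycles_at T E f. w (loop_from q) * loop_sum T w (E - set q))"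
    using E by (subst sum.Sigma[symmetric])
      (auto simp: loop_sum_def sum_distrib_left finite_cycles_at finite_configs_in)
  finally show ?thesis by (simp add: loop_sum_def)
qed

definition hop :: "nat \<Rightarrow> (edge \<Rightarrow> edge \<Rightarrow> complex) \<Rightarrow> edge \<Rightarrow> edge \<Rightarrow> complex" where
  "hop T W e e' = (if e_end T e = fst e' then W e e' else 0)"

lemma list_weight_hop_chained:
  "chained T q \<Longrightarrow> list_weight (hop T W) q = list_weight W q"
  by (induction W q rule: list_weight.induct) (auto simp: hop_def chained_Cons2)

lemma list_weight_hop_not_chained:
  "\<not> chained T q \<Longrightarrow> list_weight (hop T W) q = 0"
  by (induction W q rule: list_weight.induct) (auto simp: hop_def chained_Cons2)

lemma list_weight_closed_list:
  "q \<noteq> [] \<Longrightarrow> list_weight W (closed_list q) = W (last q) (hd q) * list_weight W q"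
  by (cases q) (auto simp: closed_list_def)

text \<open>Both sides obey the same recursion on the edge set. A cofactor is a sum over lists from
  \<open>b\<close> to \<open>f\<close>; the entry in row \<open>f\<close> and column
  \<open>b\<close> closes such a list to a cycle, and its minus sign is the minus sign in the weight
  of a loop.\<close>

lemma loop_sum_eq_perm_det:
  assumes T: "T > 0" and "finite E" "\<forall>e\<in>E. is_edge T e"
    and w: "\<And>q. simple_cycle T q \<Longrightarrow> w (loop_from q) = - list_weight W (closed_list q)"
  shows "loop_sum T w E = perm_det E (\<lambda>i j. (if i = j then 1 else 0) - hop T W i j)"
    (is "_ = perm_det E ?A")
  using assms(2,3)
proof (induction "card E" arbitrary: E rule: less_induct)
  case less
  show ?case
  proof (cases "E = {}")
    case True
    have "L = {}" if "L \<in> configs_in T {}" for L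
    proof (rule ccontr)
      assume "L \<noteq> {}"
      then obtain l where "l \<in> L" by blast
      with that obtain q where "simple_cycle T q" "loop_edges (loop_from q) \<subseteq> {}"
        by (auto simp: configs_in_def loop_config_def is_loop_iff)
      then show False using simple_cycle_nonempty by simp
    qed
    then have "configs_in T {} = {{}}" by (auto simp: configs_in_def loop_config_def)
    with True show ?thesis by (simp add: loop_sum_def perm_det_def)
  next
    case False
    then obtain f where f: "f \<in> E" by blast
    \<comment> \<open>Every edge advances the time by one modulo \<open>2 * int T\<close>, which is
      at least 2, so no edge follows itself. The diagonal entries are thus 1, in accordance with
      cycles having at least two edges.\<close>
    have loopless: "hop T W f f = 0"
    proof -
      have "0 \<le> snd (fst f)" "snd (fst f) < 2 * int T" using f less.prems by (auto simp: is_edge_def lat_pt_def)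
      then have "(snd (fst f) + 1) mod (2 * int T) \<noteq> snd (fst f)"
        using T by (cases "snd (fst f) + 1 = 2 * int T") simp_all
      then have "e_end T f \<noteq> fst f" unfolding e_end_def by (metis snd_conv)
      then show ?thesis by (simp add: hop_def)
    qed
    have IH: "loop_sum T w E' = perm_det E' ?A" if "E' \<subset> E" for E'
      using that less.prems by (intro less.hyps psubset_card_mono) (auto intro: finite_subset)
    let ?g = "\<lambda>q. list_weight (hop T W) (closed_list q) * perm_det (E - set q) ?A"
    \<comment> \<open>For distinct edges with last edge \<open>f\<close>, the condition
      \<open>hd q \<noteq> f\<close> removes only the list \<open>[f]\<close>, which belongs to the
      diagonal entry.\<close>
    let ?Q = "{q. q \<noteq> [] \<and> distinct q \<and> set q \<subseteq> E \<and> last q = f \<and> hd q \<noteq> f}"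
    have "perm_det E ?A = ?A f f * perm_minor E ?A f f + (\<Sum>b\<in>E - {f}. ?A f b * perm_minor E ?A b f)"
      unfolding perm_det_expand_row[OF less.prems(1) f, of ?A] by (rule sum.remove[OF less.prems(1) f])
    also have "?A f f * perm_minor E ?A f f = perm_det (E - {f}) ?A"
      using f by (simp add: loopless perm_minor_same)
    also have "(\<Sum>b\<in>E - {f}. ?A f b * perm_minor E ?A b f) = (\<Sum>b\<in>E - {f}. \<Sum>q\<in>simple_lists E b f. - ?g q)"
    proof (intro sum.cong refl)
      fix b assume b: "b \<in> E - {f}"
      have "perm_minor E ?A b f = (\<Sum>q\<in>simple_lists E b f. list_weight (hop T W) q * perm_det (E - set q) ?A)"
        using b f less.prems by (intro perm_minor_eq_sum_lists) auto
      then have "?A f b * perm_minor E ?A b f = ?A f b * (\<Sum>q\<in>simple_lists E b f.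
          list_weight (hop T W) q * perm_det (E - set q) ?A)" by (rule arg_cong)
      also have "\<dots> = (\<Sum>q\<in>simple_lists E b f. - ?g q)"
        unfolding sum_distrib_left
      proof (intro sum.cong refl)
        fix q assume "q \<in> simple_lists E b f"
        then have "q \<noteq> []" "hd q = b" "last q = f" by (auto simp: simple_lists_def)
        then show "?A f b * (list_weight (hop T W) q * perm_det (E - set q) ?A) = - ?g q"
          using b by (simp add: list_weight_closed_list) blast
      qed
      finally show "?A f b * perm_minor E ?A b f = (\<Sum>q\<in>simple_lists E b f. - ?g q)" .
    qed
    also have "\<dots> = (\<Sum>q\<in>(\<Union>b\<in>E - {f}. simple_lists E b f). - ?g q)"
    proof (intro sum.UNION_disjoint[symmetric] ballI impI)
      fix b c :: edge assume "b \<noteq> c"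
      then show "simple_lists E b f \<inter> simple_lists E c f = {}" unfolding simple_lists_def by blast
    qed (use less.prems in \<open>simp_all add: finite_simple_lists\<close>)
    also have "(\<Union>b\<in>E - {f}. simple_lists E b f) = ?Q"
    proof (intro equalityI subsetI)
      fix q assume q: "q \<in> ?Q"
      then have "hd q \<in> E - {f}" using hd_in_set by blast
      then show "q \<in> (\<Union>b\<in>E - {f}. simple_lists E b f)" using q by (auto simp: simple_lists_def)
    next
      fix q assume "q \<in> (\<Union>b\<in>E - {f}. simple_lists E b f)"
      then show "q \<in> ?Q" unfolding simple_lists_def by blast
    qed
    \<comment> \<open>A list in \<open>?Q\<close> that is not a cycle can fail only at a junction of
      two edges, including the closing one, and \<open>hop\<close> vanishes there.\<close>
    also have "(\<Sum>q\<in>?Q. - ?g q) = (\<Sum>q\<in>cycles_at T E f. - ?g q)"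
    proof (intro sum.mono_neutral_right ballI)
      have "?Q \<subseteq> {q. set q \<subseteq> E \<and> distinct q}" by blast
      then show "finite ?Q" using finite_subset_distinct[OF less.prems(1)] by (rule finite_subset)
      show "cycles_at T E f \<subseteq> ?Q"
      proof
        fix q assume q: "q \<in> cycles_at T E f"
        then have *: "distinct q" "2 \<le> length q" "set q \<subseteq> E" "last q = f"
          by (simp_all add: cycles_at_def simple_cycle_def)
        obtain x y r where xy: "q = x # y # r" using *(2) by (auto simp: Suc_le_length_iff numeral_2_eq_2)
        then have "last q \<in> set (y # r)" by simp
        then have "hd q \<noteq> last q" using *(1) xy by auto
        then show "q \<in> ?Q" using * xy by simp
      qed
      fix q assume q: "q \<in> ?Q - cycles_at T E f"
      then have *: "q \<noteq> []" "distinct q" "set q \<subseteq> E" "last q = f" "hd q \<noteq> f" "q \<notin> cycles_at T E f"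
        by blast+
      have "length q \<noteq> 0" "length q \<noteq> 1" using * by (auto simp: length_Suc_conv)
      then have "2 \<le> length q" by linarith
      moreover have "\<forall>e\<in>set q. is_edge T e" using * less.prems(2) by blast
      ultimately have "\<not> closed_chained T q" using * by (simp add: cycles_at_def simple_cycle_def)
      then show "- ?g q = 0" by (simp add: list_weight_hop_not_chained closed_chained_def)
    qed
    also have "\<dots> = (\<Sum>q\<in>cycles_at T E f. w (loop_from q) * loop_sum T w (E - set q))"
    proof (intro sum.cong refl)
      fix q assume q: "q \<in> cycles_at T E f"
      then have "q \<noteq> []" "last q = f" by (auto simp: cycles_at_def simple_cycle_def)
      then have "f \<in> set q" using last_in_set by blast
      then have "E - set q \<subset> E" using f by blast
      then show "- ?g q = w (loop_from q) * loop_sum T w (E - set q)"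
        using q by (simp add: IH w cycles_at_def list_weight_hop_chained simple_cycle_def closed_chained_def)
    qed
    also have "perm_det (E - {f}) ?A = loop_sum T w (E - {f})" using f by (intro IH[symmetric]) auto
    finally show ?thesis using loop_sum_step[OF less.prems(1) f, of T w] by simp
  qed
qed

section \<open>Arrows as products of node weights\<close>

definition node_weight :: "nat \<Rightarrow> real \<Rightarrow> real \<Rightarrow> real \<Rightarrow> edge \<Rightarrow> edge \<Rightarrow> complex" where
  "node_weight T m \<epsilon> \<delta> e1 e2 =
     (if odd (fst (e_end T e1))
      then (if snd e1 \<noteq> snd e2 then - \<i> * complex_of_real (m * \<epsilon>) else 1) / complex_of_real (sqrt (1 + m\<^sup>2 * \<epsilon>\<^sup>2))
      else (if snd e1 \<noteq> snd e2 then - complex_of_real \<delta> else 1) / complex_of_real (sqrt (1 - \<delta>\<^sup>2)))"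

lemma powr_half_nat: "0 < x \<Longrightarrow> x powr (real n / 2) = sqrt x ^ n"
proof -
  assume x: "0 < x"
  have "sqrt x ^ n = sqrt x powr real n" using x by (simp add: powr_realpow)
  also have "\<dots> = x powr (real n / 2)" using x by (simp add: powr_half_sqrt[symmetric] powr_powr)
  finally show ?thesis by simp
qed

lemma arrow_nodes_eq_prod:
  assumes "\<delta>\<^sup>2 < 1"
  shows "arrow_nodes T m \<epsilon> \<delta> ns = prod_list (map (\<lambda>(e1, e2). node_weight T m \<epsilon> \<delta> e1 e2) ns)"
proof -
  have pos: "0 < 1 + m\<^sup>2 * \<epsilon>\<^sup>2" "0 < 1 - \<delta>\<^sup>2"
    using assms by (simp_all add: add_pos_nonneg)
  show ?thesis
  proof (induction ns)
    case Nil
    then show ?case using pos by (simp add: arrow_nodes_def)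
  next
    case (Cons x ns)
    obtain e1 e2 where x: "x = (e1, e2)" by (cases x)
    have "arrow_nodes T m \<epsilon> \<delta> ((e1, e2) # ns) = node_weight T m \<epsilon> \<delta> e1 e2 * arrow_nodes T m \<epsilon> \<delta> ns"
      unfolding arrow_nodes_def Let_def powr_half_nat[OF pos(1)] powr_half_nat[OF pos(2)]
      by (simp add: node_weight_def mult_ac)
    then show ?case using Cons x by simp
  qed
qed

lemma prod_list_nodes: "prod_list (map (\<lambda>(x, y). W x y) (nodes q)) = list_weight W q"
  by (induction W q rule: list_weight.induct) (auto simp: nodes_def)

lemma list_weight_snoc:
  "list_weight W (q @ [x]) = list_weight W q * (if q = [] then 1 else W (last q) x)"
  by (induction W q rule: list_weight.induct) (auto simp: mult.assoc)

lemma list_weight_closed_rotate1: "list_weight W (closed_list (rotate1 q)) = list_weight W (closed_list q)"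
proof (cases q)
  case (Cons x r)
  then have "closed_list (rotate1 q) = (x # r) @ [x]" by (simp add: closed_list_def)
  then show ?thesis using Cons by (simp only: list_weight_snoc) (simp add: closed_list_def mult.commute)
qed simp

lemma list_weight_closed_rotate: "list_weight W (closed_list (rotate k q)) = list_weight W (closed_list q)"
  by (induction k) (auto simp: list_weight_closed_rotate1)

text \<open>The representative chosen in \<open>arrow_loop\<close> is some rotation of
  \<open>q\<close>, and the cyclic product of weights does not change under rotation.\<close>

lemma arrow_loop_loop_from:
  assumes "\<delta>\<^sup>2 < 1"
  shows "arrow_loop T m \<epsilon> \<delta> (loop_from q) = - list_weight (node_weight T m \<epsilon> \<delta>) (closed_list q)"
proof -
  have "(SOME c. c \<in> loop_from q) \<in> loop_from q"
    by (rule someI[of _ "closed_list (rotate 0 q)"]) (unfold loop_from_def, rule rangeI)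
  then obtain k where "(SOME c. c \<in> loop_from q) = closed_list (rotate k q)"
    by (auto simp: loop_from_def)
  then show ?thesis
    by (simp add: arrow_loop_def arrow_nodes_eq_prod[OF assms] prod_list_nodes list_weight_closed_rotate)
qed

text \<open>This is the matrix I - U, with U the one-step evolution on edges.\<close>
definition transfer :: "nat \<Rightarrow> real \<Rightarrow> real \<Rightarrow> real \<Rightarrow> edge \<Rightarrow> edge \<Rightarrow> complex" where
  "transfer T m \<epsilon> \<delta> e e' = (if e = e' then 1 else 0) - hop T (node_weight T m \<epsilon> \<delta>) e e'"

abbreviation "edges T \<equiv> {e. is_edge T e}"

lemma loop_sum_arrow:
  assumes "T > 0" "\<delta>\<^sup>2 < 1" "E \<subseteq> edges T"
  shows "loop_sum T (arrow_loop T m \<epsilon> \<delta>) E = perm_det E (transfer T m \<epsilon> \<delta>)"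
  unfolding transfer_def
  using assms finite_edges finite_subset
  by (intro loop_sum_eq_perm_det) (auto simp: arrow_loop_loop_from)

lemma loop_edges_in_edges:
  assumes "loop_config T L" "l \<in> L"
  shows "loop_edges l \<subseteq> edges T"
proof -
  obtain q where "simple_cycle T q" "l = loop_from q"
    using assms by (auto simp: loop_config_def is_loop_iff)
  then show ?thesis using simple_cycle_nonempty[of T q] by (auto simp: simple_cycle_def)
qed

lemma denom_eq_perm_det:
  assumes "T > 0" "\<delta>\<^sup>2 < 1"
  shows "denom T m \<epsilon> \<delta> = perm_det (edges T) (transfer T m \<epsilon> \<delta>)"
proof -
  have "loop_configs T = configs_in T (edges T)"
    using loop_edges_in_edges unfolding loop_configs_def configs_in_def by blast
  then have "denom T m \<epsilon> \<delta> = loop_sum T (arrow_loop T m \<epsilon> \<delta>) (edges T)"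
    by (simp add: denom_def loop_sum_def)
  then show ?thesis using loop_sum_arrow[OF assms order_refl] by simp
qed

text \<open>For a fixed path the loops range over all configurations on the edges off the path, and
  these sum to the determinant on the complement. What results is the expansion of the minor over
  simple lists, where lists that are not paths have weight zero.\<close>

lemma numer_eq_perm_minor:
  assumes T: "T > 0" "\<delta>\<^sup>2 < 1" and af: "is_edge T a" "is_edge T f"
  shows "numer T m \<epsilon> \<delta> a f = perm_minor (edges T) (transfer T m \<epsilon> \<delta>) a f"
proof -
  let ?w = "arrow_loop T m \<epsilon> \<delta>" and ?W = "node_weight T m \<epsilon> \<delta>"
  let ?P = "{p \<in> simple_lists (edges T) a f. chained T p}"
  have finP: "finite ?P" using finite_simple_lists[OF finite_edges] by simp
  have "bij_betw (\<lambda>(p, L). (L, p)) (SIGMA p:?P. configs_in T (edges T - set p)) (configs_src_sink T a f)"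
  proof (rule bij_betw_byWitness[where f' = "\<lambda>(L, p). (p, L)"])
    show "(\<lambda>(p, L). (L, p)) ` (SIGMA p:?P. configs_in T (edges T - set p)) \<subseteq> configs_src_sink T a f"
      by (auto simp: configs_src_sink_def configs_in_def simple_lists_def is_path_def)
    show "(\<lambda>(L, p). (p, L)) ` configs_src_sink T a f \<subseteq> (SIGMA p:?P. configs_in T (edges T - set p))"
    proof
      fix x assume "x \<in> (\<lambda>(L, p). (p, L)) ` configs_src_sink T a f"
      then obtain L p where x: "x = (p, L)" "(L, p) \<in> configs_src_sink T a f" by auto
      then have *: "loop_config T L" "is_path T p" "hd p = a" "last p = f"
        "\<And>l. l \<in> L \<Longrightarrow> set p \<inter> loop_edges l = {}"
        by (simp_all add: configs_src_sink_def)
      have "p \<in> ?P" using * by (auto simp: simple_lists_def is_path_def)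
      moreover have "loop_edges l \<subseteq> edges T - set p" if "l \<in> L" for l
        using loop_edges_in_edges[OF *(1) that] *(5)[OF that] by blast
      ultimately show "x \<in> (SIGMA p:?P. configs_in T (edges T - set p))"
        using x(1) *(1) by (simp add: configs_in_def)
    qed
  qed auto
  then have "numer T m \<epsilon> \<delta> a f = (\<Sum>(p, L)\<in>(SIGMA p:?P. configs_in T (edges T - set p)).
      arrow_path T m \<epsilon> \<delta> p * (\<Prod>l\<in>L. ?w l))"
    unfolding numer_def by (subst sum.reindex_bij_betw[symmetric]) (auto intro!: sum.cong)
  also have "\<dots> = (\<Sum>p\<in>?P. arrow_path T m \<epsilon> \<delta> p * loop_sum T ?w (edges T - set p))"
    using finP finite_edges[of T]
    by (subst sum.Sigma[symmetric]) (simp_all add: finite_configs_in loop_sum_def sum_distrib_left)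
  also have "\<dots> = (\<Sum>p\<in>?P. list_weight (hop T ?W) p * perm_det (edges T - set p) (transfer T m \<epsilon> \<delta>))"
  proof (intro sum.cong refl)
    fix p assume "p \<in> ?P"
    then have "list_weight (hop T ?W) p = list_weight ?W p" by (simp add: list_weight_hop_chained)
    moreover have "loop_sum T ?w (edges T - set p) = perm_det (edges T - set p) (transfer T m \<epsilon> \<delta>)"
      by (rule loop_sum_arrow[OF T]) blast
    ultimately show "arrow_path T m \<epsilon> \<delta> p * loop_sum T ?w (edges T - set p)
      = list_weight (hop T ?W) p * perm_det (edges T - set p) (transfer T m \<epsilon> \<delta>)"
      by (simp add: arrow_path_def arrow_nodes_eq_prod[OF T(2)] prod_list_nodes)
  qed
  also have "\<dots> = (\<Sum>p\<in>simple_lists (edges T) a f.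
      list_weight (hop T ?W) p * perm_det (edges T - set p) (transfer T m \<epsilon> \<delta>))"
    using finite_simple_lists[OF finite_edges[of T], of a f]
    by (intro sum.mono_neutral_left) (auto simp: list_weight_hop_not_chained)
  also have "\<dots> = perm_minor (edges T) (transfer T m \<epsilon> \<delta>) a f"
    using af finite_edges[of T]
    by (intro perm_minor_eq_sum_lists[symmetric]) (auto simp: transfer_def)
  finally show ?thesis .
qed

section \<open>Predecessors of an edge on the torus\<close>

definition pred_L :: "nat \<Rightarrow> pt \<Rightarrow> edge" where
  "pred_L T p = (((fst p + 1) mod (2 * int T), (snd p - 1) mod (2 * int T)), False)"

definition pred_R :: "nat \<Rightarrow> pt \<Rightarrow> edge" where
  "pred_R T p = (((fst p - 1) mod (2 * int T), (snd p - 1) mod (2 * int T)), True)"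

lemma e_end_eq_iff:
  assumes T: "T > 0" and e: "is_edge T e" and p: "lat_pt T p"
  shows "e_end T e = p \<longleftrightarrow> e = (if snd e then pred_R T p else pred_L T p)"
proof -
  have *: "(x + d) mod (2 * int T) = y \<longleftrightarrow> x = (y - d) mod (2 * int T)"
    if "0 \<le> x" "x < 2 * int T" "0 \<le> y" "y < 2 * int T" for x y d :: int
  proof
    assume "(x + d) mod (2 * int T) = y"
    then have "(y - d) mod (2 * int T) = (x + d - d) mod (2 * int T)" by (metis mod_diff_left_eq)
    then show "x = (y - d) mod (2 * int T)" using that by simp
  next
    assume "x = (y - d) mod (2 * int T)"
    then have "(x + d) mod (2 * int T) = (y - d + d) mod (2 * int T)" by (metis mod_add_left_eq)
    then show "(x + d) mod (2 * int T) = y" using that by simp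
  qed
  obtain x t d where ex: "e = ((x, t), d)" by (cases e) auto
  obtain x' t' where pt: "p = (x', t')" by force
  have b: "0 \<le> x" "x < 2 * int T" "0 \<le> t" "t < 2 * int T" "0 \<le> x'" "x' < 2 * int T" "0 \<le> t'" "t' < 2 * int T"
    using e p by (auto simp: ex pt is_edge_def lat_pt_def)
  show ?thesis
    using *[of x x' 1] *[of x x' "-1"] *[of t t' 1] b
    by (auto simp: ex pt e_end_def pred_L_def pred_R_def)
qed

lemma is_edge_pred:
  assumes T: "T > 0" and p: "lat_pt T p"
  shows "is_edge T (pred_L T p)" "is_edge T (pred_R T p)"
proof -
  have ev: "even (x mod (2 * int T)) \<longleftrightarrow> even x" for x
    by (metis dvd_mod_iff dvd_triv_left)
  show "is_edge T (pred_L T p)" "is_edge T (pred_R T p)"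
    using T p by (auto simp: is_edge_def lat_pt_def pred_L_def pred_R_def ev)
qed

lemma sum_hop:
  assumes T: "T > 0" and f: "is_edge T f"
  shows "(\<Sum>e\<in>edges T. y e * hop T W e f)
       = y (pred_L T (fst f)) * W (pred_L T (fst f)) f + y (pred_R T (fst f)) * W (pred_R T (fst f)) f"
proof -
  have p: "lat_pt T (fst f)" using f by (simp add: is_edge_def)
  \<comment> \<open>For T = 1 the two predecessors start at the same point; their directions still
    tell them apart.\<close>
  have ne: "pred_L T (fst f) \<noteq> pred_R T (fst f)" by (simp add: pred_L_def pred_R_def)
  have ends: "e_end T (pred_L T (fst f)) = fst f" "e_end T (pred_R T (fst f)) = fst f"
    using e_end_eq_iff[OF T is_edge_pred(1)[OF T p] p] e_end_eq_iff[OF T is_edge_pred(2)[OF T p] p]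
    by (simp_all add: pred_L_def pred_R_def)
  have "(\<Sum>e\<in>edges T. y e * hop T W e f) = (\<Sum>e\<in>{pred_L T (fst f), pred_R T (fst f)}. y e * hop T W e f)"
  proof (intro sum.mono_neutral_right ballI)
    fix e assume e: "e \<in> edges T - {pred_L T (fst f), pred_R T (fst f)}"
    then have "e_end T e \<noteq> fst f" using e_end_eq_iff[OF T _ p, of e] by (auto split: if_splits)
    then show "y e * hop T W e f = 0" by (simp add: hop_def)
  qed (use is_edge_pred[OF T p] finite_edges in auto)
  then show ?thesis using ne ends by (simp add: hop_def)
qed

section \<open>The scalar Klein-Gordon equation\<close>

lemma summable_cnj_mult_shift:
  fixes u :: "'a \<Rightarrow> complex"
  assumes sq: "(\<lambda>z. (cmod (u z))\<^sup>2) summable_on S" and b: "bij_betw \<sigma> S S"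
  shows "(\<lambda>z. cnj (u z) * u (\<sigma> z)) summable_on S"
proof -
  have "(\<lambda>z. (cmod (u (\<sigma> z)))\<^sup>2) summable_on S"
    using summable_on_reindex_bij_betw[OF b, of "\<lambda>z. (cmod (u z))\<^sup>2"] sq by simp
  with sq have "(\<lambda>z. (cmod (u z))\<^sup>2 + (cmod (u (\<sigma> z)))\<^sup>2) summable_on S"
    by (rule summable_on_add)
  then have "(\<lambda>z. norm (cnj (u z) * u (\<sigma> z))) summable_on S"
  proof (rule summable_on_comparison_test)
    fix z
    have "2 * (cmod (u z) * cmod (u (\<sigma> z))) \<le> (cmod (u z))\<^sup>2 + (cmod (u (\<sigma> z)))\<^sup>2"
      using sum_squares_bound[of "cmod (u z)" "cmod (u (\<sigma> z))"] by simp
    moreover have "0 \<le> cmod (u z) * cmod (u (\<sigma> z))" by simp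
    ultimately show "norm (cnj (u z) * u (\<sigma> z)) \<le> (cmod (u z))\<^sup>2 + (cmod (u (\<sigma> z)))\<^sup>2"
      unfolding norm_mult complex_mod_cnj by linarith
  qed simp
  then show ?thesis by (rule abs_summable_summable)
qed

text \<open>Reindexing by the bijection moves it onto the conjugated factor: the adjoint of a shift
  is the inverse shift.\<close>

lemma infsum_cnj_shift_inverse:
  fixes u :: "'a \<Rightarrow> complex"
  assumes b: "bij_betw \<sigma> S S" and inv: "\<And>z. z \<in> S \<Longrightarrow> \<sigma>' (\<sigma> z) = z"
  shows "infsum (\<lambda>z. cnj (u z) * u (\<sigma>' z)) S = cnj (infsum (\<lambda>z. cnj (u z) * u (\<sigma> z)) S)"
proof -
  have "infsum (\<lambda>z. cnj (u z) * u (\<sigma>' z)) S = infsum (\<lambda>z. cnj (u (\<sigma> z)) * u (\<sigma>' (\<sigma> z))) S"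
    using infsum_reindex_bij_betw[OF b, of "\<lambda>z. cnj (u z) * u (\<sigma>' z)"] by simp
  also have "\<dots> = infsum (\<lambda>z. cnj (cnj (u z) * u (\<sigma> z))) S"
    by (intro infsum_cong) (simp add: inv mult.commute)
  also have "\<dots> = cnj (infsum (\<lambda>z. cnj (u z) * u (\<sigma> z)) S)" by (rule infsum_cnj)
  finally show ?thesis .
qed

text \<open>The shift terms form a symmetric operator, so pairing the equation with \<^term>\<open>u\<close>
  and taking imaginary parts isolates \<^term>\<open>\<mu>\<close> times the square norm.\<close>
lemma klein_gordon_energy:
  fixes u s :: "'a \<Rightarrow> complex"
  assumes sq: "(\<lambda>z. (cmod (u z))\<^sup>2) summable_on S"
    and b: "bij_betw \<sigma> S S" "bij_betw \<sigma>' S S" "bij_betw \<tau> S S" "bij_betw \<tau>' S S"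
    and inv: "\<And>z. z \<in> S \<Longrightarrow> \<sigma>' (\<sigma> z) = z" "\<And>z. z \<in> S \<Longrightarrow> \<tau>' (\<tau> z) = z"
    and eq: "\<And>z. z \<in> S \<Longrightarrow> u (\<sigma> z) + u (\<sigma>' z) - of_real \<kappa> * (u (\<tau> z) + u (\<tau>' z))
        - \<i> * of_real \<mu> * u z = s z"
    and z0: "z0 \<in> S" "\<And>z. z \<in> S \<Longrightarrow> z \<noteq> z0 \<Longrightarrow> s z = 0"
  shows "\<mu> * infsum (\<lambda>z. (cmod (u z))\<^sup>2) S \<le> cmod (u z0) * cmod (s z0)"
proof -
  let ?I = "\<lambda>\<sigma>. infsum (\<lambda>z. cnj (u z) * u (\<sigma> z)) S"
  let ?N = "infsum (\<lambda>z. (cmod (u z))\<^sup>2) S"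
  note sm = summable_cnj_mult_shift[OF sq]
  have hs: "((\<lambda>z. cnj (u z) * u (\<rho> z)) has_sum ?I \<rho>) S" if "bij_betw \<rho> S S" for \<rho>
    using sm[OF that] by simp
  have "((\<lambda>z. (cmod (u z))\<^sup>2) has_sum ?N) S" using sq by simp
  then have hN: "((\<lambda>z. complex_of_real ((cmod (u z))\<^sup>2)) has_sum of_real ?N) S"
    by (rule has_sum_of_real)
  have "((\<lambda>z. (cnj (u z) * u (\<sigma> z) + cnj (u z) * u (\<sigma>' z))
       + (- of_real \<kappa>) * (cnj (u z) * u (\<tau> z) + cnj (u z) * u (\<tau>' z))
       + (- \<i> * of_real \<mu>) * complex_of_real ((cmod (u z))\<^sup>2))
     has_sum ((?I \<sigma> + ?I \<sigma>') + (- of_real \<kappa>) * (?I \<tau> + ?I \<tau>') + (- \<i> * of_real \<mu>) * of_real ?N)) S"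
    by (intro has_sum_add has_sum_cmult_right hs b hN)
  moreover have "((\<lambda>z. (cnj (u z) * u (\<sigma> z) + cnj (u z) * u (\<sigma>' z))
       + (- of_real \<kappa>) * (cnj (u z) * u (\<tau> z) + cnj (u z) * u (\<tau>' z))
       + (- \<i> * of_real \<mu>) * complex_of_real ((cmod (u z))\<^sup>2)) has_sum (cnj (u z0) * s z0)) S"
  proof -
    have "((\<lambda>z. cnj (u z) * s z) has_sum (cnj (u z0) * s z0)) {z0}"
      using has_sum_finite[of "{z0}" "\<lambda>z. cnj (u z) * s z"] by simp
    then have "((\<lambda>z. cnj (u z) * s z) has_sum (cnj (u z0) * s z0)) S"
      by (rule has_sum_cong_neutral[THEN iffD1, rotated -1]) (use z0 in auto)
    moreover have "cnj (u z) * s z = (cnj (u z) * u (\<sigma> z) + cnj (u z) * u (\<sigma>' z))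
       + (- of_real \<kappa>) * (cnj (u z) * u (\<tau> z) + cnj (u z) * u (\<tau>' z))
       + (- \<i> * of_real \<mu>) * complex_of_real ((cmod (u z))\<^sup>2)" if "z \<in> S" for z
      unfolding eq[OF that, symmetric] complex_norm_square by (simp add: algebra_simps)
    ultimately show ?thesis by (simp cong: has_sum_cong)
  qed
  ultimately have "(?I \<sigma> + ?I \<sigma>') + (- of_real \<kappa>) * (?I \<tau> + ?I \<tau>') + (- \<i> * of_real \<mu>) * of_real ?N
      = cnj (u z0) * s z0"
    by (rule has_sum_unique)
  then have "(?I \<sigma> + cnj (?I \<sigma>)) + (- of_real \<kappa>) * (?I \<tau> + cnj (?I \<tau>)) + (- \<i> * of_real \<mu>) * of_real ?N
      = cnj (u z0) * s z0"
    using infsum_cnj_shift_inverse[OF b(1) inv(1), where u = u]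
      infsum_cnj_shift_inverse[OF b(3) inv(2), where u = u] by simp
  then have "Im ((?I \<sigma> + cnj (?I \<sigma>)) + (- of_real \<kappa>) * (?I \<tau> + cnj (?I \<tau>)) + (- \<i> * of_real \<mu>) * of_real ?N)
      = Im (cnj (u z0) * s z0)" by (rule arg_cong)
  then have "- (\<mu> * ?N) = Im (cnj (u z0) * s z0)" by simp
  also have "\<bar>\<dots>\<bar> \<le> cmod (cnj (u z0) * s z0)" by (rule abs_Im_le_cmod)
  finally show ?thesis by (simp add: norm_mult)
qed

definition klein_gordon :: "real \<Rightarrow> real \<Rightarrow> (int \<Rightarrow> int \<Rightarrow> complex) \<Rightarrow> int \<Rightarrow> int \<Rightarrow> complex" where
  "klein_gordon \<kappa> \<mu> u n x = u (n + 1) x + u (n - 1) x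
     - of_real \<kappa> * (u n (x + 1) + u n (x - 1)) - \<i> * of_real \<mu> * u n x"

lemma klein_gordon_unique:
  assumes "\<mu> > 0" and sq: "(\<lambda>(n, x). (cmod (u n x))\<^sup>2) summable_on UNIV"
    and eq: "\<And>n x. klein_gordon \<kappa> \<mu> u n x = 0"
  shows "u n x = 0"
proof -
  have bij: "bij_betw (\<lambda>(n, x). (n + a, x + b :: int)) UNIV UNIV" for a b :: int
    by (rule bij_betw_byWitness[where f' = "\<lambda>(n, x). (n - a, x - b)"]) auto
  let ?u = "\<lambda>(n, x). u n x"
  have sq': "(\<lambda>z. (cmod (?u z))\<^sup>2) summable_on UNIV" using sq by (simp add: case_prod_unfold)
  \<comment> \<open>The source is zero, so any point can serve as its support; the right-hand side
    is 0.\<close>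
  have "\<mu> * infsum (\<lambda>z. (cmod (?u z))\<^sup>2) UNIV \<le> cmod (?u (0, 0)) * cmod ((\<lambda>_. 0 :: complex) (0 :: int, 0 :: int))"
  proof (rule klein_gordon_energy[OF sq' bij[of 1 0] bij[of "-1" 0] bij[of 0 1] bij[of 0 "-1"]])
    fix z :: "int \<times> int"
    show "?u ((\<lambda>(n, x). (n + 1, x + 0)) z) + ?u ((\<lambda>(n, x). (n + - 1, x + 0)) z)
      - of_real \<kappa> * (?u ((\<lambda>(n, x). (n + 0, x + 1)) z) + ?u ((\<lambda>(n, x). (n + 0, x + - 1)) z))
      - \<i> * of_real \<mu> * ?u z = 0"
      using eq[of "fst z" "snd z"] by (simp add: klein_gordon_def case_prod_unfold)
  qed auto
  then have "infsum (\<lambda>z. (cmod (?u z))\<^sup>2) UNIV \<le> 0"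
    using \<open>\<mu> > 0\<close> by (simp add: mult_le_0_iff)
  moreover have "(cmod (?u (n, x)))\<^sup>2 \<le> infsum (\<lambda>z. (cmod (?u z))\<^sup>2) UNIV"
    using finite_sum_le_infsum[OF sq', of "{(n, x)}"] by simp
  ultimately have "(cmod (u n x))\<^sup>2 \<le> 0" unfolding case_prod_conv by linarith
  then show ?thesis by simp
qed

lemma int_mod_shift_bij:
  assumes "T > (0 :: int)"
  shows "bij_betw (\<lambda>n. (n + a) mod T) {0..<T} {0..<T}"
proof (rule bij_betw_byWitness[where f' = "\<lambda>n. (n - a) mod T"])
  show "\<forall>n\<in>{0..<T}. ((n + a) mod T - a) mod T = n"
    by (auto simp: mod_diff_left_eq)
  show "\<forall>n\<in>{0..<T}. ((n - a) mod T + a) mod T = n"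
    by (auto simp: mod_add_left_eq)
qed (use assms in auto)

definition periodic2 :: "int \<Rightarrow> (int \<Rightarrow> int \<Rightarrow> complex) \<Rightarrow> bool" where
  "periodic2 T u \<longleftrightarrow> (\<forall>n x. u (n mod T) (x mod T) = u n x)"

text \<open>This serves twice. A zero source forces \<open>u\<close> to vanish, which gives the
  nonzero determinant. A unit source at the origin bounds the square norm of the torus Green
  function independently of its size.\<close>

lemma klein_gordon_torus_bound:
  assumes T: "T > (0 :: int)" and per: "periodic2 T u"
    and s: "\<And>n x. n mod T \<noteq> 0 \<or> x mod T \<noteq> 0 \<Longrightarrow> klein_gordon \<kappa> \<mu> u n x = 0"
  shows "\<mu> * (\<Sum>(n, x)\<in>{0..<T} \<times> {0..<T}. (cmod (u n x))\<^sup>2)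
    \<le> cmod (u 0 0) * cmod (klein_gordon \<kappa> \<mu> u 0 0)"
proof -
  let ?S = "{0..<T} \<times> {0..<T}"
  let ?sh = "\<lambda>a b (n, x). ((n + a) mod T, (x + b) mod T)"
  have bij: "bij_betw (?sh a b) ?S ?S" for a b
  proof -
    have "bij_betw (map_prod (\<lambda>n. (n + a) mod T) (\<lambda>x. (x + b) mod T)) ?S ?S"
      using int_mod_shift_bij[OF T] by (intro bij_betw_map_prod)
    then show ?thesis by (simp add: map_prod_def)
  qed
  have inv: "?sh (-a) (-b) (?sh a b z) = z" if "z \<in> ?S" for a b z
    using that by (auto simp: mod_diff_left_eq mod_add_left_eq)
  have p: "u (n mod T) (x mod T) = u n x" for n x using per by (simp add: periodic2_def)
  let ?u = "\<lambda>(n, x). u n x"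
  have "\<mu> * infsum (\<lambda>z. (cmod (?u z))\<^sup>2) ?S \<le> cmod (?u (0, 0)) * cmod ((\<lambda>(n, x). klein_gordon \<kappa> \<mu> u n x) (0, 0))"
  proof (rule klein_gordon_energy[OF _ bij[of 1 0] bij[of "-1" 0] bij[of 0 1] bij[of 0 "-1"]])
    fix z assume z: "z \<in> ?S"
    show "?sh (-1) 0 (?sh 1 0 z) = z" using inv[OF z, of 1 0] by simp
    show "?sh 0 (-1) (?sh 0 1 z) = z" using inv[OF z, of 0 1] by simp
    show "?u (?sh 1 0 z) + ?u (?sh (-1) 0 z) - of_real \<kappa> * (?u (?sh 0 1 z) + ?u (?sh 0 (-1) z))
      - \<i> * of_real \<mu> * ?u z = (\<lambda>(n, x). klein_gordon \<kappa> \<mu> u n x) z"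
      by (simp add: klein_gordon_def case_prod_unfold p)
    show "(\<lambda>(n, x). klein_gordon \<kappa> \<mu> u n x) z = 0" if "z \<noteq> (0, 0)"
      using z that s[of "fst z" "snd z"] by (auto simp: case_prod_unfold prod_eq_iff)
  qed (use T in auto)
  then show ?thesis by (simp add: case_prod_unfold)
qed

text \<open>For \<^term>\<open>Im w > 0\<close> this is the root inside the unit disc of
  \<^term>\<open>z + 1 / z = 2 * w\<close>; it extends continuously to the real interval (-1,1).\<close>
definition root_in :: "complex \<Rightarrow> complex" where
  "root_in w = w - \<i> * csqrt (1 - w\<^sup>2)"

lemma root_in_mult: "root_in w * (w + \<i> * csqrt (1 - w\<^sup>2)) = 1"
proof -
  have "root_in w * (w + \<i> * csqrt (1 - w\<^sup>2)) = w\<^sup>2 + (csqrt (1 - w\<^sup>2))\<^sup>2"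
    by (simp add: root_in_def algebra_simps power2_eq_square)
  then show ?thesis by simp
qed

lemma root_in_nonzero [simp]: "root_in w \<noteq> 0"
  using root_in_mult[of w] by auto

lemma inverse_root_in: "1 / root_in w = w + \<i> * csqrt (1 - w\<^sup>2)"
  using root_in_mult[of w] by (simp add: field_simps)

lemma root_in_plus_inverse: "root_in w + 1 / root_in w = 2 * w"
  by (simp add: inverse_root_in) (simp add: root_in_def)

lemma root_in_minus_inverse: "root_in w - 1 / root_in w = - 2 * \<i> * csqrt (1 - w\<^sup>2)"
  by (simp add: inverse_root_in) (simp add: root_in_def)

text \<open>For \<open>l = root_in w\<close> the imaginary part of \<open>l + 1 / l\<close> is that
  of \<open>l\<close> times \<open>1 - 1 / |l|^2\<close>, and it equals twice that of
  \<open>w\<close>, hence is positive. So it is enough that \<open>l\<close> lies in the lower half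
  plane, that is, that the real part of the square root exceeds \<open>Im w\<close>.\<close>

lemma norm_root_in:
  assumes "Im w > 0"
  shows "cmod (root_in w) < 1"
proof -
  define s where "s = csqrt (1 - w\<^sup>2)"
  have s2: "s\<^sup>2 = 1 - w\<^sup>2" by (simp add: s_def)
  have re: "(Re s)\<^sup>2 - (Im s)\<^sup>2 = 1 - (Re w)\<^sup>2 + (Im w)\<^sup>2" and im: "Re s * Im s = - (Re w * Im w)"
    using arg_cong[OF s2, of Re] arg_cong[OF s2, of Im] by (simp_all add: power2_eq_square mult.commute)
  have "Re s \<ge> 0" unfolding s_def by (rule Re_csqrt)
  \<comment> \<open>The two components of \<open>s\<^sup>2 = 1 - w\<^sup>2\<close> conflict
    otherwise: the real one makes \<open>(Re w)\<^sup>2\<close> exceed \<open>(Im s)\<^sup>2\<close>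
    by at least 1, the imaginary one bounds it by \<open>(Im s)\<^sup>2\<close>.\<close>
  have "Re s > Im w"
  proof (rule ccontr)
    assume "\<not> Re s > Im w"
    then have le: "Re s \<le> Im w" by simp
    then have "(Re s)\<^sup>2 \<le> (Im w)\<^sup>2" using \<open>Re s \<ge> 0\<close> by (rule power_mono)
    then have "(Re w)\<^sup>2 \<ge> 1 + (Im s)\<^sup>2" using re by linarith
    moreover have "(Re w)\<^sup>2 \<le> (Im s)\<^sup>2"
    proof -
      have "\<bar>Re w\<bar> * Im w = Re s * \<bar>Im s\<bar>"
        using arg_cong[OF im, of abs] assms \<open>Re s \<ge> 0\<close> by (simp add: abs_mult)
      also have "\<dots> \<le> Im w * \<bar>Im s\<bar>" using le by (intro mult_right_mono) auto
      finally have "\<bar>Re w\<bar> \<le> \<bar>Im s\<bar>" using assms by (simp add: mult.commute)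
      then show ?thesis by (simp add: abs_le_square_iff)
    qed
    ultimately show False by linarith
  qed
  let ?l = "root_in w"
  have neg: "Im ?l < 0" using \<open>Re s > Im w\<close> by (simp add: root_in_def s_def)
  have "Im (?l + 1 / ?l) > 0" using assms by (simp add: root_in_plus_inverse)
  then have "Im ?l * (1 - 1 / (cmod ?l)\<^sup>2) > 0"
    by (simp add: Im_divide cmod_power2 algebra_simps)
  then have "1 - 1 / (cmod ?l)\<^sup>2 < 0" using neg by (simp add: zero_less_mult_iff)
  then have "(cmod ?l)\<^sup>2 < 1" by (simp add: field_simps)
  then show ?thesis by (simp add: abs_square_less_1)
qed

lemma root_in_minus_inverse_nonzero:
  assumes "Im w > 0"
  shows "root_in w - 1 / root_in w \<noteq> 0"
proof
  assume "root_in w - 1 / root_in w = 0"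
  then have "(root_in w)\<^sup>2 = 1" by (simp add: field_simps power2_eq_square)
  then have "cmod (root_in w) = 1"
    by (metis norm_one norm_power power2_eq_1_iff norm_ge_zero abs_norm_cancel abs_1 abs_minus_cancel)
  with norm_root_in[OF assms] show False by simp
qed

section \<open>Fourier modes and the Green function of the torus\<close>

definition mode :: "complex \<Rightarrow> nat \<Rightarrow> complex" where
  "mode l k = l ^ k / (l - 1 / l)"

text \<open>For 0 \<le> k \<le> T and |l| < 1 this is the sum of the decaying mode over all
  translates of \<open>k\<close> by multiples of T. The translates to the right and to the left are
  two geometric series, with first terms \<open>l ^ k\<close> and
  \<open>l ^ (T - k)\<close>.\<close>

definition torus_mode :: "nat \<Rightarrow> complex \<Rightarrow> nat \<Rightarrow> complex" where
  "torus_mode T l k = (l ^ k + l ^ (T - k)) / ((1 - l ^ T) * (l - 1 / l))"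

definition mode_int :: "nat \<Rightarrow> complex \<Rightarrow> int \<Rightarrow> complex" where
  "mode_int T l n = torus_mode T l (nat (n mod int T))"

lemma torus_mode_step:
  assumes "l \<noteq> 0" "0 < k" "k < T"
  shows "torus_mode T l (k + 1) + torus_mode T l (k - 1) - (l + 1 / l) * torus_mode T l k = 0"
proof -
  obtain j where j: "k = Suc j" using assms by (cases k) auto
  obtain i where i: "T = Suc (Suc (j + i))" using assms j less_imp_Suc_add[of k T] by auto
  have e: "l ^ (k + 1) + l ^ (T - (k + 1)) + (l ^ (k - 1) + l ^ (T - (k - 1)))
      - (l + 1 / l) * (l ^ k + l ^ (T - k)) = 0"
    using \<open>l \<noteq> 0\<close> by (simp add: j i Suc_diff_le field_simps)
  define c where "c = inverse ((1 - l ^ T) * (l - 1 / l))"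
  have tm: "torus_mode T l i = (l ^ i + l ^ (T - i)) * c" for i
    by (simp only: torus_mode_def c_def divide_inverse)
  have "torus_mode T l (k + 1) + torus_mode T l (k - 1) - (l + 1 / l) * torus_mode T l k
     = (l ^ (k + 1) + l ^ (T - (k + 1)) + (l ^ (k - 1) + l ^ (T - (k - 1)))
      - (l + 1 / l) * (l ^ k + l ^ (T - k))) * c"
    by (simp only: tm ring_distribs mult.assoc)
  then show ?thesis by (simp only: e mult_zero_left)
qed

lemma torus_mode_source:
  assumes "l \<noteq> 0" "l ^ T \<noteq> 1" "l - 1 / l \<noteq> 0" "T > 0"
  shows "torus_mode T l 1 + torus_mode T l (T - 1) - (l + 1 / l) * torus_mode T l 0 = 1"
proof -
  obtain t where t: "T = Suc t" using assms by (cases T) auto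
  have e: "l ^ 1 + l ^ (T - 1) + (l ^ (T - 1) + l ^ (T - (T - 1)))
      - (l + 1 / l) * (l ^ 0 + l ^ (T - 0)) = (1 - l ^ T) * (l - 1 / l)"
    using \<open>l \<noteq> 0\<close> by (simp add: t field_simps)
  define c where "c = inverse ((1 - l ^ T) * (l - 1 / l))"
  have tm: "torus_mode T l i = (l ^ i + l ^ (T - i)) * c" for i
    by (simp only: torus_mode_def c_def divide_inverse)
  have "torus_mode T l 1 + torus_mode T l (T - 1) - (l + 1 / l) * torus_mode T l 0
     = (l ^ 1 + l ^ (T - 1) + (l ^ (T - 1) + l ^ (T - (T - 1)))
      - (l + 1 / l) * (l ^ 0 + l ^ (T - 0))) * c"
    by (simp only: tm ring_distribs mult.assoc)
  also have "\<dots> = 1"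
    unfolding e c_def by (rule right_inverse) (use assms in simp)
  finally show ?thesis .
qed

lemma torus_mode_wrap: "torus_mode T l T = torus_mode T l 0"
  by (simp add: torus_mode_def add.commute)

text \<open>Inside a period both \<open>l ^ k\<close> and \<open>l ^ (T - k)\<close> solve the
  homogeneous recurrence. At multiples of T the two branches meet with a kink, and the denominator
  is chosen to make its size 1.\<close>

lemma mode_int_eq:
  assumes l: "l \<noteq> 0" "l ^ T \<noteq> 1" "l - 1 / l \<noteq> 0" and T: "T > 0"
  shows "mode_int T l (n + 1) + mode_int T l (n - 1) - (l + 1 / l) * mode_int T l n
    = (if int T dvd n then 1 else 0)"
proof -
  define r where "r = n mod int T"
  have r: "0 \<le> r" "r < int T" using T by (auto simp: r_def)
  have up: "mode_int T l (n + 1) = torus_mode T l (nat r + 1)"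
  proof (cases "r + 1 = int T")
    case True
    then have "(n + 1) mod int T = 0" unfolding r_def by (metis mod_add_left_eq mod_self)
    moreover have "nat r + 1 = T" using True r by linarith
    ultimately show ?thesis by (simp add: mode_int_def torus_mode_wrap)
  next
    case False
    have "(n + 1) mod int T = (r + 1) mod int T" unfolding r_def by (simp add: mod_add_left_eq)
    then have "(n + 1) mod int T = r + 1" using False r by simp
    then show ?thesis using r by (simp add: mode_int_def nat_add_distrib)
  qed
  show ?thesis
  proof (cases "r = 0")
    case True
    have "(n - 1) mod int T = (r - 1) mod int T" unfolding r_def by (simp add: mod_diff_left_eq)
    also have "\<dots> = int T - 1" using True T by (simp add: zmod_minus1)
    finally have "mode_int T l (n - 1) = torus_mode T l (T - 1)"
      using T by (simp add: mode_int_def nat_diff_distrib)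
    then show ?thesis using up True torus_mode_source[OF l T]
      by (simp add: mode_int_def r_def dvd_eq_mod_eq_0)
  next
    case False
    have "(n - 1) mod int T = (r - 1) mod int T" unfolding r_def by (simp add: mod_diff_left_eq)
    then have "(n - 1) mod int T = r - 1" using False r by simp
    moreover have "nat (r - 1) = nat r - 1" using False r by linarith
    ultimately have "mode_int T l (n - 1) = torus_mode T l (nat r - 1)"
      by (simp add: mode_int_def)
    then show ?thesis using up False r torus_mode_step[OF l(1), of "nat r" T]
      by (simp add: mode_int_def r_def dvd_eq_mod_eq_0)
  qed
qed

text \<open>Half the factor by which the space and mass terms of \<open>klein_gordon\<close> act on
  the wave with momentum \<theta>. The recurrence in time for that wave thus has characteristic
  roots with sum twice the symbol.\<close>

definition symbol :: "real \<Rightarrow> real \<Rightarrow> real \<Rightarrow> complex" where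
  "symbol \<kappa> \<mu> \<theta> = complex_of_real (\<kappa> * cos (2 * pi * \<theta>)) + \<i> * complex_of_real (\<mu> / 2)"

definition torus_green :: "real \<Rightarrow> real \<Rightarrow> nat \<Rightarrow> int \<Rightarrow> int \<Rightarrow> complex" where
  "torus_green \<kappa> \<mu> T n x = (\<Sum>j<T. cis (2 * pi * (real j / real T) * of_int x)
      * mode_int T (root_in (symbol \<kappa> \<mu> (real j / real T))) n) / of_nat T"

lemma sum_cis_roots:
  assumes T: "T > 0"
  shows "(\<Sum>j<T. cis (2 * pi * (real j / real T) * of_int x)) = (if int T dvd x then of_nat T else 0)"
proof -
  define z where "z = cis (2 * pi * of_int x / real T)"
  have zj: "cis (2 * pi * (real j / real T) * of_int x) = z ^ j" for j
    unfolding z_def Complex.DeMoivre by (rule arg_cong[of _ _ cis]) (simp add: field_simps)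
  have "z ^ T = cis (2 * pi * of_int x)" unfolding z_def Complex.DeMoivre
    using T by (intro arg_cong[of _ _ cis]) (simp add: field_simps)
  then have zT: "z ^ T = 1" using cis_multiple_2pi[of "of_int x"] by simp
  show ?thesis
  proof (cases "int T dvd x")
    case True
    then obtain k where "x = int T * k" by blast
    then have "2 * pi * real_of_int x / real T = 2 * pi * real_of_int k" using T by simp
    then have "z = cis (2 * pi * of_int k)" unfolding z_def by (rule arg_cong)
    then have "z = 1" using cis_multiple_2pi[of "of_int k"] by simp
    with True show ?thesis by (simp only: zj) simp
  next
    case False
    have "z \<noteq> 1"
    proof
      assume "z = 1"
      then have "cos (2 * pi * of_int x / real T) = 1" by (simp add: z_def cis.ctr complex_eq_iff)
      then obtain k :: int where "2 * pi * of_int x / real T = of_int k * 2 * pi"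
        using cos_one_2pi_int by blast
      then have "real_of_int x = of_int (k * int T)" using T by (simp add: field_simps)
      then have "x = k * int T" by (simp only: of_int_eq_iff)
      with False show False by simp
    qed
    with False zT show ?thesis by (simp only: zj) (simp add: sum_gp_strict)
  qed
qed

text \<open>Each momentum j/T decouples into the recurrence of \<open>mode_int_eq\<close>, with a
  source at the times divisible by T. Averaging the waves over all momenta localises the source in
  space as well.\<close>

lemma torus_green_equation:
  assumes "\<mu> > 0" and T: "T > 0"
  shows "klein_gordon \<kappa> \<mu> (torus_green \<kappa> \<mu> T) n x = (if int T dvd n \<and> int T dvd x then 1 else 0)"
proof -
  let ?e = "\<lambda>j (x :: int). cis (2 * pi * (real j / real T) * of_int x)"
  let ?l = "\<lambda>j. root_in (symbol \<kappa> \<mu> (real j / real T))"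
  let ?m = "\<lambda>j n. mode_int T (?l j) n"
  have mode_eq: "?e j x * ?m j (n + 1) + ?e j x * ?m j (n - 1)
      - of_real \<kappa> * (?e j (x + 1) * ?m j n + ?e j (x - 1) * ?m j n) - \<i> * of_real \<mu> * (?e j x * ?m j n)
    = ?e j x * (if int T dvd n then 1 else 0)" for j
  proof -
    let ?w = "symbol \<kappa> \<mu> (real j / real T)"
    have w: "Im ?w > 0" using assms by (simp add: symbol_def)
    have n1: "cmod (?l j) < 1" by (rule norm_root_in[OF w])
    then have "cmod (?l j ^ T) < 1" using T by (simp add: norm_power power_less_one_iff)
    then have lT: "?l j ^ T \<noteq> 1" by auto
    let ?a = "2 * pi * (real j / real T)"
    have "?e j (x + 1) = ?e j x * cis ?a" "?e j (x - 1) = ?e j x * cis (- ?a)"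
      unfolding cis_mult by (rule arg_cong[of _ _ cis], simp add: distrib_left right_diff_distrib)+
    moreover have "cis ?a + cis (- ?a) = 2 * of_real (cos ?a)"
      by (simp add: complex_eq_iff)
    ultimately have "?e j (x + 1) + ?e j (x - 1) = ?e j x * (2 * of_real (cos ?a))"
      by (metis distrib_left)
    then have "of_real \<kappa> * (?e j (x + 1) * ?m j n + ?e j (x - 1) * ?m j n) + \<i> * of_real \<mu> * (?e j x * ?m j n)
       = ?e j x * (2 * ?w) * ?m j n"
      by (simp add: symbol_def distrib_right[symmetric] algebra_simps)
    also have "2 * ?w = ?l j + 1 / ?l j" by (simp add: root_in_plus_inverse)
    finally have "?e j x * ?m j (n + 1) + ?e j x * ?m j (n - 1)
      - of_real \<kappa> * (?e j (x + 1) * ?m j n + ?e j (x - 1) * ?m j n) - \<i> * of_real \<mu> * (?e j x * ?m j n)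
      = ?e j x * (?m j (n + 1) + ?m j (n - 1) - (?l j + 1 / ?l j) * ?m j n)"
      by (simp add: algebra_simps)
    then show ?thesis
      using mode_int_eq[OF root_in_nonzero lT root_in_minus_inverse_nonzero[OF w] T, of n] by simp
  qed
  have "klein_gordon \<kappa> \<mu> (torus_green \<kappa> \<mu> T) n x
    = (\<Sum>j<T. ?e j x * ?m j (n + 1) + ?e j x * ?m j (n - 1)
      - of_real \<kappa> * (?e j (x + 1) * ?m j n + ?e j (x - 1) * ?m j n) - \<i> * of_real \<mu> * (?e j x * ?m j n)) / of_nat T"
    by (simp only: klein_gordon_def torus_green_def sum.distrib sum_subtractf sum_distrib_left[symmetric]
        divide_inverse ring_distribs mult.assoc)
  also have "\<dots> = (\<Sum>j<T. ?e j x * (if int T dvd n then 1 else 0)) / of_nat T"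
    by (simp only: mode_eq)
  also have "\<dots> = (\<Sum>j<T. ?e j x) * (if int T dvd n then 1 else 0) / of_nat T"
    by (simp only: sum_distrib_right)
  also have "\<dots> = (if int T dvd n \<and> int T dvd x then 1 else 0)"
    unfolding sum_cis_roots[OF T] using T by simp
  finally show ?thesis .
qed

lemma torus_green_periodic:
  assumes T: "T > 0"
  shows "periodic2 (int T) (torus_green \<kappa> \<mu> T)"
proof -
  have "cis (2 * pi * (real j / real T) * of_int (x mod int T)) = cis (2 * pi * (real j / real T) * of_int x)"
    for j x
  proof -
    have "of_int x = (of_int (x mod int T) :: real) + of_int (int T * (x div int T))"
      unfolding of_int_add[symmetric] by simp
    then have "2 * pi * (real j / real T) * of_int x
      = 2 * pi * (real j / real T) * of_int (x mod int T) + 2 * pi * of_int (int j * (x div int T))"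
      using T by (simp add: field_simps)
    then show ?thesis by (simp only: cis_mult[symmetric] cis_multiple_2pi Ints_of_int) simp
  qed
  then show ?thesis by (simp add: periodic2_def torus_green_def mode_int_def)
qed

section \<open>From the torus to the infinite lattice\<close>

lemma riemann_sum_tendsto_integral:
  fixes f :: "real \<Rightarrow> complex"
  assumes cont: "continuous_on {0..1} f"
  shows "(\<lambda>T. (\<Sum>j<T. f (real j / real T)) / of_nat T) \<longlonglongrightarrow> integral {0..1} f"
proof (rule LIMSEQ_I)
  fix e :: real assume e: "0 < e"
  have "uniformly_continuous_on {0..1} f"
    using cont by (intro compact_uniformly_continuous) auto
  with e obtain d where d: "d > 0" "\<And>x y. x \<in> {0..1} \<Longrightarrow> y \<in> {0..1} \<Longrightarrow> dist y x < d \<Longrightarrow> dist (f y) (f x) < e / 2"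
    unfolding uniformly_continuous_on_def by (metis half_gt_zero)
  obtain N where N: "real N > 1 / d" using reals_Archimedean2 by blast
  show "\<exists>N. \<forall>T\<ge>N. norm ((\<Sum>j<T. f (real j / real T)) / of_nat T - integral {0..1} f) < e"
  proof (intro exI[of _ "Suc N"] allI impI)
    fix T assume T: "Suc N \<le> T"
    then have T0: "real T > 0" by simp
    have "1 / d < real T" using N T by linarith
    then have Td: "1 / real T < d" using d(1) T0 by (simp add: field_simps)
    have int: "f integrable_on {a..b}" if "0 \<le> a" "b \<le> 1" for a b
      using that by (intro integrable_continuous_interval continuous_on_subset[OF cont]) auto
    let ?p = "\<lambda>j. real j / real T"
    have split: "integral {0..?p k} f = (\<Sum>j<k. integral {?p j..?p (Suc j)} f)" if "k \<le> T" for k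
      using that
    proof (induction k)
      case (Suc k)
      have "integral {0..?p k} f + integral {?p k..?p (Suc k)} f = integral {0..?p (Suc k)} f"
        using Suc.prems T0 by (intro Henstock_Kurzweil_Integration.integral_combine int)
          (simp_all add: divide_right_mono)
      then show ?case using Suc by simp
    qed simp
    have piece: "norm (f (?p j) / of_nat T - integral {?p j..?p (Suc j)} f) \<le> e / 2 * (1 / real T)"
      if j: "j < T" for j
    proof -
      have p: "0 \<le> ?p j" "?p j \<le> ?p (Suc j)" "?p (Suc j) \<le> 1" "?p (Suc j) - ?p j = 1 / real T"
        using j T0 by (auto simp: field_simps)
      have c: "f (?p j) / of_nat T = integral {?p j..?p (Suc j)} (\<lambda>_. f (?p j))"
        using p(2,4) by (simp add: scaleR_conv_of_real)
      have "f (?p j) / of_nat T - integral {?p j..?p (Suc j)} f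
        = integral {?p j..?p (Suc j)} (\<lambda>x. f (?p j) - f x)"
        unfolding c using int p by (intro Henstock_Kurzweil_Integration.integral_diff[symmetric]) auto
      also have "norm \<dots> \<le> e / 2 * (?p (Suc j) - ?p j)"
      proof (rule integral_bound)
        show "continuous_on {?p j..?p (Suc j)} (\<lambda>x. f (?p j) - f x)"
          using p by (intro continuous_intros continuous_on_subset[OF cont]) auto
        fix x assume x: "x \<in> {?p j..?p (Suc j)}"
        then have "dist (?p j) x < d" using p(4) Td by (simp add: dist_real_def)
        moreover have "x \<in> {0..1}" "?p j \<in> {0..1}" using x p(1-3) unfolding atLeastAtMost_iff by linarith+
        ultimately have "dist (f (?p j)) (f x) < e / 2" by (intro d(2))
        then show "norm (f (?p j) - f x) \<le> e / 2" by (simp add: dist_norm)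
      qed (use p in auto)
      finally show ?thesis using p(4) by simp
    qed
    have "(\<Sum>j<T. f (?p j)) / of_nat T - integral {0..1} f
      = (\<Sum>j<T. f (?p j) / of_nat T - integral {?p j..?p (Suc j)} f)"
      using split[OF order_refl] T0 by (simp add: sum_subtractf sum_divide_distrib)
    also have "norm \<dots> \<le> (\<Sum>j<T. e / 2 * (1 / real T))"
      by (rule sum_norm_le) (use piece in auto)
    also have "\<dots> = e / 2" using T0 by simp
    finally show "norm ((\<Sum>j<T. f (?p j)) / of_nat T - integral {0..1} f) < e" using e by linarith
  qed
qed

text \<open>The open half plane holds the symbols for \<mu> > 0; the real interval is added for the
  limit \<mu> = 0. The other real points are left out because there \<open>1 - w\<^sup>2\<close>
  lies on the branch cut of \<open>csqrt\<close>.\<close>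

definition symbol_domain :: "complex set" where
  "symbol_domain = {w. Im w > 0 \<or> Im w = 0 \<and> \<bar>Re w\<bar> < 1}"

lemma symbol_domain_csqrt:
  assumes "w \<in> symbol_domain"
  shows "1 - w\<^sup>2 \<notin> \<real>\<^sub>\<le>\<^sub>0"
proof
  assume "1 - w\<^sup>2 \<in> \<real>\<^sub>\<le>\<^sub>0"
  then have *: "1 - (Re w)\<^sup>2 + (Im w)\<^sup>2 \<le> 0" "Re w * Im w = 0"
    by (auto simp: complex_nonpos_Reals_iff power2_eq_square)
  have "(Re w)\<^sup>2 < 1" using assms * by (auto simp: symbol_domain_def abs_square_less_1)
  then show False using *(1) zero_le_power2[of "Im w"] by linarith
qed

lemma continuous_on_root_in: "continuous_on symbol_domain root_in"
  unfolding root_in_def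
  by (intro continuous_intros continuous_on_compose2[OF continuous_on_csqrt])
     (use symbol_domain_csqrt in auto)

lemma continuous_on_mode: "continuous_on symbol_domain (\<lambda>w. mode (root_in w) k)"
proof -
  have "csqrt (1 - w\<^sup>2) \<noteq> 0" if "w \<in> symbol_domain" for w
    using symbol_domain_csqrt[OF that] by auto
  then show ?thesis
    unfolding mode_def root_in_minus_inverse
    by (intro continuous_intros continuous_on_root_in continuous_on_compose2[OF continuous_on_csqrt])
       (use symbol_domain_csqrt in auto)
qed

definition green :: "real \<Rightarrow> real \<Rightarrow> int \<Rightarrow> int \<Rightarrow> complex" where
  "green \<kappa> \<mu> n x = integral {0..1} (\<lambda>\<theta>. cis (2 * pi * \<theta> * of_int x)
      * mode (root_in (symbol \<kappa> \<mu> \<theta>)) (nat \<bar>n\<bar>))"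

lemma symbol_in_domain:
  assumes "\<mu> > 0 \<or> \<mu> = 0 \<and> \<bar>\<kappa>\<bar> < 1"
  shows "symbol \<kappa> \<mu> \<theta> \<in> symbol_domain"
proof -
  have "\<bar>\<kappa> * cos (2 * pi * \<theta>)\<bar> \<le> \<bar>\<kappa>\<bar> * 1"
    unfolding abs_mult by (intro mult_left_mono) auto
  then show ?thesis using assms by (auto simp: symbol_domain_def symbol_def)
qed

text \<open>Since the momentum runs over a compact interval, joint continuity of the integrand
  suffices. The alternative with \<mu> = 0 and \<open>\<kappa>\<close> of modulus below 1 is the
  endpoint \<delta> = 0.\<close>

lemma continuous_on_green_param:
  fixes U :: "real set"
  assumes \<kappa>: "continuous_on U \<kappa>" and \<mu>: "continuous_on U \<mu>"
    and U: "\<And>d. d \<in> U \<Longrightarrow> \<mu> d > 0 \<or> \<mu> d = 0 \<and> \<bar>\<kappa> d\<bar> < 1"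
  shows "continuous_on U (\<lambda>d. green (\<kappa> d) (\<mu> d) n x)"
  unfolding green_def cbox_interval[symmetric]
proof (rule integral_continuous_on_param)
  have \<kappa>': "continuous_on (U \<times> cbox 0 1) (\<lambda>z. \<kappa> (fst z))"
    by (rule continuous_on_compose2[OF \<kappa>]) (auto intro: continuous_intros)
  have \<mu>': "continuous_on (U \<times> cbox 0 1) (\<lambda>z. \<mu> (fst z))"
    by (rule continuous_on_compose2[OF \<mu>]) (auto intro: continuous_intros)
  have "continuous_on (U \<times> cbox 0 1) (\<lambda>z. symbol (\<kappa> (fst z)) (\<mu> (fst z)) (snd z))"
    unfolding symbol_def by (intro continuous_intros \<kappa>' \<mu>') auto
  then have "continuous_on (U \<times> cbox 0 1) (\<lambda>z. mode (root_in (symbol (\<kappa> (fst z)) (\<mu> (fst z)) (snd z))) (nat \<bar>n\<bar>))"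
    by (rule continuous_on_compose2[OF continuous_on_mode]) (use U symbol_in_domain in auto)
  moreover have "continuous_on (U \<times> cbox 0 1) (\<lambda>z. cis (2 * pi * snd z * of_int x))"
    unfolding cis_conv_exp by (intro continuous_intros)
  ultimately show "continuous_on (U \<times> cbox 0 1) (\<lambda>(d, \<theta>). cis (2 * pi * \<theta> * of_int x)
      * mode (root_in (symbol (\<kappa> d) (\<mu> d) \<theta>)) (nat \<bar>n\<bar>))"
    unfolding case_prod_unfold by (intro continuous_on_mult)
qed

lemma torus_mode_symmetric: "k \<le> T \<Longrightarrow> torus_mode T l (T - k) = torus_mode T l k"
  by (simp add: torus_mode_def add.commute)

lemma mode_int_eq_torus_mode:
  assumes "nat \<bar>n\<bar> < T"
  shows "mode_int T l n = torus_mode T l (nat \<bar>n\<bar>)"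
proof (cases "n \<ge> 0")
  case True
  then show ?thesis using assms by (simp add: mode_int_def)
next
  case False
  have "n mod int T = (n + int T) mod int T" by simp
  also have "\<dots> = n + int T" using False assms by (intro mod_pos_pos_trivial) auto
  finally have "nat (n mod int T) = T - nat \<bar>n\<bar>" using False assms by linarith
  then show ?thesis using assms torus_mode_symmetric[of "nat \<bar>n\<bar>" T l] by (simp add: mode_int_def)
qed

text \<open>The difference consists of the translates that wrap around the torus; the shortest of
  them has length \<open>T - k\<close>.\<close>

lemma torus_mode_diff_bound:
  assumes l: "l \<noteq> 0" "cmod l \<le> \<rho>" "\<rho> < 1" "cmod (1 / (l - 1 / l)) \<le> C" and k: "k < T"
  shows "cmod (torus_mode T l k - mode l k) \<le> 2 * \<rho> ^ (T - k) / (1 - \<rho>) * C"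
proof -
  have \<rho>: "0 \<le> \<rho>" using l(2) norm_ge_zero order_trans by blast
  have pT: "\<rho> ^ T \<le> \<rho>" using \<rho> l(3) k by (cases T) (auto simp: mult_left_le power_le_one)
  have lp: "cmod (l ^ i) \<le> \<rho> ^ i" for i using l(2) by (simp add: norm_power power_mono)
  have "1 - \<rho> \<le> 1 - cmod (l ^ T)" using lp[of T] pT by linarith
  also have "\<dots> \<le> cmod (1 - l ^ T)" using norm_triangle_ineq2[of 1 "l ^ T"] by simp
  finally have den: "1 - \<rho> \<le> cmod (1 - l ^ T)" .
  then have nz: "1 - l ^ T \<noteq> 0" using l(3) by auto
  have "torus_mode T l k - mode l k = (l ^ (T - k) + l ^ (k + T)) / (1 - l ^ T) * (1 / (l - 1 / l))"
  \<comment> \<open>If \<open>l - 1 / l\<close> is zero, division by zero makes both sides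
    0.\<close>
  proof (cases "l - 1 / l = 0")
    case False
    define D where "D = l - 1 / l"
    show ?thesis using False nz unfolding torus_mode_def mode_def D_def[symmetric]
      by (simp add: divide_simps power_add) (simp add: algebra_simps)
  qed (simp add: torus_mode_def mode_def)
  also have "cmod \<dots> \<le> (2 * \<rho> ^ (T - k)) / (1 - \<rho>) * C"
    unfolding norm_mult norm_divide
  proof (intro mult_mono frac_le)
    have "\<rho> ^ (k + T) \<le> \<rho> ^ (T - k)" using \<rho> l(3) by (intro power_decreasing) auto
    then show "cmod (l ^ (T - k) + l ^ (k + T)) \<le> 2 * \<rho> ^ (T - k)"
      using norm_triangle_ineq[of "l ^ (T - k)" "l ^ (k + T)"] lp[of "T - k"] lp[of "k + T"] by linarith
  qed (use l den \<rho> in \<open>auto simp: norm_divide\<close>)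
  finally show ?thesis .
qed

text \<open>Up to the wrap-around terms the torus Green function is a Riemann sum of the integrand
  of \<open>green\<close>. By compactness the roots have modulus at most some \<rho> < 1 for all
  momenta, so those terms vanish uniformly; this is where \<mu> > 0 is decisive.\<close>

lemma torus_green_tendsto:
  assumes \<mu>: "\<mu> > 0"
  shows "(\<lambda>T. torus_green \<kappa> \<mu> T n x) \<longlonglongrightarrow> green \<kappa> \<mu> n x"
proof -
  let ?l = "\<lambda>\<theta>. root_in (symbol \<kappa> \<mu> \<theta>)"
  let ?e = "\<lambda>\<theta>. cis (2 * pi * \<theta> * of_int x)"
  define k where "k = nat \<bar>n\<bar>"
  have cs: "continuous_on {0..1} (symbol \<kappa> \<mu>)"
    unfolding symbol_def by (intro continuous_intros)
  have dom: "symbol \<kappa> \<mu> \<theta> \<in> symbol_domain" for \<theta> using symbol_in_domain \<mu> by blast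
  have cl: "continuous_on {0..1} (\<lambda>\<theta>. cmod (?l \<theta>))"
    by (intro continuous_on_norm continuous_on_compose2[OF continuous_on_root_in cs]) (use dom in auto)
  obtain t where t: "t \<in> {0..1}" "\<And>\<theta>. \<theta> \<in> {0..1} \<Longrightarrow> cmod (?l \<theta>) \<le> cmod (?l t)"
    using continuous_attains_sup[OF _ _ cl] by auto
  define \<rho> where "\<rho> = cmod (?l t)"
  have \<rho>: "\<rho> < 1" "0 \<le> \<rho>" unfolding \<rho>_def using \<mu> by (auto intro!: norm_root_in simp: symbol_def)
  have cm: "continuous_on {0..1} (\<lambda>\<theta>. mode (?l \<theta>) i)" for i
    by (rule continuous_on_compose2[OF continuous_on_mode cs]) (use dom in auto)
  \<comment> \<open>\<open>mode l 0\<close> is \<open>1 / (l - 1 / l)\<close>, so its maximum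
    supplies the constant \<open>C\<close> of the wrap-around bound.\<close>
  obtain t' where t': "\<And>\<theta>. \<theta> \<in> {0..1} \<Longrightarrow> cmod (mode (?l \<theta>) 0) \<le> cmod (mode (?l t') 0)"
    using continuous_attains_sup[OF _ _ continuous_on_norm[OF cm[of 0]]] compact_Icc
    by (metis atLeastAtMost_iff empty_iff order_refl zero_le_one)
  define C where "C = cmod (mode (?l t') 0)"
  let ?R = "\<lambda>T. (\<Sum>j<T. ?e (real j / real T) * mode (?l (real j / real T)) k) / of_nat T"
  have "continuous_on {0..1} (\<lambda>\<theta>. ?e \<theta> * mode (?l \<theta>) k)"
    unfolding cis_conv_exp by (intro continuous_on_mult cm) (intro continuous_intros)
  then have R: "?R \<longlonglongrightarrow> green \<kappa> \<mu> n x"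
    unfolding green_def k_def by (rule riemann_sum_tendsto_integral)
  have "(\<lambda>T. torus_green \<kappa> \<mu> T n x - ?R T) \<longlonglongrightarrow> 0"
  proof (rule Lim_null_comparison)
    show "\<forall>\<^sub>F T in sequentially. norm (torus_green \<kappa> \<mu> T n x - ?R T) \<le> 2 * \<rho> ^ (T - k) / (1 - \<rho>) * C"
      using eventually_gt_at_top[of k]
    proof eventually_elim
      fix T assume T: "T > k"
      let ?b = "2 * \<rho> ^ (T - k) / (1 - \<rho>) * C"
      have "torus_green \<kappa> \<mu> T n x - ?R T = (\<Sum>j<T. ?e (real j / real T)
          * (torus_mode T (?l (real j / real T)) k - mode (?l (real j / real T)) k)) / of_nat T"
        using T mode_int_eq_torus_mode[of n T]
        by (simp add: torus_green_def k_def sum_subtractf right_diff_distrib diff_divide_distrib)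
      also have "norm \<dots> \<le> (\<Sum>j<T. ?b) / real T"
        unfolding norm_divide norm_of_nat
      proof (intro divide_right_mono sum_norm_le)
        fix j assume "j \<in> {..<T}"
        then have j: "real j / real T \<in> {0..1}" by auto
        show "norm (?e (real j / real T) * (torus_mode T (?l (real j / real T)) k - mode (?l (real j / real T)) k)) \<le> ?b"
          using torus_mode_diff_bound[OF root_in_nonzero _ \<rho>(1) _ T, of "symbol \<kappa> \<mu> (real j / real T)" C]
            t(2)[OF j] t'[OF j] by (simp add: norm_mult \<rho>_def C_def mode_def)
      qed simp
      also have "\<dots> = ?b" using T by simp
      finally show "norm (torus_green \<kappa> \<mu> T n x - ?R T) \<le> ?b" .
    qed
    have "(\<lambda>T. \<rho> ^ (T - k)) \<longlonglongrightarrow> 0"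
      by (rule LIMSEQ_offset[of _ k]) (use \<rho> in \<open>simp add: LIMSEQ_realpow_zero\<close>)
    then have "(\<lambda>T. 2 * \<rho> ^ (T - k) / (1 - \<rho>) * C) \<longlonglongrightarrow> 2 * 0 / (1 - \<rho>) * C"
      by (intro tendsto_intros) (use \<rho> in auto)
    then show "(\<lambda>T. 2 * \<rho> ^ (T - k) / (1 - \<rho>) * C) \<longlonglongrightarrow> 0" by simp
  qed
  from tendsto_add[OF this R] show ?thesis by simp
qed

text \<open>The torus equation passes to the limit pointwise: once T exceeds |n| + |x|, only the
  origin satisfies both divisibility conditions.\<close>

lemma green_equation:
  assumes \<mu>: "\<mu> > 0"
  shows "klein_gordon \<kappa> \<mu> (green \<kappa> \<mu>) n x = (if n = 0 \<and> x = 0 then 1 else 0)"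
proof -
  have "(\<lambda>T. klein_gordon \<kappa> \<mu> (torus_green \<kappa> \<mu> T) n x) \<longlonglongrightarrow> klein_gordon \<kappa> \<mu> (green \<kappa> \<mu>) n x"
    unfolding klein_gordon_def by (intro tendsto_intros torus_green_tendsto \<mu>)
  moreover have "(\<lambda>T. klein_gordon \<kappa> \<mu> (torus_green \<kappa> \<mu> T) n x) \<longlonglongrightarrow> (if n = 0 \<and> x = 0 then 1 else 0)"
  proof (rule tendsto_eventually)
    show "\<forall>\<^sub>F T in sequentially. klein_gordon \<kappa> \<mu> (torus_green \<kappa> \<mu> T) n x = (if n = 0 \<and> x = 0 then 1 else 0)"
      using eventually_gt_at_top[of "nat (\<bar>n\<bar> + \<bar>x\<bar>)"]
    proof eventually_elim
      fix T assume T: "T > nat (\<bar>n\<bar> + \<bar>x\<bar>)"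
      have "int T dvd y \<longleftrightarrow> y = 0" if "\<bar>y\<bar> < int T" for y
        using that dvd_imp_le_int[of y "int T"] by auto
      then show "klein_gordon \<kappa> \<mu> (torus_green \<kappa> \<mu> T) n x = (if n = 0 \<and> x = 0 then 1 else 0)"
        using T \<mu> by (subst torus_green_equation) auto
    qed
  qed
  ultimately show ?thesis by (rule LIMSEQ_unique)
qed

text \<open>The energy estimate closes on itself. With unit source, \<mu> N \<le> |g(0,0)| for the
  square norm N on the torus, and |g(0,0)|^2 \<le> N, so N \<le> 1/\<mu>^2 whatever T is. Finite
  partial sums inherit the bound in the limit.\<close>

lemma green_square_summable:
  assumes \<mu>: "\<mu> > 0"
  shows "(\<lambda>(n, x). (cmod (green \<kappa> \<mu> n x))\<^sup>2) summable_on UNIV"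
proof (rule nonneg_bdd_above_summable_on)
  let ?g = "torus_green \<kappa> \<mu>"
  have torus: "(\<Sum>(n, x)\<in>{0..<int T} \<times> {0..<int T}. (cmod (?g T n x))\<^sup>2) \<le> 1 / \<mu>\<^sup>2" if T: "T > 0" for T
  proof -
    let ?N = "\<Sum>(n, x)\<in>{0..<int T} \<times> {0..<int T}. (cmod (?g T n x))\<^sup>2"
    have "klein_gordon \<kappa> \<mu> (?g T) n x = 0" if "n mod int T \<noteq> 0 \<or> x mod int T \<noteq> 0" for n x
      using that \<mu> T by (auto simp: torus_green_equation dvd_eq_mod_eq_0)
    then have le: "\<mu> * ?N \<le> cmod (?g T 0 0) * cmod (klein_gordon \<kappa> \<mu> (?g T) 0 0)"
      using T torus_green_periodic[OF T] by (intro klein_gordon_torus_bound) auto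
    then have "\<mu> * ?N \<le> cmod (?g T 0 0)" using \<mu> T by (simp add: torus_green_equation)
    moreover have "(cmod (?g T 0 0))\<^sup>2 \<le> ?N"
      using member_le_sum[of "(0, 0)" "{0..<int T} \<times> {0..<int T}" "\<lambda>(n, x). (cmod (?g T n x))\<^sup>2"] T by auto
    moreover have N0: "?N \<ge> 0" by (intro sum_nonneg) auto
    ultimately have "(\<mu> * ?N)\<^sup>2 \<le> ?N" using \<mu>
      by (meson order_trans power_mono mult_nonneg_nonneg less_imp_le)
    then have "\<mu>\<^sup>2 * ?N * ?N \<le> 1 * ?N" by (simp add: power2_eq_square mult_ac)
    then have "\<mu>\<^sup>2 * ?N \<le> 1" using N0 by (cases "?N = 0") (auto simp: mult_le_cancel_right)
    then show ?thesis using \<mu> by (simp add: field_simps)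
  qed
  show "bdd_above (sum (\<lambda>(n, x). (cmod (green \<kappa> \<mu> n x))\<^sup>2) ` {F. F \<subseteq> UNIV \<and> finite F})"
  proof (rule bdd_aboveI[of _ "1 / \<mu>\<^sup>2"], clarify)
    fix F :: "(int \<times> int) set" assume F: "finite F"
    have "(\<lambda>T. \<Sum>(n, x)\<in>F. (cmod (?g T n x))\<^sup>2) \<longlonglongrightarrow> (\<Sum>(n, x)\<in>F. (cmod (green \<kappa> \<mu> n x))\<^sup>2)"
      unfolding case_prod_unfold by (intro tendsto_intros torus_green_tendsto \<mu>)
    moreover obtain B where B: "\<And>z. z \<in> F \<Longrightarrow> \<bar>fst z\<bar> \<le> B \<and> \<bar>snd z\<bar> \<le> B"
    proof -
      have "\<bar>fst z\<bar> \<le> (\<Sum>z\<in>F. \<bar>fst z\<bar> + \<bar>snd z\<bar>) \<and> \<bar>snd z\<bar> \<le> (\<Sum>z\<in>F. \<bar>fst z\<bar> + \<bar>snd z\<bar>)" if "z \<in> F" for z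
        using member_le_sum[OF that, of "\<lambda>z. \<bar>fst z\<bar> + \<bar>snd z\<bar>"] F by auto
      then show ?thesis using that by blast
    qed
    have "\<forall>\<^sub>F T in sequentially. (\<Sum>(n, x)\<in>F. (cmod (?g T n x))\<^sup>2) \<le> 1 / \<mu>\<^sup>2"
      \<comment> \<open>Two coordinates of modulus at most \<open>B\<close> differ by at most
        \<open>2 * B\<close>, so for larger T reduction modulo T is injective on \<open>F\<close>
        and the partial sum fits into one period.\<close>
      using eventually_gt_at_top[of "nat (2 * \<bar>B\<bar>)"]
    proof eventually_elim
      fix T assume T: "T > nat (2 * \<bar>B\<bar>)"
      let ?r = "\<lambda>(n, x). (n mod int T, x mod int T)"
      have eq: "a = b" if "a mod int T = b mod int T" "\<bar>a\<bar> \<le> B" "\<bar>b\<bar> \<le> B" for a b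
      proof -
        have "int T dvd a - b" using that(1) by (simp add: mod_eq_dvd_iff)
        then show ?thesis using dvd_imp_le_int[of "a - b" "int T"] that T by fastforce
      qed
      have inj: "inj_on ?r F"
        by (rule inj_onI) (use B eq in \<open>fastforce simp: prod_eq_iff\<close>)
      have "(\<Sum>(n, x)\<in>F. (cmod (?g T n x))\<^sup>2) = (\<Sum>(n, x)\<in>?r ` F. (cmod (?g T n x))\<^sup>2)"
        using torus_green_periodic[of T \<kappa> \<mu>] T
        by (subst sum.reindex[OF inj]) (auto simp: case_prod_unfold periodic2_def intro!: sum.cong)
      also have "\<dots> \<le> (\<Sum>(n, x)\<in>{0..<int T} \<times> {0..<int T}. (cmod (?g T n x))\<^sup>2)"
        using T by (intro sum_mono2) auto
      also have "\<dots> \<le> 1 / \<mu>\<^sup>2" using T by (intro torus) auto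
      finally show "(\<Sum>(n, x)\<in>F. (cmod (?g T n x))\<^sup>2) \<le> 1 / \<mu>\<^sup>2" .
    qed
    ultimately show "(\<Sum>(n, x)\<in>F. (cmod (green \<kappa> \<mu> n x))\<^sup>2) \<le> 1 / \<mu>\<^sup>2"
      by (rule tendsto_upperbound) simp
  qed
qed auto

section \<open>Solving the edge equations\<close>

definition turn_weight :: "real \<Rightarrow> real \<Rightarrow> int \<Rightarrow> bool \<Rightarrow> bool \<Rightarrow> complex" where
  "turn_weight a \<delta> i d d' =
     (if odd i then (if d \<noteq> d' then - \<i> * complex_of_real a else 1) / complex_of_real (sqrt (1 + a\<^sup>2))
      else (if d \<noteq> d' then - complex_of_real \<delta> else 1) / complex_of_real (sqrt (1 - \<delta>\<^sup>2)))"

definition torus_edge :: "nat \<Rightarrow> bool \<Rightarrow> int \<Rightarrow> int \<Rightarrow> edge" where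
  "torus_edge T d i j = ((i mod (2 * int T), j mod (2 * int T)), d)"

lemma even_mod_double [simp]: "even (x mod (2 * int T)) \<longleftrightarrow> even x"
  by (metis dvd_mod_iff dvd_triv_left)

lemma is_edge_torus_edge: "T > 0 \<Longrightarrow> even (i + j) \<Longrightarrow> is_edge T (torus_edge T d i j)"
  by (simp add: is_edge_def lat_pt_def torus_edge_def)

lemma torus_edge_is_edge: "is_edge T e \<Longrightarrow> torus_edge T (snd e) (fst (fst e)) (snd (fst e)) = e"
  by (cases e) (auto simp: is_edge_def lat_pt_def torus_edge_def)

lemma sum_transfer:
  assumes T: "T > 0" and ev: "even (i + j)"
  shows "(\<Sum>e\<in>edges T. y e * transfer T m \<epsilon> \<delta> e (torus_edge T d i j))
    = y (torus_edge T d i j)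
      - (y (torus_edge T False (i + 1) (j - 1)) * turn_weight (m * \<epsilon>) \<delta> i False d
       + y (torus_edge T True (i - 1) (j - 1)) * turn_weight (m * \<epsilon>) \<delta> i True d)"
proof -
  let ?f = "torus_edge T d i j"
  have f: "is_edge T ?f" by (rule is_edge_torus_edge[OF T ev])
  have pL: "pred_L T (fst ?f) = torus_edge T False (i + 1) (j - 1)"
    by (simp add: pred_L_def torus_edge_def mod_add_left_eq mod_diff_left_eq)
  have pR: "pred_R T (fst ?f) = torus_edge T True (i - 1) (j - 1)"
    by (simp add: pred_R_def torus_edge_def mod_diff_left_eq)
  \<comment> \<open>A predecessor starts at a point of the opposite parity and ends at one of the
    parity of \<open>i\<close>, and the latter is what decides between odd and even node.\<close>
  have w: "node_weight T m \<epsilon> \<delta> (torus_edge T b i' j') ?f = turn_weight (m * \<epsilon>) \<delta> i b d"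
    if "odd i' \<longleftrightarrow> even i" for b i' j'
    using that by (cases "even i") (simp_all add: node_weight_def turn_weight_def torus_edge_def e_end_def power_mult_distrib)
  have "(\<Sum>e\<in>edges T. y e * transfer T m \<epsilon> \<delta> e ?f)
    = (\<Sum>e\<in>edges T. (if e = ?f then y e else 0)) - (\<Sum>e\<in>edges T. y e * hop T (node_weight T m \<epsilon> \<delta>) e ?f)"
    unfolding sum_subtractf[symmetric] by (intro sum.cong) (auto simp: transfer_def algebra_simps)
  also have "(\<Sum>e\<in>edges T. (if e = ?f then y e else 0)) = y ?f"
    using f finite_edges[of T] by simp
  finally show ?thesis
    unfolding sum_hop[OF T f] pL pR by (simp add: w)
qed

text \<open>\<open>a\<close> stands for m \<epsilon>. Below, \<open>c\<close> normalises the odd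
  nodes and \<open>h\<close> the even ones; \<kappa> is their product over one double step, and
  \<mu> comes from the paths that turn at both nodes of a double step.\<close>

locale weights =
  fixes a \<delta> :: real
  assumes a: "a > 0" and \<delta>: "0 < \<delta>" "\<delta> < 1"
begin

definition "c = complex_of_real (1 / sqrt (1 + a\<^sup>2))"
definition "h = complex_of_real (1 / sqrt (1 - \<delta>\<^sup>2))"
definition "\<kappa> = 1 / (sqrt (1 + a\<^sup>2) * sqrt (1 - \<delta>\<^sup>2))"
definition "\<mu> = 2 * a * \<delta> * \<kappa>"

lemma delta_sq: "\<delta>\<^sup>2 < 1"
  using \<delta> by (simp add: abs_square_less_1)

lemma ch: "c * h = of_real \<kappa>"
  by (simp add: c_def h_def \<kappa>_def)

text \<open>This is the unit determinant of the double step: before normalisation the odd node has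
  determinant 1 + a^2 and the even node 1 - \<delta>^2.\<close>

lemma \<kappa>_sq: "(of_real \<kappa>)\<^sup>2 * ((1 + (of_real a)\<^sup>2) * (1 - (of_real \<delta>)\<^sup>2)) = (1 :: complex)"
proof -
  have "1 + a\<^sup>2 > 0" by (simp add: add_pos_nonneg)
  then have "\<kappa>\<^sup>2 * ((1 + a\<^sup>2) * (1 - \<delta>\<^sup>2)) = 1"
    using delta_sq by (simp add: \<kappa>_def power_divide power_mult_distrib)
  then have "complex_of_real (\<kappa>\<^sup>2 * ((1 + a\<^sup>2) * (1 - \<delta>\<^sup>2))) = 1" by simp
  then show ?thesis by simp
qed

lemma \<mu>_pos: "\<mu> > 0"
proof -
  have "1 + a\<^sup>2 > 0" by (simp add: add_pos_nonneg)
  then show ?thesis using a \<delta> delta_sq by (simp add: \<mu>_def \<kappa>_def)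
qed

lemma turn_weight_simps:
  "odd i \<Longrightarrow> turn_weight a \<delta> i d d' = (if d = d' then c else - \<i> * of_real a * c)"
  "even i \<Longrightarrow> turn_weight a \<delta> i d d' = (if d = d' then h else - of_real \<delta> * h)"
  by (auto simp: turn_weight_def c_def h_def)

text \<open>Two time steps of the propagator equations compose to a 2x2 matrix of unit determinant
  and trace \<open>\<kappa> (X + 1/X) + \<i> \<mu>\<close>, \<open>X\<close> the unit space shift; by Cayley-Hamilton each component
  of a homogeneous solution satisfies the scalar equation.\<close>
lemma klein_gordon_of_system:
  fixes A1 A2 :: "int \<Rightarrow> int \<Rightarrow> complex"
  assumes e1: "\<And>n x. A1 n x = of_real \<kappa> * (A1 (n - 1) (x + 1) - \<i> * of_real \<delta> * A2 (n - 1) (x + 1)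
      + of_real a * (A2 (n - 1) x + \<i> * of_real \<delta> * A1 (n - 1) x))"
    and e2: "\<And>n x. A2 n x = of_real \<kappa> * (A2 (n - 1) (x - 1) + \<i> * of_real \<delta> * A1 (n - 1) (x - 1)
      - of_real a * (A1 (n - 1) x - \<i> * of_real \<delta> * A2 (n - 1) x))"
  shows "klein_gordon \<kappa> \<mu> A1 n x = 0" "klein_gordon \<kappa> \<mu> A2 n x = 0"
proof -
  let ?k = "complex_of_real \<kappa>" and ?a = "complex_of_real a" and ?d = "complex_of_real \<delta>"
  have M: "complex_of_real \<mu> = 2 * ?a * ?d * ?k" by (simp add: \<mu>_def)
  have n1: "n + 1 - 1 = n" by simp
  \<comment> \<open>Only the value at time \<open>n + 1\<close> is expanded here. Expanding time
    \<open>n\<close> next leaves the value at time \<open>n - 1\<close> times one minus the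
    determinant.\<close>
  have "klein_gordon \<kappa> \<mu> A1 n x = A1 (n - 1) x - ?k * (?a * ?d * \<i> * A1 n x + A1 n (x - 1)
      + \<i> * ?d * A2 n (x + 1) - ?a * A2 n x)"
    unfolding klein_gordon_def M using e1[of "n + 1" x] by (simp add: algebra_simps)
  also have "\<dots> = A1 (n - 1) x * (1 - ?k\<^sup>2 * ((1 + ?a\<^sup>2) * (1 - ?d\<^sup>2)))"
    unfolding e1[of n x] e1[of n "x - 1"] e2[of n "x + 1"] e2[of n x]
    by (simp add: algebra_simps power2_eq_square)
  finally show "klein_gordon \<kappa> \<mu> A1 n x = 0" by (simp only: \<kappa>_sq) simp
  have "klein_gordon \<kappa> \<mu> A2 n x = A2 (n - 1) x - ?k * (?a * ?d * \<i> * A2 n x + A2 n (x + 1)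
      - \<i> * ?d * A1 n (x - 1) + ?a * A1 n x)"
    unfolding klein_gordon_def M using e2[of "n + 1" x] by (simp add: algebra_simps)
  also have "\<dots> = A2 (n - 1) x * (1 - ?k\<^sup>2 * ((1 + ?a\<^sup>2) * (1 - ?d\<^sup>2)))"
    unfolding e2[of n x] e2[of n "x + 1"] e1[of n "x - 1"] e1[of n x]
    by (simp add: algebra_simps power2_eq_square)
  finally show "klein_gordon \<kappa> \<mu> A2 n x = 0" by (simp only: \<kappa>_sq) simp
qed

text \<open>A left kernel vector is a periodic solution of the evolution without source. On the
  edges entering even points it satisfies the homogeneous axiomatic system, so the energy bound
  annihilates it there, and the even nodes then annihilate it on the edges leaving even
  points.\<close>

lemma denom_nonzero:
  assumes T: "T > 0" and me: "m * \<epsilon> = a"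
  shows "denom T m \<epsilon> \<delta> \<noteq> 0"
  unfolding denom_eq_perm_det[OF T delta_sq]
proof (rule perm_det_nonzero[OF finite_edges])
  fix y f
  assume ker: "\<And>j. j \<in> edges T \<Longrightarrow> (\<Sum>i\<in>edges T. y i * transfer T m \<epsilon> \<delta> i j) = 0"
    and f: "f \<in> edges T"
  define Y where "Y = (\<lambda>d i j. y (torus_edge T d i j))"
  have node: "Y d i j = Y False (i + 1) (j - 1) * turn_weight a \<delta> i False d
       + Y True (i - 1) (j - 1) * turn_weight a \<delta> i True d" if "even (i + j)" for d i j
    using ker[of "torus_edge T d i j"] is_edge_torus_edge[OF T that] sum_transfer[OF T that]
    by (simp add: Y_def me)
  \<comment> \<open>The left-moving edge from \<open>(2 * x + 1, 2 * n - 1)\<close> ends at the even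
    point \<open>(2 * x, 2 * n)\<close>, and so does the right-moving edge used for
    \<open>A2\<close>. The factor \<open>\<i>\<close> brings the coefficients into the form of the
    axioms.\<close>
  define A1 where "A1 = (\<lambda>n x. \<i> * Y False (2 * x + 1) (2 * n - 1))"
  define A2 where "A2 = (\<lambda>n x. Y True (2 * x - 1) (2 * n - 1))"
  let ?k = "complex_of_real \<kappa>" and ?a = "complex_of_real a" and ?d = "complex_of_real \<delta>"
  have evL: "Y False (2 * x) (2 * n) = h * (- \<i> * A1 n x - ?d * A2 n x)" for n x
    using node[of "2 * x" "2 * n" False] by (simp add: turn_weight_simps A1_def A2_def algebra_simps)
  have evR: "Y True (2 * x) (2 * n) = h * (A2 n x + \<i> * ?d * A1 n x)" for n x
    using node[of "2 * x" "2 * n" True] by (simp add: turn_weight_simps A1_def A2_def algebra_simps)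
  have e1: "A1 n x = ?k * (A1 (n - 1) (x + 1) - \<i> * ?d * A2 (n - 1) (x + 1)
      + ?a * (A2 (n - 1) x + \<i> * ?d * A1 (n - 1) x))" for n x
  proof -
    have "A1 n x = \<i> * c * (Y False (2 * (x + 1)) (2 * (n - 1)) - \<i> * ?a * Y True (2 * x) (2 * (n - 1)))"
      using arg_cong[OF node[of "2 * x + 1" "2 * n - 1" False], of "\<lambda>z. \<i> * z"]
      by (simp add: turn_weight_simps A1_def algebra_simps)
    then show ?thesis unfolding evL evR by (simp add: ch[symmetric] algebra_simps)
  qed
  have e2: "A2 n x = ?k * (A2 (n - 1) (x - 1) + \<i> * ?d * A1 (n - 1) (x - 1)
      - ?a * (A1 (n - 1) x - \<i> * ?d * A2 (n - 1) x))" for n x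
  proof -
    have "A2 n x = c * (Y True (2 * (x - 1)) (2 * (n - 1)) - \<i> * ?a * Y False (2 * x) (2 * (n - 1)))"
      using node[of "2 * x - 1" "2 * n - 1" True] by (simp add: turn_weight_simps A2_def algebra_simps)
    then show ?thesis unfolding evL evR by (simp add: ch[symmetric] algebra_simps)
  qed
  \<comment> \<open>Edge coordinates are doubled and read modulo \<open>2 * int T\<close>, so the
    halved indices have period T.\<close>
  have shift: "torus_edge T d (2 * (x mod int T) + b) (2 * (n mod int T) - 1) = torus_edge T d (2 * x + b) (2 * n - 1)"
    for d x b n
  proof -
    have "(2 * (z mod int T) + r) mod (2 * int T) = (2 * z + r) mod (2 * int T)" for z r
      by (simp only: mult_mod_right mod_add_left_eq)
    from this[of x b] this[of n "-1"] show ?thesis by (simp add: torus_edge_def)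
  qed
  have zero: "u n x = 0" if per: "periodic2 (int T) u" and kg: "\<And>n x. klein_gordon \<kappa> \<mu> u n x = 0" for u n x
  proof -
    let ?S = "{0..<int T} \<times> {0..<int T}"
    have "\<mu> * (\<Sum>(n, x)\<in>?S. (cmod (u n x))\<^sup>2) \<le> cmod (u 0 0) * cmod (klein_gordon \<kappa> \<mu> u 0 0)"
      using T per kg by (intro klein_gordon_torus_bound) auto
    then have "(\<Sum>(n, x)\<in>?S. (cmod (u n x))\<^sup>2) \<le> 0" using \<mu>_pos by (simp add: kg mult_le_0_iff)
    moreover have "(cmod (u (n mod int T) (x mod int T)))\<^sup>2 \<le> (\<Sum>(n, x)\<in>?S. (cmod (u n x))\<^sup>2)"
    proof -
      have "(n mod int T, x mod int T) \<in> ?S" using T by simp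
      then show ?thesis
        using member_le_sum[of "(n mod int T, x mod int T)" ?S "\<lambda>(n, x). (cmod (u n x))\<^sup>2"]
        by (simp add: case_prod_unfold)
    qed
    ultimately have "(cmod (u (n mod int T) (x mod int T)))\<^sup>2 \<le> 0" by linarith
    then show "u n x = 0" using per by (simp add: periodic2_def)
  qed
  have p1: "periodic2 (int T) A1" using shift[of False _ 1] by (simp add: periodic2_def A1_def Y_def)
  have p2: "periodic2 (int T) A2" using shift[of True _ "-1"] by (simp add: periodic2_def A2_def Y_def)
  have A0: "A1 n x = 0" "A2 n x = 0" for n x
    by (rule zero[OF p1 klein_gordon_of_system(1)[of A1 A2, OF e1 e2]],
        rule zero[OF p2 klein_gordon_of_system(2)[of A1 A2, OF e1 e2]])
  define d i j where "d = snd f" and "i = fst (fst f)" and "j = snd (fst f)"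
  have fe: "f = torus_edge T d i j" and ev: "even (i + j)"
    using f torus_edge_is_edge[of T f] by (simp_all add: d_def i_def j_def is_edge_def lat_pt_def)
  show "y f = 0"
  proof (cases "even i")
    case True
    then obtain x n where "i = 2 * x" "j = 2 * n" using ev by (auto elim!: evenE)
    then show ?thesis using evL[of x n] evR[of x n] A0 by (cases d) (simp_all add: fe Y_def)
  next
    case False
    then have "odd j" using ev by simp
    then obtain n' where "j = 2 * n' + 1" by (rule oddE)
    then have j: "j = 2 * (n' + 1) - 1" by simp
    from False obtain x where "i = 2 * x + 1" by (rule oddE)
    then show ?thesis using A0(1)[of "n' + 1" x] A0(2)[of "n' + 1" "x + 1"]
      unfolding fe j by (cases d) (simp_all add: A1_def A2_def Y_def algebra_simps)
  qed
qed

text \<open>Amplitudes on the edges leaving the even points, in terms of a solution of the scalar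
  equation: a column of the adjugate of the time shift minus the two-step matrix.\<close>
definition amp_L :: "(int \<Rightarrow> int \<Rightarrow> complex) \<Rightarrow> int \<Rightarrow> int \<Rightarrow> complex" where
  "amp_L g n x = of_real \<kappa> * (- \<i> * of_real a * g n x - of_real \<delta> * g n (x - 1))"

definition amp_R :: "(int \<Rightarrow> int \<Rightarrow> complex) \<Rightarrow> int \<Rightarrow> int \<Rightarrow> complex" where
  "amp_R g n x = g (n + 1) x - of_real \<kappa> * (g n (x + 1) + \<i> * of_real a * of_real \<delta> * g n x)"

text \<open>A matrix times its adjugate is diagonal. So the equation for left-moving edges is an
  identity in \<open>g\<close>, while the one for right-moving edges holds up to the scalar operator
  applied to \<open>g\<close>; a scalar point source thus becomes a source on the right-moving edge
  alone, as for \<open>a0\<close>.\<close>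

lemma amp_equations:
  "amp_L g n x = of_real \<kappa> * (amp_L g (n - 1) (x + 1) - \<i> * of_real a * amp_R g (n - 1) x
      - of_real \<delta> * (amp_R g (n - 1) (x - 1) - \<i> * of_real a * amp_L g (n - 1) x))"
  "amp_R g n x = of_real \<kappa> * (amp_R g (n - 1) (x - 1) - \<i> * of_real a * amp_L g (n - 1) x
      - of_real \<delta> * (amp_L g (n - 1) (x + 1) - \<i> * of_real a * amp_R g (n - 1) x))
      + klein_gordon \<kappa> \<mu> g n x"
proof -
  let ?k = "complex_of_real \<kappa>" and ?a = "complex_of_real a" and ?d = "complex_of_real \<delta>"
  have M: "complex_of_real \<mu> = 2 * ?a * ?d * ?k" by (simp add: \<mu>_def)
  show "amp_L g n x = ?k * (amp_L g (n - 1) (x + 1) - \<i> * ?a * amp_R g (n - 1) x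
      - ?d * (amp_R g (n - 1) (x - 1) - \<i> * ?a * amp_L g (n - 1) x))"
    unfolding amp_L_def amp_R_def by (simp add: algebra_simps)
  have "?k * (amp_R g (n - 1) (x - 1) - \<i> * ?a * amp_L g (n - 1) x
      - ?d * (amp_L g (n - 1) (x + 1) - \<i> * ?a * amp_R g (n - 1) x)) + klein_gordon \<kappa> \<mu> g n x
    = amp_R g n x + g (n - 1) x * (1 - ?k\<^sup>2 * ((1 + ?a\<^sup>2) * (1 - ?d\<^sup>2)))"
    unfolding amp_L_def amp_R_def klein_gordon_def M by (simp add: algebra_simps power2_eq_square)
  then show "amp_R g n x = ?k * (amp_R g (n - 1) (x - 1) - \<i> * ?a * amp_L g (n - 1) x
      - ?d * (amp_L g (n - 1) (x + 1) - \<i> * ?a * amp_R g (n - 1) x)) + klein_gordon \<kappa> \<mu> g n x"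
    by (simp only: \<kappa>_sq) simp
qed

text \<open>Extends the amplitudes to edges leaving odd points by passing through one odd node. The
  odd point \<open>(2 * x + 1, 2 * n + 1)\<close> is reached from the even points with indices
  \<open>x\<close>, moving right, and \<open>x + 1\<close>, moving left, both at time index
  \<open>n\<close>.\<close>

definition edge_amp :: "(int \<Rightarrow> int \<Rightarrow> complex) \<Rightarrow> bool \<Rightarrow> int \<Rightarrow> int \<Rightarrow> complex" where
  "edge_amp g d i j = (let x = i div 2; n = j div 2 in
     if even i then (if d then amp_R g n x else amp_L g n x)
     else if d then c * (amp_R g n x - \<i> * of_real a * amp_L g n (x + 1))
     else c * (amp_L g n (x + 1) - \<i> * of_real a * amp_R g n x))"

text \<open>\<open>edge_amp\<close> of the torus Green function solves the linear system with unit
  source at \<open>a0\<close>. Cramer's rule identifies it with numerator over denominator, and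
  \<open>denom_nonzero\<close> permits the division.\<close>

lemma propagator_eq_amp:
  assumes T: "T > 0" and me: "m * \<epsilon> = a"
  shows "propagator a0 (torus_edge T d (2 * p) (2 * q)) m \<epsilon> \<delta> T
    = (if d then amp_R (torus_green \<kappa> \<mu> T) q p else amp_L (torus_green \<kappa> \<mu> T) q p)"
proof -
  let ?g = "torus_green \<kappa> \<mu> T"
  have g: "?g (n mod int T) (x mod int T) = ?g n x" for n x
    using torus_green_periodic[OF T] by (simp add: periodic2_def)
  \<comment> \<open>Amplitudes also use neighbouring indices, which may leave the fundamental
    domain; periodicity has to be available after the shift.\<close>
  have g': "?g (n mod int T + r) (x mod int T + s) = ?g (n + r) (x + s)" for n x r s
    by (subst (1 2) g[symmetric]) (simp add: mod_add_left_eq)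
  have g'': "amp_L ?g (n mod int T) (x mod int T) = amp_L ?g n x"
    "amp_R ?g (n mod int T) (x mod int T) = amp_R ?g n x"
    "amp_L ?g (n mod int T) (x mod int T + 1) = amp_L ?g n (x + 1)" for n x
    using g'[of n 0 x 0] g'[of n 0 x "-1"] g'[of n 1 x 0] g'[of n 0 x 1]
    by (simp_all add: amp_L_def amp_R_def)
  define y where "y = (\<lambda>e :: edge. edge_amp ?g (snd e) (fst (fst e)) (snd (fst e)))"
  have div: "(i mod (2 * int T)) div 2 = (i div 2) mod int T" for i
    by (simp add: zmod_zmult2_eq)
  have y: "y (torus_edge T d i j) = edge_amp ?g d i j" for d i j
    by (simp add: y_def torus_edge_def edge_amp_def div g'' Let_def)
  have sys: "(\<Sum>e\<in>edges T. y e * transfer T m \<epsilon> \<delta> e f) = (if f = a0 then 1 else 0)"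
    if f: "f \<in> edges T" for f
  proof -
    define d i j where "d = snd f" and "i = fst (fst f)" and "j = snd (fst f)"
    have fe: "f = torus_edge T d i j" and ev: "even (i + j)"
      and b: "0 \<le> i" "i < 2 * int T" "0 \<le> j" "j < 2 * int T"
      using f torus_edge_is_edge[of T f] by (simp_all add: d_def i_def j_def is_edge_def lat_pt_def)
    have fa: "f = a0 \<longleftrightarrow> d \<and> i = 0 \<and> j = 0"
      using b by (auto simp: fe a0_def torus_edge_def)
    have *: "(\<Sum>e\<in>edges T. y e * transfer T m \<epsilon> \<delta> e f) = edge_amp ?g d i j
      - (edge_amp ?g False (i + 1) (j - 1) * turn_weight a \<delta> i False d
       + edge_amp ?g True (i - 1) (j - 1) * turn_weight a \<delta> i True d)"
      unfolding fe sum_transfer[OF T ev] y me ..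
    show ?thesis
    proof (cases "even i")
      case True
      then obtain x n where xn: "i = 2 * x" "j = 2 * n" using ev by (auto elim!: evenE)
      have d2: "(2 * x + 1) div 2 = x" "(2 * n - 1) div 2 = n - 1" "(2 * x - 1) div 2 = x - 1" by presburger+
      have kg: "klein_gordon \<kappa> \<mu> ?g n x = (if x = 0 \<and> n = 0 then 1 else 0)"
      proof -
        have "int T dvd z \<longleftrightarrow> z = 0" if "0 \<le> z" "z < int T" for z
          using that zdvd_imp_le[of "int T" z] by (cases "z = 0") auto
        then show ?thesis using b xn by (subst torus_green_equation[OF \<mu>_pos T]) auto
      qed
      have "(\<Sum>e\<in>edges T. y e * transfer T m \<epsilon> \<delta> e f) = (if d then klein_gordon \<kappa> \<mu> ?g n x else 0)"
      proof (cases d)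
        case True
        then show ?thesis unfolding * xn edge_amp_def Let_def d2 using amp_equations(2)[of ?g n x]
          by (simp add: turn_weight_simps ch[symmetric] algebra_simps)
      next
        case False
        then show ?thesis unfolding * xn edge_amp_def Let_def d2 using amp_equations(1)[of ?g n x]
          by (simp add: turn_weight_simps ch[symmetric] algebra_simps)
      qed
      then show ?thesis unfolding kg fa xn by auto
    next
      case False
      then have "odd j" using ev by simp
      with False obtain x n where xn: "i = 2 * x + 1" "j = 2 * n + 1" by (auto elim!: oddE)
      have d2: "(2 * x + 1) div 2 = x" "(2 * n + 1) div 2 = n" "(2 * x + 1 + 1) div 2 = x + 1"
        "(2 * x + 1 - 1) div 2 = x" "(2 * n + 1 - 1) div 2 = n" by presburger+
      have "i \<noteq> 0" "odd i" using False by auto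
      \<comment> \<open>At odd points the equation is the definition of \<open>edge_amp\<close>; all
        content sits at the even points.\<close>
      then have "(\<Sum>e\<in>edges T. y e * transfer T m \<epsilon> \<delta> e f) = 0"
        unfolding * edge_amp_def Let_def xn d2
        by (cases d) (simp_all add: turn_weight_simps algebra_simps)
      then show ?thesis using \<open>i \<noteq> 0\<close> by (simp add: fa)
    qed
  qed
  have ae: "is_edge T a0" using T by (simp add: a0_def is_edge_def lat_pt_def)
  have fe: "is_edge T (torus_edge T d (2 * p) (2 * q))" by (rule is_edge_torus_edge[OF T]) simp
  have "numer T m \<epsilon> \<delta> a0 (torus_edge T d (2 * p) (2 * q))
    = y (torus_edge T d (2 * p) (2 * q)) * denom T m \<epsilon> \<delta>"
    unfolding denom_eq_perm_det[OF T delta_sq] numer_eq_perm_minor[OF T delta_sq ae fe]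
    by (rule perm_minor_cramer) (use ae fe finite_edges sys in auto)
  then show ?thesis
    using denom_nonzero[OF T me] by (simp add: propagator_def y edge_amp_def)
qed

end

section \<open>The axiomatic propagator\<close>

definition square_summable :: "(int \<Rightarrow> int \<Rightarrow> complex) \<Rightarrow> bool" where
  "square_summable u \<longleftrightarrow> (\<lambda>(n, x). (cmod (u n x))\<^sup>2) summable_on UNIV"

lemma square_summable_shift:
  assumes "square_summable u"
  shows "square_summable (\<lambda>n x. u (n + r) (x + s))"
proof -
  have "bij_betw (\<lambda>(n, x). (n + r, x + s)) UNIV UNIV"
    by (rule bij_betw_byWitness[where f' = "\<lambda>(n, x). (n - r, x - s)"]) auto
  from summable_on_reindex_bij_betw[OF this, of "\<lambda>(n, x). (cmod (u n x))\<^sup>2"] assms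
  show ?thesis by (simp add: square_summable_def case_prod_unfold)
qed

lemma square_summable_scale:
  assumes "square_summable u"
  shows "square_summable (\<lambda>n x. b * u n x)"
  using summable_on_cmult_right[of "\<lambda>(n, x). (cmod (u n x))\<^sup>2" UNIV "(cmod b)\<^sup>2"] assms
  by (simp add: square_summable_def case_prod_unfold norm_mult power_mult_distrib)

lemma square_summable_add:
  assumes "square_summable u" "square_summable v"
  shows "square_summable (\<lambda>n x. u n x + v n x)"
  unfolding square_summable_def
proof (rule summable_on_comparison_test)
  have "(\<lambda>(n, x). (cmod (u n x))\<^sup>2 + (cmod (v n x))\<^sup>2) summable_on UNIV"
    using summable_on_add assms by (simp add: square_summable_def case_prod_unfold)
  from summable_on_cmult_right[OF this, of 2]
  show "(\<lambda>z. 2 * (case z of (n, x) \<Rightarrow> (cmod (u n x))\<^sup>2 + (cmod (v n x))\<^sup>2)) summable_on UNIV" .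
  fix z :: "int \<times> int"
  obtain n x where z: "z = (n, x)" by (cases z)
  have "(cmod (u n x + v n x))\<^sup>2 \<le> (cmod (u n x) + cmod (v n x))\<^sup>2"
    by (intro power_mono norm_triangle_ineq) simp
  also have "\<dots> \<le> 2 * ((cmod (u n x))\<^sup>2 + (cmod (v n x))\<^sup>2)"
    using sum_squares_bound[of "cmod (u n x)" "cmod (v n x)"] by (simp add: power2_sum)
  finally show "(case z of (n, x) \<Rightarrow> (cmod (u n x + v n x))\<^sup>2)
      \<le> 2 * (case z of (n, x) \<Rightarrow> (cmod (u n x))\<^sup>2 + (cmod (v n x))\<^sup>2)"
    by (simp add: z)
qed auto

lemma square_summable_diff:
  assumes "square_summable u" "square_summable v"
  shows "square_summable (\<lambda>n x. u n x - v n x)"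
  using square_summable_add[OF assms(1) square_summable_scale[OF assms(2), of "-1"]] by simp

text \<open>The scalar functions take time first, lattice points put space first; the bijection
  exchanges the two.\<close>

lemma summable_on_even_points:
  "f summable_on {z. even (fst z) \<and> even (snd z)} \<longleftrightarrow> (\<lambda>(n, x). f (2 * x, 2 * n)) summable_on (UNIV :: (int \<times> int) set)"
proof -
  have "bij_betw (\<lambda>(n, x). (2 * x, 2 * n)) (UNIV :: (int \<times> int) set) {z. even (fst z) \<and> even (snd z)}"
    by (rule bij_betw_byWitness[where f' = "\<lambda>(i, j). (j div 2, i div 2)"]) auto
  from summable_on_reindex_bij_betw[OF this, of f] show ?thesis by (simp add: case_prod_unfold)
qed

lemma square_summable_even_points:
  "(\<lambda>z. (cmod (A1 z))\<^sup>2 + (cmod (A2 z))\<^sup>2) summable_on {z. even (fst z) \<and> even (snd z)}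
    \<longleftrightarrow> square_summable (\<lambda>n x. A1 (2 * x, 2 * n)) \<and> square_summable (\<lambda>n x. A2 (2 * x, 2 * n))"
  (is "?l \<longleftrightarrow> _")
proof
  assume ?l
  then have *: "(\<lambda>(n, x). (cmod (A1 (2 * x, 2 * n)))\<^sup>2 + (cmod (A2 (2 * x, 2 * n)))\<^sup>2) summable_on (UNIV :: (int \<times> int) set)"
    by (simp add: summable_on_even_points)
  show "square_summable (\<lambda>n x. A1 (2 * x, 2 * n)) \<and> square_summable (\<lambda>n x. A2 (2 * x, 2 * n))"
    unfolding square_summable_def
    by (intro conjI summable_on_comparison_test[OF *]) auto
next
  assume "square_summable (\<lambda>n x. A1 (2 * x, 2 * n)) \<and> square_summable (\<lambda>n x. A2 (2 * x, 2 * n))"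
  then show ?l
    unfolding summable_on_even_points square_summable_def case_prod_unfold
    by (intro summable_on_add) auto
qed

context weights
begin

text \<open>Together with \<open>ax_even2\<close> this is twice an adjugate column for the axiomatic
  double step. The second component is exactly twice \<open>amp_R\<close>; the first differs from
  \<open>2 * \<i>\<close> times \<open>amp_L\<close> only in the term with \<delta>, which sits at
  \<open>x + 1\<close> instead of \<open>x - 1\<close>.\<close>

definition ax_even1 :: "int \<Rightarrow> int \<Rightarrow> complex" where
  "ax_even1 n x = 2 * of_real \<kappa> * (of_real a * green \<kappa> \<mu> n x - \<i> * of_real \<delta> * green \<kappa> \<mu> n (x + 1))"

definition ax_even2 :: "int \<Rightarrow> int \<Rightarrow> complex" where
  "ax_even2 n x = 2 * amp_R (green \<kappa> \<mu>) n x"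

lemma ax_even_equations:
  "ax_even1 n x = of_real \<kappa> * (ax_even1 (n - 1) (x + 1) - \<i> * of_real \<delta> * ax_even2 (n - 1) (x + 1)
      + of_real a * (ax_even2 (n - 1) x + \<i> * of_real \<delta> * ax_even1 (n - 1) x))"
  "ax_even2 n x = of_real \<kappa> * (ax_even2 (n - 1) (x - 1) + \<i> * of_real \<delta> * ax_even1 (n - 1) (x - 1)
      - of_real a * (ax_even1 (n - 1) x - \<i> * of_real \<delta> * ax_even2 (n - 1) x))
      + (if x = 0 \<and> n = 0 then 2 else 0)"
proof -
  let ?k = "complex_of_real \<kappa>" and ?a = "complex_of_real a" and ?d = "complex_of_real \<delta>" and ?g = "green \<kappa> \<mu>"
  have M: "complex_of_real \<mu> = 2 * ?a * ?d * ?k" by (simp add: \<mu>_def)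
  show "ax_even1 n x = ?k * (ax_even1 (n - 1) (x + 1) - \<i> * ?d * ax_even2 (n - 1) (x + 1)
      + ?a * (ax_even2 (n - 1) x + \<i> * ?d * ax_even1 (n - 1) x))"
    unfolding ax_even1_def ax_even2_def amp_R_def by (simp add: algebra_simps)
  have src: "2 * (if n = 0 \<and> x = 0 then 1 else 0) = (if x = 0 \<and> n = 0 then 2 else (0 :: complex))"
    by simp
  have "?k * (ax_even2 (n - 1) (x - 1) + \<i> * ?d * ax_even1 (n - 1) (x - 1)
      - ?a * (ax_even1 (n - 1) x - \<i> * ?d * ax_even2 (n - 1) x)) + 2 * klein_gordon \<kappa> \<mu> ?g n x
    = ax_even2 n x + 2 * (?g (n - 1) x * (1 - ?k\<^sup>2 * ((1 + ?a\<^sup>2) * (1 - ?d\<^sup>2))))"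
    unfolding ax_even1_def ax_even2_def amp_R_def klein_gordon_def M
    by (simp add: algebra_simps power2_eq_square)
  then show "ax_even2 n x = ?k * (ax_even2 (n - 1) (x - 1) + \<i> * ?d * ax_even1 (n - 1) (x - 1)
      - ?a * (ax_even1 (n - 1) x - \<i> * ?d * ax_even2 (n - 1) x)) + (if x = 0 \<and> n = 0 then 2 else 0)"
    unfolding green_equation[OF \<mu>_pos] \<kappa>_sq src by (simp only: diff_self mult_zero_right add_0_right)
qed

lemma square_summable_ax_even: "square_summable ax_even1" "square_summable ax_even2"
proof -
  have g: "square_summable (green \<kappa> \<mu>)"
    unfolding square_summable_def by (rule green_square_summable[OF \<mu>_pos])
  show "square_summable ax_even1"
    unfolding ax_even1_def[abs_def]
    using square_summable_shift[OF g, of 0 1]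
    by (intro square_summable_scale square_summable_diff g) auto
  show "square_summable ax_even2"
    unfolding ax_even2_def[abs_def] amp_R_def
    using square_summable_shift[OF g, of 0 1] square_summable_shift[OF g, of 1 0]
    by (intro square_summable_scale square_summable_diff square_summable_add g) auto
qed

definition ax1 :: "pt \<Rightarrow> complex" where
  "ax1 = (\<lambda>(i, j). let n = j div 2; x = i div 2 in
     if odd (i + j) then 0 else if even i then ax_even1 n x
     else h * (ax_even1 n (x + 1) - \<i> * of_real \<delta> * ax_even2 n (x + 1)))"

definition ax2 :: "pt \<Rightarrow> complex" where
  "ax2 = (\<lambda>(i, j). let n = j div 2; x = i div 2 in
     if odd (i + j) then 0 else if even i then ax_even2 n x
     else h * (ax_even2 n x + \<i> * of_real \<delta> * ax_even1 n x))"

lemma ax_simps: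
  "ax1 (2 * x, 2 * n) = ax_even1 n x" "ax2 (2 * x, 2 * n) = ax_even2 n x"
  "ax1 (2 * x + 1, 2 * n + 1) = h * (ax_even1 n (x + 1) - \<i> * of_real \<delta> * ax_even2 n (x + 1))"
  "ax2 (2 * x + 1, 2 * n + 1) = h * (ax_even2 n x + \<i> * of_real \<delta> * ax_even1 n x)"
  by (simp_all add: ax1_def ax2_def)

text \<open>The axioms in halved coordinates. Odd indices are written as
  \<open>2 * (n - 1) + 1\<close> so that the formulas for odd points apply by plain
  rewriting.\<close>

definition ax_system :: "(pt \<Rightarrow> complex) \<Rightarrow> (pt \<Rightarrow> complex) \<Rightarrow> bool" where
  "ax_system A1 A2 \<longleftrightarrow>
    (\<forall>x n. A1 (2 * x, 2 * n) = c * (A1 (2 * x + 1, 2 * (n - 1) + 1) + of_real a * A2 (2 * x + 1, 2 * (n - 1) + 1))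
     \<and> A2 (2 * x, 2 * n) = c * (A2 (2 * (x - 1) + 1, 2 * (n - 1) + 1) - of_real a * A1 (2 * (x - 1) + 1, 2 * (n - 1) + 1))
         + (if x = 0 \<and> n = 0 then 2 else 0)
     \<and> A1 (2 * x + 1, 2 * n + 1) = h * (A1 (2 * (x + 1), 2 * n) - \<i> * of_real \<delta> * A2 (2 * (x + 1), 2 * n))
     \<and> A2 (2 * x + 1, 2 * n + 1) = h * (A2 (2 * x, 2 * n) + \<i> * of_real \<delta> * A1 (2 * x, 2 * n)))
    \<and> square_summable (\<lambda>n x. A1 (2 * x, 2 * n)) \<and> square_summable (\<lambda>n x. A2 (2 * x, 2 * n))
    \<and> (\<forall>z. odd (fst z + snd z) \<longrightarrow> A1 z = 0 \<and> A2 z = 0)"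

lemma all_even_iff: "(\<forall>i j :: int. even i \<and> even j \<longrightarrow> P i j) \<longleftrightarrow> (\<forall>x n. P (2 * x) (2 * n))"
  by (auto elim!: evenE)

lemma all_odd_iff: "(\<forall>i j :: int. odd i \<and> odd j \<longrightarrow> P i j) \<longleftrightarrow> (\<forall>x n. P (2 * x + 1) (2 * n + 1))"
  by (auto elim!: oddE)

lemma ax_conds_iff:
  assumes me: "m * \<epsilon> = a"
  shows "ax_conds m \<epsilon> \<delta> A1 A2 \<longleftrightarrow> ax_system A1 A2"
proof -
  have me2: "m\<^sup>2 * \<epsilon>\<^sup>2 = a\<^sup>2" by (simp add: me[symmetric] power_mult_distrib)
  have c: "z / complex_of_real (sqrt (1 + a\<^sup>2)) = c * z" and h: "z / complex_of_real (sqrt (1 - \<delta>\<^sup>2)) = h * z" for z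
    by (simp_all add: c_def h_def)
  have idx: "2 * (n - 1) + 1 = 2 * n - 1" "2 * (n + 1) = 2 * n + 1 + 1" "2 * n + 1 - 1 = 2 * n"
    "2 * n = 0 \<longleftrightarrow> n = 0" for n :: int
    by simp_all
  show ?thesis
    unfolding ax_conds_def all_even_iff all_odd_iff square_summable_even_points me me2 c h ax_system_def idx
    by (simp only: all_conj_distrib conj_ac)
qed

lemma ax_system_solution: "ax_system ax1 ax2"
proof -
  have "ax1 z = 0 \<and> ax2 z = 0" if "odd (fst z + snd z)" for z
    using that by (cases z) (simp add: ax1_def ax2_def Let_def)
  moreover have "ax_even1 n x = c * (h * (ax_even1 (n - 1) (x + 1) - \<i> * of_real \<delta> * ax_even2 (n - 1) (x + 1))
      + of_real a * (h * (ax_even2 (n - 1) x + \<i> * of_real \<delta> * ax_even1 (n - 1) x)))" for n x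
    by (subst ax_even_equations(1)) (simp add: ch[symmetric] algebra_simps)
  moreover have "ax_even2 n x = c * (h * (ax_even2 (n - 1) (x - 1) + \<i> * of_real \<delta> * ax_even1 (n - 1) (x - 1))
      - of_real a * (h * (ax_even1 (n - 1) (x - 1 + 1) - \<i> * of_real \<delta> * ax_even2 (n - 1) (x - 1 + 1))))
      + (if x = 0 \<and> n = 0 then 2 else 0)" for n x
    by (subst ax_even_equations(2)) (simp add: ch[symmetric] algebra_simps)
  ultimately show ?thesis
    unfolding ax_system_def ax_simps using square_summable_ax_even by blast
qed

text \<open>On even points the difference of two solutions loses the source and stays square
  summable, so both components vanish by the scalar uniqueness. Odd points are determined by even
  ones, and the values off the lattice are fixed to 0, so the solution is unique as a pair of
  functions.\<close>

lemma ax_system_unique: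
  assumes A: "ax_system A1 A2" and B: "ax_system B1 B2"
  shows "A1 = B1 \<and> A2 = B2"
proof -
  let ?k = "complex_of_real \<kappa>" and ?a = "complex_of_real a" and ?d = "complex_of_real \<delta>"
  define D1 D2 where "D1 = (\<lambda>n x. A1 (2 * x, 2 * n) - B1 (2 * x, 2 * n))"
    and "D2 = (\<lambda>n x. A2 (2 * x, 2 * n) - B2 (2 * x, 2 * n))"
  have e: "C1 (2 * x, 2 * n) = ?k * (C1 (2 * (x + 1), 2 * (n - 1)) - \<i> * ?d * C2 (2 * (x + 1), 2 * (n - 1))
      + ?a * (C2 (2 * x, 2 * (n - 1)) + \<i> * ?d * C1 (2 * x, 2 * (n - 1))))"
    "C2 (2 * x, 2 * n) = ?k * (C2 (2 * (x - 1), 2 * (n - 1)) + \<i> * ?d * C1 (2 * (x - 1), 2 * (n - 1))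
      - ?a * (C1 (2 * x, 2 * (n - 1)) - \<i> * ?d * C2 (2 * x, 2 * (n - 1)))) + (if x = 0 \<and> n = 0 then 2 else 0)"
    if C: "ax_system C1 C2" for C1 C2 n x
  proof -
    have C': "\<And>x n. C1 (2 * x, 2 * n) = c * (C1 (2 * x + 1, 2 * (n - 1) + 1) + ?a * C2 (2 * x + 1, 2 * (n - 1) + 1))"
      "\<And>x n. C2 (2 * x, 2 * n) = c * (C2 (2 * (x - 1) + 1, 2 * (n - 1) + 1) - ?a * C1 (2 * (x - 1) + 1, 2 * (n - 1) + 1))
         + (if x = 0 \<and> n = 0 then 2 else 0)"
      "\<And>x n. C1 (2 * x + 1, 2 * n + 1) = h * (C1 (2 * (x + 1), 2 * n) - \<i> * ?d * C2 (2 * (x + 1), 2 * n))"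
      "\<And>x n. C2 (2 * x + 1, 2 * n + 1) = h * (C2 (2 * x, 2 * n) + \<i> * ?d * C1 (2 * x, 2 * n))"
      using C unfolding ax_system_def by blast+
    have x: "x - 1 + 1 = x" by simp
    note r = C'(3)[of x "n - 1"] C'(4)[of x "n - 1"] C'(3)[of "x - 1" "n - 1", unfolded x] C'(4)[of "x - 1" "n - 1"]
    show "C1 (2 * x, 2 * n) = ?k * (C1 (2 * (x + 1), 2 * (n - 1)) - \<i> * ?d * C2 (2 * (x + 1), 2 * (n - 1))
      + ?a * (C2 (2 * x, 2 * (n - 1)) + \<i> * ?d * C1 (2 * x, 2 * (n - 1))))"
      unfolding C'(1)[of x n] r ch[symmetric] by (simp only: ring_distribs mult_ac)
    show "C2 (2 * x, 2 * n) = ?k * (C2 (2 * (x - 1), 2 * (n - 1)) + \<i> * ?d * C1 (2 * (x - 1), 2 * (n - 1))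
      - ?a * (C1 (2 * x, 2 * (n - 1)) - \<i> * ?d * C2 (2 * x, 2 * (n - 1)))) + (if x = 0 \<and> n = 0 then 2 else 0)"
      unfolding C'(2)[of x n] r ch[symmetric] by (simp only: ring_distribs mult_ac)
  qed
  have s1: "D1 n x = ?k * (D1 (n - 1) (x + 1) - \<i> * ?d * D2 (n - 1) (x + 1)
      + ?a * (D2 (n - 1) x + \<i> * ?d * D1 (n - 1) x))" for n x
    unfolding D1_def D2_def
    by (subst e(1)[OF A], subst e(1)[OF B]) (simp only: ring_distribs mult_ac add_ac diff_conv_add_uminus minus_add_distrib mult_minus_right minus_minus)
  have s2: "D2 n x = ?k * (D2 (n - 1) (x - 1) + \<i> * ?d * D1 (n - 1) (x - 1)
      - ?a * (D1 (n - 1) x - \<i> * ?d * D2 (n - 1) x))" for n x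
    unfolding D1_def D2_def
    by (subst e(2)[OF A], subst e(2)[OF B]) (simp add: algebra_simps)
  have sq: "square_summable (\<lambda>n x. C1 (2 * x, 2 * n))" "square_summable (\<lambda>n x. C2 (2 * x, 2 * n))"
    if "ax_system C1 C2" for C1 C2
    using that unfolding ax_system_def by blast+
  have "square_summable D1"
    unfolding D1_def by (rule square_summable_diff[OF sq(1)[OF A] sq(1)[OF B]])
  moreover have "square_summable D2"
    unfolding D2_def by (rule square_summable_diff[OF sq(2)[OF A] sq(2)[OF B]])
  ultimately have D: "D1 n x = 0" "D2 n x = 0" for n x
    unfolding square_summable_def
    using klein_gordon_unique[OF \<mu>_pos _ klein_gordon_of_system(1)[of D1 D2, OF s1 s2]]
      klein_gordon_unique[OF \<mu>_pos _ klein_gordon_of_system(2)[of D1 D2, OF s1 s2]] by blast+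
  have ev: "A1 (2 * x, 2 * n) = B1 (2 * x, 2 * n)" "A2 (2 * x, 2 * n) = B2 (2 * x, 2 * n)" for x n
    using D[of n x] by (simp_all add: D1_def D2_def)
  have od: "A1 (2 * x + 1, 2 * n + 1) = B1 (2 * x + 1, 2 * n + 1)" "A2 (2 * x + 1, 2 * n + 1) = B2 (2 * x + 1, 2 * n + 1)" for x n
  proof -
    have "C1 (2 * x + 1, 2 * n + 1) = h * (C1 (2 * (x + 1), 2 * n) - \<i> * ?d * C2 (2 * (x + 1), 2 * n))"
      "C2 (2 * x + 1, 2 * n + 1) = h * (C2 (2 * x, 2 * n) + \<i> * ?d * C1 (2 * x, 2 * n))"
      if "ax_system C1 C2" for C1 C2
      using that unfolding ax_system_def by blast+
    from this[OF A] this[OF B]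
    show "A1 (2 * x + 1, 2 * n + 1) = B1 (2 * x + 1, 2 * n + 1)" "A2 (2 * x + 1, 2 * n + 1) = B2 (2 * x + 1, 2 * n + 1)"
      by (simp_all only: ev)
  qed
  have "A1 (i, j) = B1 (i, j) \<and> A2 (i, j) = B2 (i, j)" for i j
  proof (cases "even (i + j)")
    case True
    show ?thesis
    proof (cases "even i")
      case True
      with \<open>even (i + j)\<close> obtain x n where "i = 2 * x" "j = 2 * n" by (auto elim!: evenE)
      then show ?thesis using ev by simp
    next
      case False
      with \<open>even (i + j)\<close> have "odd j" by simp
      with False obtain x n where "i = 2 * x + 1" "j = 2 * n + 1" by (auto elim!: oddE)
      then show ?thesis using od by simp
    qed
  next
    case False
    have "C1 (i, j) = 0 \<and> C2 (i, j) = 0" if "ax_system C1 C2" for C1 C2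
    proof -
      have "\<forall>z. odd (fst z + snd z) \<longrightarrow> C1 z = 0 \<and> C2 z = 0"
        using that unfolding ax_system_def by blast
      with False show ?thesis by simp
    qed
    from this[OF A] this[OF B] show ?thesis by simp
  qed
  then show ?thesis by auto
qed

lemma ax_prop_eq:
  assumes "m * \<epsilon> = a"
  shows "ax_prop m \<epsilon> \<delta> = (ax1, ax2)"
  unfolding ax_prop_def ax_conds_iff[OF assms]
proof (rule the_equality)
  fix A assume "ax_system (fst A) (snd A)"
  from ax_system_unique[OF this ax_system_solution] show "A = (ax1, ax2)" by (simp add: prod_eq_iff)
qed (simp add: ax_system_solution)

lemma A_ax_eq:
  assumes "m * \<epsilon> = a"
  shows "A_ax k (2 * p, 2 * q) m \<epsilon> \<delta> = (if k = 1 then ax_even1 q p else ax_even2 q p)"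
  by (simp add: A_ax_def ax_prop_eq[OF assms] ax_simps)

end

section \<open>The limits in T and in \<delta>\<close>

lemma (in weights) propagator_tendsto:
  assumes me: "m * \<epsilon> = a"
  shows "(\<lambda>T. propagator a0 (f_edge k T p q) m \<epsilon> \<delta> T) \<longlonglongrightarrow>
    (if k = 2 then amp_R (green \<kappa> \<mu>) q p else amp_L (green \<kappa> \<mu>) q p)"
proof -
  have "(\<lambda>T. if k = 2 then amp_R (torus_green \<kappa> \<mu> T) q p else amp_L (torus_green \<kappa> \<mu> T) q p) \<longlonglongrightarrow>
    (if k = 2 then amp_R (green \<kappa> \<mu>) q p else amp_L (green \<kappa> \<mu>) q p)"
    unfolding amp_L_def amp_R_def
    by (cases "k = 2") (auto intro!: tendsto_intros torus_green_tendsto \<mu>_pos)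
  moreover have "\<forall>\<^sub>F T in sequentially. propagator a0 (f_edge k T p q) m \<epsilon> \<delta> T
      = (if k = 2 then amp_R (torus_green \<kappa> \<mu> T) q p else amp_L (torus_green \<kappa> \<mu> T) q p)"
    using eventually_gt_at_top[of 0]
  proof eventually_elim
    fix T :: nat assume "T > 0"
    from propagator_eq_amp[OF this me, of "k = 2" p q]
    show "propagator a0 (f_edge k T p q) m \<epsilon> \<delta> T
      = (if k = 2 then amp_R (torus_green \<kappa> \<mu> T) q p else amp_L (torus_green \<kappa> \<mu> T) q p)"
      by (simp add: f_edge_def torus_edge_def)
  qed
  ultimately show ?thesis by (simp add: tendsto_cong)
qed

text \<open>Continuity is used on a closed interval that includes \<delta> = 0. At that endpoint
  \<mu> vanishes, but \<kappa> is \<open>1 / sqrt (1 + a\<^sup>2)\<close>, below 1 because a > 0, so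
  the symbol remains in the domain of continuity.\<close>

lemma green_tendsto_zero_delta:
  assumes "a > 0"
  defines "\<kappa> \<equiv> \<lambda>\<delta>. 1 / (sqrt (1 + a\<^sup>2) * sqrt (1 - \<delta>\<^sup>2))"
  shows "((\<lambda>\<delta>. green (\<kappa> \<delta>) (2 * a * \<delta> * \<kappa> \<delta>) n x) \<longlongrightarrow> green (\<kappa> 0) 0 n x) (at_right 0)"
    and "(\<kappa> \<longlongrightarrow> \<kappa> 0) (at_right 0)"
proof -
  \<comment> \<open>Any upper end strictly between 0 and 1 would serve; it keeps
    \<open>sqrt (1 - \<delta>\<^sup>2)\<close> away from zero.\<close>
  let ?U = "{0..1 / 2 :: real}"
  have sq: "\<delta>\<^sup>2 < 1" if "\<delta> \<in> ?U" for \<delta> using that by (simp add: abs_square_less_1)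
  have a2: "1 + a\<^sup>2 > 0" by (simp add: add_pos_nonneg)
  have \<kappa>: "continuous_on ?U \<kappa>"
    unfolding \<kappa>_def
  proof (intro continuous_intros ballI)
    fix \<delta> assume "\<delta> \<in> ?U"
    then have "1 - \<delta>\<^sup>2 > 0" using sq by simp
    then show "sqrt (1 + a\<^sup>2) * sqrt (1 - \<delta>\<^sup>2) \<noteq> 0" using a2 by simp
  qed
  have pos: "\<kappa> \<delta> > 0" if "\<delta> \<in> ?U" for \<delta> using sq[OF that] a2 by (simp add: \<kappa>_def)
  have s: "sqrt (1 + a\<^sup>2) > 1" using \<open>a > 0\<close> by simp
  then have "\<bar>\<kappa> 0\<bar> = 1 / sqrt (1 + a\<^sup>2)" by (simp add: \<kappa>_def)
  also have "\<dots> < 1" using s by (subst divide_less_eq_1_pos) linarith+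
  finally have lt: "\<bar>\<kappa> 0\<bar> < 1" .
  have lim: "(f \<longlongrightarrow> f 0) (at_right 0)" if "continuous_on ?U f" for f :: "real \<Rightarrow> 'b::topological_space"
  proof -
    have "(f \<longlongrightarrow> f 0) (at 0 within ?U)" using that unfolding continuous_on_def by (rule bspec) simp
    then show ?thesis by (simp add: at_within_Icc_at_right)
  qed
  have "continuous_on ?U (\<lambda>\<delta>. green (\<kappa> \<delta>) (2 * a * \<delta> * \<kappa> \<delta>) n x)"
  proof (rule continuous_on_green_param)
    fix \<delta> assume \<delta>: "\<delta> \<in> ?U"
    show "2 * a * \<delta> * \<kappa> \<delta> > 0 \<or> 2 * a * \<delta> * \<kappa> \<delta> = 0 \<and> \<bar>\<kappa> \<delta>\<bar> < 1"
      using pos[OF \<delta>] lt \<delta> \<open>a > 0\<close> by (cases "\<delta> = 0") auto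
  qed (intro continuous_intros \<kappa>)+
  from lim[OF this]
  show "((\<lambda>\<delta>. green (\<kappa> \<delta>) (2 * a * \<delta> * \<kappa> \<delta>) n x) \<longlongrightarrow> green (\<kappa> 0) 0 n x) (at_right 0)"
    by simp
  show "(\<kappa> \<longlongrightarrow> \<kappa> 0) (at_right 0)" by (rule lim[OF \<kappa>])
qed

theorem theorem4:
  shows "(\<forall>T::nat. \<forall>\<epsilon> m \<delta> :: real. T > 0 \<and> \<epsilon> > 0 \<and> m > 0 \<and> 0 < \<delta> \<and> \<delta> < 1
            \<longrightarrow> denom T m \<epsilon> \<delta> \<noteq> 0)
       \<and> (\<forall>\<epsilon> m :: real. \<forall>p q :: int. \<forall>k::nat. \<epsilon> > 0 \<and> m > 0 \<and> k \<in> {1, 2} \<longrightarrow>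
            (\<exists>L. (\<forall>\<^sub>F \<delta> in at_right 0.
                    convergent (\<lambda>T. propagator a0 (f_edge k T p q) m \<epsilon> \<delta> T))
                 \<and> ((\<lambda>\<delta>. lim (\<lambda>T. propagator a0 (f_edge k T p q) m \<epsilon> \<delta> T)) \<longlongrightarrow> L) (at_right 0)
                 \<and> - 2 * (- \<i>) ^ k * L = A_tilde k p q m \<epsilon>))"
proof (intro conjI allI impI)
  fix T :: nat and \<epsilon> m \<delta> :: real
  assume "T > 0 \<and> \<epsilon> > 0 \<and> m > 0 \<and> 0 < \<delta> \<and> \<delta> < 1"
  then have T: "T > 0" and w: "weights (m * \<epsilon>) \<delta>" by (auto simp: weights_def)
  show "denom T m \<epsilon> \<delta> \<noteq> 0" by (rule weights.denom_nonzero[OF w T refl])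
next
  fix \<epsilon> m :: real and p q :: int and k :: nat
  assume "\<epsilon> > 0 \<and> m > 0 \<and> k \<in> {1, 2}"
  then have k: "k = 1 \<or> k = 2" and a: "m * \<epsilon> > 0" by auto
  define a where "a = m * \<epsilon>"
  define \<kappa> where "\<kappa> = (\<lambda>\<delta>. 1 / (sqrt (1 + a\<^sup>2) * sqrt (1 - \<delta>\<^sup>2)))"
  define G where "G = (\<lambda>\<delta>. green (\<kappa> \<delta>) (2 * a * \<delta> * \<kappa> \<delta>))"
  define g where "g = green (\<kappa> 0) 0"
  define R where "R = g (q + 1) p - of_real (\<kappa> 0) * g q (p + 1)"
  have "a > 0" and me: "m * \<epsilon> = a" using a by (simp_all add: a_def)
  have G: "((\<lambda>\<delta>. G \<delta> n x) \<longlongrightarrow> g n x) (at_right 0)" for n x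
    unfolding G_def g_def \<kappa>_def by (rule green_tendsto_zero_delta(1)[OF \<open>a > 0\<close>])
  have \<kappa>: "((\<lambda>\<delta>. complex_of_real (\<kappa> \<delta>)) \<longlongrightarrow> of_real (\<kappa> 0)) (at_right 0)"
    unfolding \<kappa>_def by (intro tendsto_of_real green_tendsto_zero_delta(2)[OF \<open>a > 0\<close>])
  have \<delta>: "(complex_of_real \<longlongrightarrow> 0) (at_right 0)"
    using tendsto_of_real[OF tendsto_ident_at[of 0 "{0<..}"], where ?'a = complex] by simp
  have ev: "\<forall>\<^sub>F \<delta> in at_right (0 :: real). weights a \<delta>"
    using \<open>a > 0\<close> by (auto simp: weights_def eventually_at_right_field intro!: exI[of _ 1])
  have loc: "weights.\<kappa> a \<delta> = \<kappa> \<delta>" "weights.\<mu> a \<delta> = 2 * a * \<delta> * \<kappa> \<delta>" if "weights a \<delta>" for \<delta>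
    using weights.\<kappa>_def[OF that] weights.\<mu>_def[OF that] by (simp_all add: \<kappa>_def)
  have Gf: "green (\<kappa> \<delta>) (2 * a * \<delta> * \<kappa> \<delta>) = G \<delta>" for \<delta> by (simp add: G_def)
  define L where "L = (if k = 2 then R else of_real (\<kappa> 0) * (- \<i> * of_real a * g q p))"
  define amp where "amp = (\<lambda>\<delta>. if k = 2
      then G \<delta> (q + 1) p - of_real (\<kappa> \<delta>) * (G \<delta> q (p + 1) + \<i> * of_real a * of_real \<delta> * G \<delta> q p)
      else of_real (\<kappa> \<delta>) * (- \<i> * of_real a * G \<delta> q p - of_real \<delta> * G \<delta> q (p - 1)))"
  have lim: "(\<lambda>T. propagator a0 (f_edge k T p q) m \<epsilon> \<delta> T) \<longlonglongrightarrow> amp \<delta>" if w: "weights a \<delta>" for \<delta>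
    using weights.propagator_tendsto[OF w me, of k p q]
    unfolding weights.amp_L_def[OF w] weights.amp_R_def[OF w] loc[OF w] Gf amp_def .
  \<comment> \<open>\<open>L\<close> is rewritten with explicit zeros in place of \<delta>, so that
    the limit rules match \<open>amp\<close> term by term.\<close>
  have L: "L = (if k = 2
      then g (q + 1) p - of_real (\<kappa> 0) * (g q (p + 1) + \<i> * of_real a * 0 * g q p)
      else of_real (\<kappa> 0) * (- \<i> * of_real a * g q p - 0 * g q (p - 1)))"
    by (simp add: L_def R_def)
  have amp: "(amp \<longlongrightarrow> L) (at_right 0)"
    unfolding L amp_def
    by (cases "k = 2"; simp only: simp_thms if_True if_False; intro tendsto_intros G \<kappa> \<delta>)

  define ax where "ax = (\<lambda>\<delta>. if k = 1
      then 2 * of_real (\<kappa> \<delta>) * (of_real a * G \<delta> q p - \<i> * of_real \<delta> * G \<delta> q (p + 1))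
      else 2 * (G \<delta> (q + 1) p - of_real (\<kappa> \<delta>) * (G \<delta> q (p + 1) + \<i> * of_real a * of_real \<delta> * G \<delta> q p)))"
  have ax_eq: "A_ax k (2 * p, 2 * q) m \<epsilon> \<delta> = ax \<delta>" if w: "weights a \<delta>" for \<delta>
    using weights.A_ax_eq[OF w me, of k p q]
    unfolding weights.ax_even1_def[OF w] weights.ax_even2_def[OF w] weights.amp_R_def[OF w] loc[OF w] Gf ax_def .
  have "(ax \<longlongrightarrow> (if k = 1
      then 2 * of_real (\<kappa> 0) * (of_real a * g q p - \<i> * 0 * g q (p + 1))
      else 2 * (g (q + 1) p - of_real (\<kappa> 0) * (g q (p + 1) + \<i> * of_real a * 0 * g q p)))) (at_right 0)"
    unfolding ax_def
    by (cases "k = 1"; simp only: simp_thms if_True if_False; intro tendsto_intros G \<kappa> \<delta>)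
  \<comment> \<open>For k = 1 the factor 2i meets the -i in \<open>L\<close> and gives 2; for k = 2
    the factor is 2 already. The terms in which the two models differ carry the factor 0.\<close>
  moreover have "- 2 * (- \<i>) ^ k * L = (if k = 1
      then 2 * of_real (\<kappa> 0) * (of_real a * g q p - \<i> * 0 * g q (p + 1))
      else 2 * (g (q + 1) p - of_real (\<kappa> 0) * (g q (p + 1) + \<i> * of_real a * 0 * g q p)))"
    using k by (auto simp: L_def R_def power2_eq_square)
  ultimately have "(ax \<longlongrightarrow> - 2 * (- \<i>) ^ k * L) (at_right 0)" by simp
  moreover have "\<forall>\<^sub>F \<delta> in at_right 0. A_ax k (2 * p, 2 * q) m \<epsilon> \<delta> = ax \<delta>"
    using ev by eventually_elim (rule ax_eq)
  ultimately have "((\<lambda>\<delta>. A_ax k (2 * p, 2 * q) m \<epsilon> \<delta>) \<longlongrightarrow> - 2 * (- \<i>) ^ k * L) (at_right 0)"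
    by (simp only: tendsto_cong)
  then have "A_tilde k p q m \<epsilon> = - 2 * (- \<i>) ^ k * L"
    unfolding A_tilde_def by (intro tendsto_Lim) auto
  moreover have "\<forall>\<^sub>F \<delta> in at_right 0. convergent (\<lambda>T. propagator a0 (f_edge k T p q) m \<epsilon> \<delta> T)"
    using ev by eventually_elim (rule convergentI[OF lim])
  moreover have "((\<lambda>\<delta>. lim (\<lambda>T. propagator a0 (f_edge k T p q) m \<epsilon> \<delta> T)) \<longlongrightarrow> L) (at_right 0)"
  proof -
    have "\<forall>\<^sub>F \<delta> in at_right 0. lim (\<lambda>T. propagator a0 (f_edge k T p q) m \<epsilon> \<delta> T) = amp \<delta>"
      using ev by eventually_elim (rule limI[OF lim])
    then show ?thesis using amp by (simp only: tendsto_cong)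
  qed
  ultimately show "\<exists>L. (\<forall>\<^sub>F \<delta> in at_right 0. convergent (\<lambda>T. propagator a0 (f_edge k T p q) m \<epsilon> \<delta> T))
      \<and> ((\<lambda>\<delta>. lim (\<lambda>T. propagator a0 (f_edge k T p q) m \<epsilon> \<delta> T)) \<longlongrightarrow> L) (at_right 0)
      \<and> - 2 * (- \<i>) ^ k * L = A_tilde k p q m \<epsilon>"
    by (intro exI[of _ L] conjI) simp_all
qed

end
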